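(* Let $G=Sp(4,\mathbb{C})$, with weight lattice $P(R)=L=\mathbb{Z}^2$ and root lattice $Q(R)$, and let $\varpi_2$ be the longest fundamental weight. Let $(\lambda,\mu,\nu)\in\mathcal{P}(G)\cap L^3$ satisfy $\lambda+\mu+\nu\in Q(R)$. Then $(\lambda,\mu,\nu)\in Tens(G)$ if and only if one of the following is satisfied: 1. at least two of the vectors $\lambda,\mu,\nu$ are not multiples of $\varpi_2$; 2. (at least) two of the vectors $\lambda,\mu,\nu$ are multiples of $\varpi_2$, and $\lambda+\mu+\nu\in 2P(R)$.
   Context: Coordinates for $G=Sp(4,\mathbb{C})$ (root system $C_2$) on $V=\mathbb{R}^2$: the weight lattice is $P(R)=L=\mathbb{Z}^2$, the root lattice is $Q(R)=\{(x,y)\in\mathbb{Z}^2: x+y\in2\mathbb{Z}\}$, the fundamental weights are $\varpi_1=(1,0)$, $\varpi_2=(1,1)$, and the positive Weyl chamber is $\Delta=\{(x,y): x\ge y\ge0\}$. $V_\lambda$ denotes the irreducible representation of highest weight $\lambda\in\Delta\cap L$ and $$Tens(G)=\{(\lambda,\mu,\nu)\in(\Delta\cap L)^3: (V_\lambda\otimes V_\mu\otimes V_\nu)^G\ne0\}.$$ $\mathcal{P}(G)=D_3(G/K)\subset\Delta^3$ ($K$ a maximal compact subgroup) is the convex polyhedral cone of triples of $\Delta$-valued side lengths of oriented geodesic triangles in the symmetric space $G/K$. Explicitly, it is the set of triples $((x_1,y_1),(x_2,y_2),(x_3,y_3))\in\Delta^3$ satisfying, with $S=x_1+y_1+x_2+y_2+x_3+y_3$,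 $$x_i\le x_j+x_k,\qquad y_i\le y_j+x_k\qquad\text{whenever }\{i,j,k\}=\{1,2,3\},$$ $$x_i+y_j\le S/2\qquad\text{for all }1\le i,j\le3.$$ *)

theory Defs
  imports
    "HOL-Analysis.Product_Vector"
    "Jordan_Normal_Form.VS_Connect"
begin

section \<open>Weights\<close>

text \<open>The weight \<open>(x, y)\<close> is the torus character \<open>diag(s, t, 1/t, 1/s) \<mapsto> s\<^sup>x t\<^sup>y\<close>;
  the type \<open>weight\<close> itself is the lattice \<open>L = P(R)\<close>.\<close>

type_synonym weight = "int \<times> int"

definition real_pt :: "weight \<Rightarrow> real \<times> real" where
  "real_pt l = (real_of_int (fst l), real_of_int (snd l))"

definition root_lattice :: "weight set" where
  "root_lattice = {(x, y). even (x + y)}"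

definition twice_weight_lattice :: "weight set" where
  "twice_weight_lattice = {k + k | k. True}"

definition fund_weight2 :: weight where
  "fund_weight2 = (1, 1)"

definition multiple_of_fund_weight2 :: "weight \<Rightarrow> bool" where
  "multiple_of_fund_weight2 l \<longleftrightarrow> (\<exists>c::real. real_pt l = c *\<^sub>R real_pt fund_weight2)"

definition chamber :: "(real \<times> real) set" where
  "chamber = {(x, y). x \<ge> y \<and> y \<ge> 0}"

text \<open>The cone of \<open>\<Delta>\<close>-valued side lengths of oriented geodesic triangles in \<open>G/K\<close>,
  given by its explicit system of inequalities; the three sides are numbered 0, 1, 2.\<close>

definition triangle_cone :: "((real \<times> real) \<times> (real \<times> real) \<times> (real \<times> real)) set" where
  "triangle_cone = {(p, q, r). p \<in> chamber \<and> q \<in> chamber \<and> r \<in> chamber \<and>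
     (let x = (\<lambda>i. fst ([p, q, r] ! i));
          y = (\<lambda>i. snd ([p, q, r] ! i));
          S = (\<Sum>i<3. x i + y i)
      in (\<forall>i j k. {i, j, k} = {0, 1, 2::nat} \<longrightarrow> x i \<le> x j + x k \<and> y i \<le> y j + x k) \<and>
         (\<forall>i<3. \<forall>j<3. x i + y j \<le> S / 2))}"


section \<open>The group Sp(4) and its rational representations\<close>

text \<open>The symplectic form is antidiagonal, so that the upper triangular matrices in \<open>Sp(4)\<close>
  form a Borel subgroup and the diagonal ones a maximal torus. The simple roots are then
  \<open>(1, -1)\<close> and \<open>(0, 2)\<close>.\<close>

definition symp_form :: "complex mat" where
  "symp_form = mat 4 4 (\<lambda>(i, j). if i + j = 3 then (if i < j then 1 else - 1) else 0)"

definition Sp4 :: "complex mat monoid" where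
  "Sp4 = \<lparr>carrier = {g \<in> carrier_mat 4 4. transpose_mat g * symp_form * g = symp_form},
          mult = (*), one = 1\<^sub>m 4\<rparr>"

definition torus_elt :: "complex \<Rightarrow> complex \<Rightarrow> complex mat" where
  "torus_elt s t = mat_diag 4 (\<lambda>i. [s, t, inverse t, inverse s] ! i)"

definition max_unipotent :: "complex mat set" where
  "max_unipotent = {g \<in> carrier Sp4. upper_triangular g \<and> (\<forall>i<4. g $$ (i, i) = 1)}"

text \<open>Polynomials in the matrix entries. Since \<open>det = 1\<close> on \<open>Sp(4)\<close>, their restrictions are
  all the regular functions on the group.\<close>

inductive_set entry_polys :: "(complex mat \<Rightarrow> complex) set" where
  const: "(\<lambda>_. c) \<in> entry_polys"
| entry: "i < 4 \<Longrightarrow> j < 4 \<Longrightarrow> (\<lambda>g. g $$ (i, j)) \<in> entry_polys"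
| add: "p \<in> entry_polys \<Longrightarrow> q \<in> entry_polys \<Longrightarrow> (\<lambda>g. p g + q g) \<in> entry_polys"
| mult: "p \<in> entry_polys \<Longrightarrow> q \<in> entry_polys \<Longrightarrow> (\<lambda>g. p g * q g) \<in> entry_polys"

text \<open>Rational representations of \<open>Sp(4)\<close> on the coordinate space of dimension \<open>n\<close>.
  The units of the matrix ring are \<open>GL(n)\<close>.\<close>

definition rational_rep :: "nat \<Rightarrow> (complex mat \<Rightarrow> complex mat) \<Rightarrow> bool" where
  "rational_rep n \<rho> \<longleftrightarrow>
     \<rho> \<in> hom Sp4 (units_of (ring_mat TYPE(complex) n ())) \<and>
     (\<forall>i<n. \<forall>j<n. \<exists>p\<in>entry_polys. \<forall>g\<in>carrier Sp4. \<rho> g $$ (i, j) = p g)"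

definition irreducible_rep :: "nat \<Rightarrow> (complex mat \<Rightarrow> complex mat) \<Rightarrow> bool" where
  "irreducible_rep n \<rho> \<longleftrightarrow> rational_rep n \<rho> \<and> n > 0 \<and>
     (\<forall>W. VectorSpace.subspace class_ring W (module_vec TYPE(complex) n) \<and>
          (\<forall>g\<in>carrier Sp4. \<forall>w\<in>W. \<rho> g *\<^sub>v w \<in> W)
        \<longrightarrow> W = {0\<^sub>v n} \<or> W = carrier_vec n)"

definition highest_weight_vector ::
    "nat \<Rightarrow> (complex mat \<Rightarrow> complex mat) \<Rightarrow> weight \<Rightarrow> complex vec \<Rightarrow> bool" where
  "highest_weight_vector n \<rho> l v \<longleftrightarrow> v \<in> carrier_vec n \<and> v \<noteq> 0\<^sub>v n \<and>
     (\<forall>u\<in>max_unipotent. \<rho> u *\<^sub>v v = v) \<and>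
     (\<forall>s t. s \<noteq> 0 \<longrightarrow> t \<noteq> 0 \<longrightarrow>
        \<rho> (torus_elt s t) *\<^sub>v v = (s powi fst l * t powi snd l) \<cdot>\<^sub>v v)"

text \<open>\<open>\<rho>\<close> is a model of \<open>V\<^sub>l\<close>.\<close>

definition irrep_of_highest_weight ::
    "weight \<Rightarrow> nat \<Rightarrow> (complex mat \<Rightarrow> complex mat) \<Rightarrow> bool" where
  "irrep_of_highest_weight l n \<rho> \<longleftrightarrow>
     irreducible_rep n \<rho> \<and> (\<exists>v. highest_weight_vector n \<rho> l v)"

text \<open>The Kronecker product, i.e. the tensor product of linear maps in the lexicographically
  ordered basis of elementary tensors.\<close>

definition kronecker :: "complex mat \<Rightarrow> complex mat \<Rightarrow> complex mat" where
  "kronecker A B = mat (dim_row A * dim_row B) (dim_col A * dim_col B)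
     (\<lambda>(i, j). A $$ (i div dim_row B, j div dim_col B) * B $$ (i mod dim_row B, j mod dim_col B))"

definition tensor_rep ::
    "(complex mat \<Rightarrow> complex mat) \<Rightarrow> (complex mat \<Rightarrow> complex mat) \<Rightarrow> complex mat \<Rightarrow> complex mat" where
  "tensor_rep \<rho> \<sigma> g = kronecker (\<rho> g) (\<sigma> g)"

definition invariants :: "nat \<Rightarrow> (complex mat \<Rightarrow> complex mat) \<Rightarrow> complex vec set" where
  "invariants n \<rho> = {v \<in> carrier_vec n. \<forall>g\<in>carrier Sp4. \<rho> g *\<^sub>v v = v}"

text \<open>The representation of a given dominant highest weight exists and is unique up to
  isomorphism, so it does not matter which models of it are used.\<close>

definition Tens :: "(weight \<times> weight \<times> weight) set" where
  "Tens = {(l, m, k). real_pt l \<in> chamber \<and> real_pt m \<in> chamber \<and> real_pt k \<in> chamber \<and>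
     (\<exists>a b c \<rho> \<sigma> \<tau>.
        irrep_of_highest_weight l a \<rho> \<and> irrep_of_highest_weight m b \<sigma> \<and>
        irrep_of_highest_weight k c \<tau> \<and>
        invariants (a * b * c) (tensor_rep (tensor_rep \<rho> \<sigma>) \<tau>) \<noteq> {0\<^sub>v (a * b * c)})}"

end

theory Submission
  imports Defs "HOL-Computational_Algebra.Polynomial" "HOL-Library.Function_Algebras"
begin

text \<open>
  A vector of \<open>V\<^sub>\<lambda>\<close> is a function on the group that is equivariant under the lower triangular Borel
  subgroup, so an invariant in \<open>V\<^sub>\<lambda> \<otimes> V\<^sub>\<mu> \<otimes> V\<^sub>\<nu>\<close> is a function of three flags
  \<open>(u\<^sub>i, p\<^sub>i)\<close> (a line in a Lagrangian plane of \<open>\<complex>\<^sup>4\<close>) that is invariant under the diagonal action.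

  Twelve such functions are explicit: the symplectic products of two lines, the pairings of two
  planes, the contractions of two lines against the third plane, and the contractions of a line, taken
  twice, against the other two planes. They are simultaneously nonzero at one triple, so all their
  monomials are nonzero. A lattice point of the cone whose sum is in the root lattice is the degree of
  such a monomial except for one parity obstruction, which occurs only if two of the weights are
  multiples of \<open>\<varpi>\<^sub>2\<close>.

  In that case two of the flags only enter through their planes. For three planes in general position
  and a line in one of them there is a group element that preserves the whole configuration and has
  determinant \<open>-1\<close> on each plane; hence the invariant is equal to its negative.

  Irreducibility and highest weight covectors both come from one contraction argument: the rescaled
  action of a strictly dominant one-parameter subgroup converges to the projection onto the line of the
  highest weight vector.
\<close>

section \<open>Four by four matrices\<close>

text \<open>The two directions treat \<open>Tens\<close> differently. For existence the
  representations may be chosen, so the one of highest weight \<open>(a + b, b)\<close> is realised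
  concretely: its vectors are the values of forms of bidegree \<open>(a, b)\<close> at finitely many
  group elements \<open>h i\<close>. The obstacle is to see that these points determine every form
  of that bidegree, because the explicit invariants are forms but not visibly combinations of
  translates of \<open>lead a b\<close>; positivity of the kernel
  \<open>lead a b (x * adj y)\<close> supplies this. For vanishing the models are arbitrary
  irreducible representations, of which only a highest weight vector is known; pairing with the
  limit covector \<xi> of the contraction turns their vectors into equivariant functions of the same
  kind. Flags are read off from the rows of a matrix: the lower triangular Borel group multiplies on
  the left and changes the basis of the flag, while the diagonal action multiplies on the right and
  preserves the symplectic products of rows.\<close>

abbreviation sp :: "complex mat set" where
  "sp \<equiv> carrier Sp4"

lemma less_4_iff: "i < (4::nat) \<longleftrightarrow> i = 0 \<or> i = 1 \<or> i = 2 \<or> i = 3"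
  by auto

lemma all_less_4: "(\<forall>i<4. P i) \<longleftrightarrow> P 0 \<and> P 1 \<and> P 2 \<and> P (3::nat)"
  by (auto simp: less_4_iff)

lemma sum_less_4: "(\<Sum>k\<in>{0..<4::nat}. f k) = f 0 + f 1 + f 2 + (f 3 :: 'a::comm_monoid_add)"
  by (simp add: eval_nat_numeral add.assoc)

definition mat4 :: "'a list list \<Rightarrow> 'a mat" where
  "mat4 L = mat 4 4 (\<lambda>(i, j). L ! i ! j)"

lemma mat4_carrier [simp]: "mat4 L \<in> carrier_mat 4 4"
  by (simp add: mat4_def)

lemma mat4_index [simp]: "i < 4 \<Longrightarrow> j < 4 \<Longrightarrow> mat4 L $$ (i, j) = L ! i ! j"
  by (simp add: mat4_def)

lemma mult_carrier_mat_4 [simp]: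
  "A \<in> carrier_mat 4 4 \<Longrightarrow> B \<in> carrier_mat 4 4 \<Longrightarrow> A * B \<in> carrier_mat 4 4"
  by (rule mult_carrier_mat)

lemma mult_index_4:
  assumes "A \<in> carrier_mat 4 4" "B \<in> carrier_mat 4 4" "i < 4" "j < 4"
  shows "(A * B) $$ (i, j) = A $$ (i, 0) * B $$ (0, j) + A $$ (i, 1) * B $$ (1, j)
    + A $$ (i, 2) * B $$ (2, j) + A $$ (i, 3) * B $$ (3, j)"
  using assms by (simp add: scalar_prod_def sum_less_4)

lemma mat_eq_4_iff:
  assumes "A \<in> carrier_mat 4 4" "B \<in> carrier_mat 4 4"
  shows "A = B \<longleftrightarrow> (\<forall>i<4. \<forall>j<4. A $$ (i, j) = B $$ (i, j))"
  using assms by (auto intro!: eq_matI)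

lemma upper_triangular_4_iff:
  assumes "A \<in> carrier_mat 4 4"
  shows "upper_triangular A \<longleftrightarrow> A $$ (1, 0) = 0 \<and> A $$ (2, 0) = 0 \<and> A $$ (2, 1) = 0 \<and>
    A $$ (3, 0) = 0 \<and> A $$ (3, 1) = 0 \<and> A $$ (3, 2) = 0"
proof -
  have 1: "i < (2::nat) \<longleftrightarrow> i = 0 \<or> i = 1" "i < (3::nat) \<longleftrightarrow> i = 0 \<or> i = 1 \<or> i = 2" for i by auto
  have "upper_triangular A \<longleftrightarrow> (\<forall>i<4. \<forall>j<i. A $$ (i, j) = 0)"
    using assms by (auto simp: upper_triangular_def)
  then show ?thesis
    by (auto simp: all_less_4 1)
qed

lemma symp_form_carrier [simp]: "symp_form \<in> carrier_mat 4 4"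
  by (simp add: symp_form_def)

lemma symp_form_dim [simp]: "dim_row symp_form = 4" "dim_col symp_form = 4"
  by (simp_all add: symp_form_def)

lemma symp_form_index [simp]:
  "i < 4 \<Longrightarrow> j < 4 \<Longrightarrow> symp_form $$ (i, j) = (if i + j = 3 then if i < j then 1 else - 1 else 0)"
  by (simp add: symp_form_def)

lemma symp_form_mat4: "symp_form = mat4 [[0,0,0,1],[0,0,1,0],[0,-1,0,0],[-1,0,0,0]]"
  by (subst mat_eq_4_iff) (simp_all add: all_less_4)

text \<open>The symplectic product of row \<open>i\<close> of \<open>g\<close> with row
  \<open>j\<close> of \<open>h\<close>, multiplied out.\<close>

definition row_form :: "complex mat \<Rightarrow> complex mat \<Rightarrow> nat \<Rightarrow> nat \<Rightarrow> complex" where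
  "row_form g h i j = g $$ (i, 0) * h $$ (j, 3) + g $$ (i, 1) * h $$ (j, 2)
     - g $$ (i, 2) * h $$ (j, 1) - g $$ (i, 3) * h $$ (j, 0)"

lemma row_form_index:
  assumes "g \<in> carrier_mat 4 4" "h \<in> carrier_mat 4 4" "i < 4" "j < 4"
  shows "(g * symp_form * transpose_mat h) $$ (i, j) = row_form g h i j"
proof -
  have "(g * symp_form * transpose_mat h) $$ (i, j) =
      (\<Sum>k\<in>{0..<4}. (g * symp_form) $$ (i, k) * transpose_mat h $$ (k, j))"
    using assms by (subst index_mult_mat) (simp_all add: scalar_prod_def)
  also have "\<dots> = row_form g h i j"
    using assms unfolding sum_less_4 
    by (simp add: mult_index_4[of g symp_form] symp_form_carrier row_form_def del: index_mult_mat)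
  finally show ?thesis .
qed

lemma symp_form_square: "symp_form * symp_form = - (1\<^sub>m 4)"
  by (subst mat_eq_4_iff) (simp_all add: all_less_4 mult_index_4 del: index_mult_mat(1))

lemma sp_carrier_mat: "g \<in> sp \<Longrightarrow> g \<in> carrier_mat 4 4"
  by (simp add: Sp4_def)

lemma sp_iff: "g \<in> sp \<longleftrightarrow> g \<in> carrier_mat 4 4 \<and> transpose_mat g * symp_form * g = symp_form"
  by (simp add: Sp4_def)

lemma sp_mult_eq [simp]: "mult Sp4 g h = g * h" and sp_one_eq [simp]: "one Sp4 = 1\<^sub>m 4"
  by (simp_all add: Sp4_def)

text \<open>Since \<open>symp_form\<close> squares to -1, the defining equation exhibits a left
  inverse.\<close>

lemma sp_left_inverse:
  assumes "g \<in> carrier_mat 4 4" "transpose_mat g * symp_form * g = symp_form"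
  shows "- (symp_form * transpose_mat g * symp_form) * g = 1\<^sub>m 4"
proof -
  have "symp_form * transpose_mat g * symp_form * g = symp_form * (transpose_mat g * symp_form * g)"
    using assms(1) by (simp add: assoc_mult_mat[of _ 4 4 _ 4 _ 4])
  also have "\<dots> = - (1\<^sub>m 4)"
    by (simp add: assms(2) symp_form_square)
  finally have "- (symp_form * transpose_mat g * symp_form * g) = 1\<^sub>m 4"
    by simp
  then show ?thesis
    using assms(1) by (subst uminus_mult_left_mat) auto
qed

text \<open>For square matrices a left inverse is a right inverse, which moves the symplectic
  condition from the columns to the rows of \<open>g\<close>, where the flags live.\<close>

lemma sp_iff_transpose:
  "g \<in> sp \<longleftrightarrow> g \<in> carrier_mat 4 4 \<and> g * symp_form * transpose_mat g = symp_form"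
proof -
  have *: "g * symp_form * transpose_mat g = symp_form"
    if g: "g \<in> carrier_mat 4 4" "transpose_mat g * symp_form * g = symp_form" for g :: "complex mat"
  proof -
    let ?S = "symp_form"
    have "- (?S * transpose_mat g * ?S) \<in> carrier_mat 4 4" using g(1) by simp
    from mat_mult_left_right_inverse[OF this g(1) sp_left_inverse[OF g]]
    have "g * - (?S * transpose_mat g * ?S) = 1\<^sub>m 4" .
    then have 1: "g * (?S * transpose_mat g * ?S) = - 1\<^sub>m 4"
      using g(1) by (metis uminus_mult_right_mat mult_carrier_mat symp_form_carrier transpose_carrier_mat carrier_matD uminus_uminus_mat index_mult_mat(2) index_transpose_mat(2))
    have "g * ?S * transpose_mat g * (?S * ?S) = g * (?S * transpose_mat g * ?S) * ?S"
      using g(1) by (simp add: assoc_mult_mat[of _ 4 4 _ 4 _ 4])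
    also have "\<dots> = - ?S" by (simp add: 1 uminus_mult_left_mat[symmetric])
    finally have "- (g * ?S * transpose_mat g) = - ?S"
      using g(1) by (simp add: symp_form_square)
    from arg_cong[OF this, of uminus] show ?thesis by simp
  qed
  have "transpose_mat (transpose_mat g) * symp_form * transpose_mat g = symp_form \<Longrightarrow> g \<in> carrier_mat 4 4 \<Longrightarrow>
     transpose_mat g * symp_form * g = symp_form"
    using *[of "transpose_mat g"] by simp
  then show ?thesis using *[of g] by (auto simp: sp_iff)
qed

lemma sp_transpose: "g \<in> sp \<Longrightarrow> transpose_mat g \<in> sp"
  using sp_iff_transpose[of g] by (simp add: sp_iff)

text \<open>The form is alternating, so six entries of the row equation suffice; explicit matrices
  are checked to be symplectic in this form.\<close>

lemma sp_iff_rows: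
  "g \<in> sp \<longleftrightarrow> g \<in> carrier_mat 4 4 \<and> row_form g g 0 1 = 0 \<and> row_form g g 0 2 = 0 \<and>
     row_form g g 0 3 = 1 \<and> row_form g g 1 2 = 1 \<and> row_form g g 1 3 = 0 \<and> row_form g g 2 3 = 0"
proof -
  have 1: "row_form g g i i = 0" for i by (simp add: row_form_def)
  have 2: "row_form g g i j = - row_form g g j i" for i j by (simp add: row_form_def)
  have "g * symp_form * transpose_mat g = symp_form \<longleftrightarrow>
     (\<forall>i<4. \<forall>j<4. row_form g g i j = symp_form $$ (i, j))" if "g \<in> carrier_mat 4 4"
    using that by (subst mat_eq_4_iff) (simp_all add: row_form_index del: index_mult_mat(1))
  then show ?thesis
    unfolding sp_iff_transpose
    apply (simp add: all_less_4 1)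
    using 2[of 1 0] 2[of 2 0] 2[of 3 0] 2[of 2 1] 2[of 3 1] 2[of 3 2] by auto
qed

lemma sp_one [simp]: "1\<^sub>m 4 \<in> sp"
  by (simp add: sp_iff_rows row_form_def)

lemma sp_mult:
  assumes "g \<in> sp" "h \<in> sp"
  shows "g * h \<in> sp"
proof -
  have c: "g \<in> carrier_mat 4 4" "h \<in> carrier_mat 4 4" 
    using assms by (auto simp: sp_iff)
  have "transpose_mat (g * h) * symp_form * (g * h) = transpose_mat h * (transpose_mat g * symp_form * g) * h"
    using c by (simp add: transpose_mult[of _ 4 4 _ 4] assoc_mult_mat[of _ 4 4 _ 4 _ 4])
  also have "\<dots> = symp_form"
    using assms by (simp only: sp_iff)
  finally show ?thesis using c unfolding sp_iff by simp
qed

lemma sp_assoc: "x \<in> sp \<Longrightarrow> y \<in> sp \<Longrightarrow> z \<in> sp \<Longrightarrow> (x * y) * z = x * (y * z)"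
  using assoc_mult_mat sp_carrier_mat by blast

lemma sp_one_mult: "x \<in> sp \<Longrightarrow> 1\<^sub>m 4 * x = x" "x \<in> sp \<Longrightarrow> x * 1\<^sub>m 4 = x"
  by (simp_all add: left_mult_one_mat[OF sp_carrier_mat] right_mult_one_mat[OF sp_carrier_mat])

lemma sp_inverse:
  assumes "g \<in> sp"
  obtains h where "h \<in> sp" "h * g = 1\<^sub>m 4" "g * h = 1\<^sub>m 4"
proof
  let ?h = "- (symp_form * transpose_mat g * symp_form)"
  have c: "g \<in> carrier_mat 4 4" using assms by (simp add: sp_iff)
  show 1: "?h * g = 1\<^sub>m 4" using assms by (simp add: sp_left_inverse sp_iff)
  have hc: "?h \<in> carrier_mat 4 4" using c by simp
  show 2: "g * ?h = 1\<^sub>m 4"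
    by (rule mat_mult_left_right_inverse[OF hc c 1])
  have "transpose_mat ?h * symp_form * ?h = transpose_mat ?h * (transpose_mat g * symp_form * g) * ?h"
    using assms by (simp add: sp_iff)
  also have "\<dots> = (transpose_mat ?h * transpose_mat g) * symp_form * (g * ?h)"
    using c hc by (simp add: assoc_mult_mat[of _ 4 4 _ 4 _ 4] del: uminus_mult_right_mat uminus_mult_left_mat)
  also have "transpose_mat ?h * transpose_mat g = transpose_mat (g * ?h)"
    using c hc by (subst transpose_mult[of _ 4 4 _ 4]) auto
  finally have "transpose_mat ?h * symp_form * ?h = symp_form"
    unfolding 2 by simp
  then show "?h \<in> sp"
    using hc by (simp add: sp_iff)
qed

text \<open>The source of all invariants: \<open>x\<close> cancels in
  \<open>g * x * symp_form * transpose_mat (h * x)\<close>.\<close>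

lemma row_form_mult:
  assumes "g \<in> carrier_mat 4 4" "h \<in> carrier_mat 4 4" "x \<in> sp" "i < 4" "j < 4"
  shows "row_form (g * x) (h * x) i j = row_form g h i j"
proof -
  have x: "x \<in> carrier_mat 4 4" "x * symp_form * transpose_mat x = symp_form"
    using assms(3) by (auto simp: sp_iff_transpose)
  have "g * x * symp_form * transpose_mat (h * x) = g * (x * symp_form * transpose_mat x) * transpose_mat h"
    using assms x(1) by (simp add: transpose_mult[of _ 4 4 _ 4] assoc_mult_mat[of _ 4 4 _ 4 _ 4])
  then show ?thesis
    using assms x row_form_index[of "g * x" "h * x" i j] row_form_index[of g h i j] by simp
qed

lemma mat_diag_index [simp]: "i < n \<Longrightarrow> j < n \<Longrightarrow> mat_diag n f $$ (i, j) = (if i = j then f j else 0)"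
  by (simp add: mat_diag_def)

lemma torus_elt_carrier [simp]: "torus_elt s t \<in> carrier_mat 4 4"
  by (simp add: torus_elt_def mat_diag_def)

lemma torus_elt_mat4: "torus_elt s t = mat4 [[s,0,0,0],[0,t,0,0],[0,0,inverse t,0],[0,0,0,inverse s]]"
  by (subst mat_eq_4_iff) (simp_all add: all_less_4 torus_elt_def)

lemma torus_elt_sp: "s \<noteq> 0 \<Longrightarrow> t \<noteq> 0 \<Longrightarrow> torus_elt s t \<in> sp"
  by (simp add: sp_iff_rows row_form_def torus_elt_mat4)

text \<open>The root subgroup of the short simple root \<open>(1, -1)\<close>; multiplying from the
  left, it moves the line of a flag inside its plane.\<close>

definition levi_upper :: "complex \<Rightarrow> complex mat" where
  "levi_upper x = mat4 [[1,x,0,0],[0,1,0,0],[0,0,1,-x],[0,0,0,1]]"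

definition levi_lower :: "complex \<Rightarrow> complex mat" where
  "levi_lower x = mat4 [[1,0,0,0],[x,1,0,0],[0,0,1,0],[0,0,-x,1]]"

text \<open>The abelian unipotent radical of the Siegel parabolic; the plane of the first two rows
  is the graph of a symmetric form.\<close>

definition siegel_upper :: "complex \<Rightarrow> complex \<Rightarrow> complex \<Rightarrow> complex mat" where
  "siegel_upper y z w = mat4 [[1,0,y,z],[0,1,w,y],[0,0,1,0],[0,0,0,1]]"

lemma unipotent_sp:
  "levi_upper x \<in> sp" "levi_lower x \<in> sp" "siegel_upper y z w \<in> sp" "symp_form \<in> sp"
  by (simp_all add: sp_iff_rows row_form_def levi_upper_def levi_lower_def siegel_upper_def symp_form_mat4)

lemma unipotent_max_unipotent: "levi_upper x \<in> max_unipotent" "siegel_upper y z w \<in> max_unipotent"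
  using unipotent_sp(1)[of x] unipotent_sp(3)[of y z w]
  by (simp_all add: max_unipotent_def all_less_4 upper_triangular_4_iff levi_upper_def siegel_upper_def)

declare One_nat_def [simp del]

lemma mat4_dim [simp]: "dim_row (mat4 L) = 4" "dim_col (mat4 L) = 4"
  by (simp_all add: mat4_def)

section \<open>Regular functions\<close>

definition regular :: "(complex mat \<Rightarrow> complex) \<Rightarrow> bool" where
  "regular f \<longleftrightarrow> (\<exists>p\<in>entry_polys. \<forall>g\<in>sp. f g = p g)"

lemma regular_const: "regular (\<lambda>_. c)"
  unfolding regular_def by (intro bexI[where x = "\<lambda>_. c"] ballI refl entry_polys.const)

lemma regular_entry: "i < 4 \<Longrightarrow> j < 4 \<Longrightarrow> regular (\<lambda>g. g $$ (i, j))"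
  unfolding regular_def by (intro bexI[where x = "\<lambda>g. g $$ (i, j)"] ballI refl entry_polys.entry)

lemma regular_add:
  assumes "regular f" "regular h" shows "regular (\<lambda>g. f g + h g)"
proof -
  obtain p q where "p \<in> entry_polys" "q \<in> entry_polys" "\<forall>g\<in>sp. f g = p g" "\<forall>g\<in>sp. h g = q g"
    using assms by (auto simp: regular_def)
  then show ?thesis
    unfolding regular_def by (intro bexI[of _ "\<lambda>g. p g + q g"] entry_polys.add) simp_all
qed

lemma regular_mult:
  assumes "regular f" "regular h" shows "regular (\<lambda>g. f g * h g)"
proof -
  obtain p q where "p \<in> entry_polys" "q \<in> entry_polys" "\<forall>g\<in>sp. f g = p g" "\<forall>g\<in>sp. h g = q g"
    using assms by (auto simp: regular_def)
  then show ?thesis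
    unfolding regular_def by (intro bexI[of _ "\<lambda>g. p g * q g"] entry_polys.mult) simp_all
qed

lemma regular_cmult: "regular f \<Longrightarrow> regular (\<lambda>g. c * f g)"
  by (rule regular_mult[OF regular_const])

lemma regular_diff: "regular f \<Longrightarrow> regular h \<Longrightarrow> regular (\<lambda>g. f g - h g)"
  using regular_add[OF _ regular_cmult, of f h "-1"] by simp

lemma regular_sum: "(\<And>i. i \<in> I \<Longrightarrow> regular (f i)) \<Longrightarrow> regular (\<lambda>g. \<Sum>i\<in>I. f i g)"
  by (induction I rule: infinite_finite_induct) (simp_all add: regular_const regular_add)

lemma regular_cong: "(\<And>g. g \<in> sp \<Longrightarrow> f g = h g) \<Longrightarrow> regular f \<longleftrightarrow> regular h"
  by (auto simp: regular_def)

lemma regular_eqE: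
  assumes "regular f"
  obtains p where "p \<in> entry_polys" "\<And>g. g \<in> sp \<Longrightarrow> f g = p g"
  using assms by (auto simp: regular_def)

lemma regular_left_translate:
  assumes "regular f" "h \<in> sp" shows "regular (\<lambda>g. f (h * g))"
proof -
  obtain p where p: "p \<in> entry_polys" "\<And>g. g \<in> sp \<Longrightarrow> f g = p g"
    using regular_eqE[OF assms(1)] by blast
  have "regular (\<lambda>g. p (h * g))"
    using p(1)
  proof induction
    case (entry i j)
    have "regular (\<lambda>g. h $$ (i, 0) * g $$ (0, j) + h $$ (i, 1) * g $$ (1, j)
        + h $$ (i, 2) * g $$ (2, j) + h $$ (i, 3) * g $$ (3, j))"
      using entry by (intro regular_add regular_cmult regular_entry) auto
    then show ?case
      by (rule iffD1[OF regular_cong, rotated])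
        (use entry assms(2) in \<open>simp add: mult_index_4 sp_carrier_mat del: index_mult_mat(1)\<close>)
  qed (simp_all add: regular_const regular_add regular_mult)
  then show ?thesis
    by (rule iffD1[OF regular_cong, rotated]) (use p assms in \<open>simp add: sp_mult\<close>)
qed

lemma regular_right_translate:
  assumes "regular f" "h \<in> sp" shows "regular (\<lambda>g. f (g * h))"
proof -
  obtain p where p: "p \<in> entry_polys" "\<And>g. g \<in> sp \<Longrightarrow> f g = p g"
    using regular_eqE[OF assms(1)] by blast
  have "regular (\<lambda>g. p (g * h))"
    using p(1)
  proof induction
    case (entry i j)
    have "regular (\<lambda>g. h $$ (0, j) * g $$ (i, 0) + h $$ (1, j) * g $$ (i, 1)
        + h $$ (2, j) * g $$ (i, 2) + h $$ (3, j) * g $$ (i, 3))"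
      using entry by (intro regular_add regular_cmult regular_entry) auto
    then show ?case
      by (rule iffD1[OF regular_cong, rotated])
        (use entry assms(2) in \<open>simp add: mult_index_4 sp_carrier_mat mult.commute del: index_mult_mat(1)\<close>)
  qed (simp_all add: regular_const regular_add regular_mult)
  then show ?thesis
    by (rule iffD1[OF regular_cong, rotated]) (use p assms in \<open>simp add: sp_mult\<close>)
qed

lemma regular_tendsto:
  assumes "regular f" "\<And>k. s k \<in> sp" "g \<in> sp"
    and lim: "\<And>i j. i < 4 \<Longrightarrow> j < 4 \<Longrightarrow> ((\<lambda>k. s k $$ (i, j)) \<longlongrightarrow> g $$ (i, j)) F"
  shows "((\<lambda>k. f (s k)) \<longlongrightarrow> f g) F"
proof -
  obtain p where p: "p \<in> entry_polys" "\<And>g. g \<in> sp \<Longrightarrow> f g = p g"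
    using regular_eqE[OF assms(1)] by blast
  have "((\<lambda>k. p (s k)) \<longlongrightarrow> p g) F"
    using p(1) by induction (auto intro!: tendsto_intros lim)
  then show ?thesis using p assms by simp
qed

text \<open>Restriction to a polynomial curve reduces vanishing statements about regular functions
  to polynomials in one variable.\<close>

lemma regular_curve_poly:
  assumes "regular f" "\<And>e. c e \<in> sp"
    and ent: "\<And>i j. i < 4 \<Longrightarrow> j < 4 \<Longrightarrow> \<exists>P. \<forall>e. c e $$ (i, j) = poly P e"
  obtains P where "\<And>e. f (c e) = poly P e"
proof -
  obtain p where p: "p \<in> entry_polys" "\<And>g. g \<in> sp \<Longrightarrow> f g = p g"
    using regular_eqE[OF assms(1)] by blast
  have "\<exists>P. \<forall>e. p (c e) = poly P e"
    using p(1)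
  proof induction
    case (const a)
    then show ?case by (intro exI[of _ "[:a:]"]) simp
  next
    case (add p q)
    then obtain P Q where "\<forall>e. p (c e) = poly P e" "\<forall>e. q (c e) = poly Q e" by blast
    then show ?case by (intro exI[of _ "P + Q"]) simp
  next
    case (mult p q)
    then obtain P Q where "\<forall>e. p (c e) = poly P e" "\<forall>e. q (c e) = poly Q e" by blast
    then show ?case by (intro exI[of _ "P * Q"]) simp
  qed (rule ent)
  then show ?thesis using that p assms by auto
qed

section \<open>The big cell\<close>

text \<open>Pluecker coordinates of the plane spanned by the first two rows.\<close>

definition row_minor :: "nat \<Rightarrow> nat \<Rightarrow> complex mat \<Rightarrow> complex" where
  "row_minor i j g = g $$ (0, i) * g $$ (1, j) - g $$ (0, j) * g $$ (1, i)"

text \<open>The transpose of \<open>exp (e * E)\<close> for the regular nilpotent \<open>E = E\<^sub>1\<^sub>2 + E\<^sub>2\<^sub>3 - E\<^sub>3\<^sub>4\<close>.\<close>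

definition regular_lower :: "complex \<Rightarrow> complex mat" where
  "regular_lower e = mat4 [[1,0,0,0],[e,1,0,0],[e^2/2,e,1,0],[-(e^3)/6,-(e^2)/2,-e,1]]"

lemma regular_lower_sp: "regular_lower e \<in> sp"
  by (simp add: sp_iff_rows row_form_def regular_lower_def power2_eq_square power3_eq_cube)

lemma sp_row_nonzero:
  assumes "g \<in> sp"
  shows "\<not> (g $$ (0, 0) = 0 \<and> g $$ (0, 1) = 0 \<and> g $$ (0, 2) = 0 \<and> g $$ (0, 3) = 0)"
  using assms by (auto simp: sp_iff_rows row_form_def)

text \<open>Isotropy of the first two rows, written in Pluecker coordinates.\<close>

lemma sp_row_minor_03:
  assumes "g \<in> sp" shows "row_minor 0 3 g = - row_minor 1 2 g"
  using assms unfolding sp_iff_rows row_form_def row_minor_def by (simp add: algebra_simps) 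

lemma sp_row_minor_nonzero:
  assumes "g \<in> sp"
  shows "\<not> (row_minor 0 1 g = 0 \<and> row_minor 0 2 g = 0 \<and> row_minor 1 2 g = 0 \<and>
    row_minor 1 3 g = 0 \<and> row_minor 2 3 g = 0)"
proof
  assume z: "row_minor 0 1 g = 0 \<and> row_minor 0 2 g = 0 \<and> row_minor 1 2 g = 0 \<and>
    row_minor 1 3 g = 0 \<and> row_minor 2 3 g = 0"
  define a b where "a = nth [g $$ (2, 3), g $$ (2, 2), - g $$ (2, 1), - g $$ (2, 0)]"
    and "b = nth [g $$ (3, 3), g $$ (3, 2), - g $$ (3, 1), - g $$ (3, 0)]"
  \<comment> \<open>Cauchy-Binet: the determinant of the products of rows 0, 1 with rows 3, 2 is
    linear in the minors; on the group it equals 1.\<close>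
  have "row_form g g 0 3 * row_form g g 1 2 - row_form g g 0 2 * row_form g g 1 3 =
     row_minor 0 1 g * (b 0 * a 1 - a 0 * b 1) + row_minor 0 2 g * (b 0 * a 2 - a 0 * b 2) +
     row_minor 0 3 g * (b 0 * a 3 - a 0 * b 3) + row_minor 1 2 g * (b 1 * a 2 - a 1 * b 2) +
     row_minor 1 3 g * (b 1 * a 3 - a 1 * b 3) + row_minor 2 3 g * (b 2 * a 3 - a 2 * b 3)"
    unfolding row_form_def row_minor_def a_def b_def by (simp add: algebra_simps)
  then show False
    using assms z sp_row_minor_03[OF assms] by (simp add: sp_iff_rows)
qed

text \<open>Each entry of the first row and each minor reappears in a coefficient with a nonzero
  factor; this is why the nilpotent is taken regular. By isotropy the quadratic terms of the minors
  \<open>0 3\<close> and \<open>1 2\<close> add up instead of cancelling.\<close>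

lemma mult_regular_lower_entries:
  assumes "g \<in> sp"
  shows "(g * regular_lower e) $$ (0, 0) = poly [:g $$ (0,0), g $$ (0,1), g $$ (0,2) / 2, - g $$ (0,3) / 6:] e"
    and "row_minor 0 1 (g * regular_lower e) = poly [:row_minor 0 1 g, row_minor 0 2 g, row_minor 1 2 g,
      - row_minor 1 3 g / 3, - row_minor 2 3 g / 12:] e"
proof -
  note [simp] = sp_carrier_mat[OF assms] 
  have c: "regular_lower e \<in> carrier_mat 4 4" by (simp add: regular_lower_def)
  show "(g * regular_lower e) $$ (0, 0) = poly [:g $$ (0,0), g $$ (0,1), g $$ (0,2) / 2, - g $$ (0,3) / 6:] e"
    by (simp add: mult_index_4 c del: index_mult_mat(1))
      (simp add: regular_lower_def field_simps power2_eq_square power3_eq_cube)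
  have "row_minor 0 1 (g * regular_lower e) = row_minor 0 1 g + e * row_minor 0 2 g
     - e^2/2 * row_minor 0 3 g + e^2/2 * row_minor 1 2 g - e^3/3 * row_minor 1 3 g - e^4/12 * row_minor 2 3 g"
    by (simp add: row_minor_def mult_index_4 c del: index_mult_mat(1))
      (simp add: regular_lower_def field_simps power2_eq_square power3_eq_cube power4_eq_xxxx)
  also have "\<dots> = poly [:row_minor 0 1 g, row_minor 0 2 g, row_minor 1 2 g,
      - row_minor 1 3 g / 3, - row_minor 2 3 g / 12:] e"
    by (simp add: sp_row_minor_03[OF assms] field_simps power2_eq_square power3_eq_cube power4_eq_xxxx)
  finally show "row_minor 0 1 (g * regular_lower e) = poly [:row_minor 0 1 g, row_minor 0 2 g, row_minor 1 2 g,
      - row_minor 1 3 g / 3, - row_minor 2 3 g / 12:] e" .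
qed

text \<open>Along the curve \<open>g * regular_lower e\<close> the two functions that cut out the
  cell are nonzero polynomials. Their product with the restriction of \<open>f\<close> is zero,
  hence so is that restriction, and the curve passes through \<open>g\<close> at
  \<open>e = 0\<close>.\<close>

lemma big_cell_dense:
  assumes f: "regular f"
    and zero: "\<And>g. g \<in> sp \<Longrightarrow> g $$ (0, 0) \<noteq> 0 \<Longrightarrow> row_minor 0 1 g \<noteq> 0 \<Longrightarrow> f g = 0"
    and g: "g \<in> sp"
  shows "f g = 0"
proof -
  let ?c = "\<lambda>e. g * regular_lower e"
  have c: "?c e \<in> sp" for e by (intro sp_mult g regular_lower_sp)
  have "\<exists>P. \<forall>e. ?c e $$ (i, j) = poly P e" if "i < 4" "j < 4" for i j
  proof -
    define L :: "complex poly list list" where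
      "L = [[1,0,0,0],[[:0,1:],1,0,0],[[:0,0,1/2:],[:0,1:],1,0],[[:0,0,0,-1/6:],[:0,0,-1/2:],[:0,-1:],1]]"
    have L: "regular_lower e $$ (i, j) = poly (L ! i ! j) e" if "i < 4" "j < 4" for i j e
      using that by (auto simp: less_4_iff regular_lower_def L_def power2_eq_square power3_eq_cube)
    have "?c e $$ (i, j) = poly ([:g $$ (i, 0):] * L!0!j + [:g $$ (i, 1):] * L!1!j
        + [:g $$ (i, 2):] * L!2!j + [:g $$ (i, 3):] * L!3!j) e" for e
      using that by (simp add: mult_index_4 sp_carrier_mat[OF g] sp_carrier_mat[OF regular_lower_sp] L
          del: index_mult_mat(1))
    then show ?thesis by blast
  qed
  then obtain P where P: "\<And>e. f (?c e) = poly P e"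
    using regular_curve_poly[of f ?c] f c by blast
  let ?P1 = "[:g $$ (0,0), g $$ (0,1), g $$ (0,2) / 2, - g $$ (0,3) / 6:]"
  let ?P2 = "[:row_minor 0 1 g, row_minor 0 2 g, row_minor 1 2 g, - row_minor 1 3 g / 3, - row_minor 2 3 g / 12:]"
  have "poly (?P1 * ?P2 * P) e = 0" for e
    using zero[OF c, of e] unfolding mult_regular_lower_entries[OF g] P poly_mult
    by (simp only: mult_eq_0_iff) blast
  then have "?P1 * ?P2 * P = 0"
    using poly_all_0_iff_0 by blast
  moreover have "?P1 \<noteq> 0" "?P2 \<noteq> 0"
    using sp_row_nonzero[OF g] sp_row_minor_nonzero[OF g] by auto
  ultimately have "P = 0" unfolding mult_eq_0_iff by blast
  moreover have "?c 0 = g"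
  proof -
    have "regular_lower 0 = 1\<^sub>m 4"
      by (subst mat_eq_4_iff) (simp_all add: regular_lower_def all_less_4)
    then show ?thesis using sp_carrier_mat[OF g] by simp
  qed
  ultimately show ?thesis using P[of 0] by simp
qed

definition borel_lower :: "complex mat set" where
  "borel_lower = {b \<in> sp. b $$ (0, 1) = 0 \<and> b $$ (0, 2) = 0 \<and> b $$ (0, 3) = 0 \<and>
     b $$ (1, 2) = 0 \<and> b $$ (1, 3) = 0 \<and> b $$ (2, 3) = 0}"

lemma borel_lower_sp: "b \<in> borel_lower \<Longrightarrow> b \<in> sp"
  by (simp add: borel_lower_def)

lemma borel_lower_diag:
  assumes "b \<in> borel_lower"
  shows "b $$ (0, 0) * b $$ (3, 3) = 1" "b $$ (1, 1) * b $$ (2, 2) = 1"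
    "b $$ (0, 0) \<noteq> 0" "b $$ (1, 1) \<noteq> 0"
  using assms by (auto simp: borel_lower_def sp_iff_rows row_form_def)

text \<open>Gaussian elimination by columns. The pivots are \<open>g $$ (0, 0)\<close> and
  \<open>h11\<close>, which is \<open>row_minor 0 1 g\<close> divided by the first pivot.\<close>

lemma big_cell_factor:
  assumes g: "g \<in> sp" and "g $$ (0, 0) \<noteq> 0" "row_minor 0 1 g \<noteq> 0"
  obtains b y z w x where "b \<in> borel_lower" "g = b * (siegel_upper y z w * levi_upper x)"
proof -
  define x where "x = g $$ (0, 1) / g $$ (0, 0)"
  define y where "y = g $$ (0, 2) / g $$ (0, 0)"
  define z where "z = (g $$ (0, 3) + x * g $$ (0, 2)) / g $$ (0, 0)"
  define h11 where "h11 = g $$ (1, 1) - x * g $$ (1, 0)"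
  define w where "w = (g $$ (1, 2) - y * g $$ (1, 0)) / h11"
  have h11: "h11 \<noteq> 0"
    using assms(2,3) by (simp add: h11_def x_def row_minor_def field_simps)
  define m where "m = levi_upper (- x) * siegel_upper (- y) (- z) (- w)"
  define b where "b = g * m"
  have cg: "g \<in> carrier_mat 4 4" by (rule sp_carrier_mat[OF g])
  have c: "levi_upper x \<in> carrier_mat 4 4" "siegel_upper y z w \<in> carrier_mat 4 4" for x y z w
    by (simp_all add: levi_upper_def siegel_upper_def)
  have m: "m \<in> sp" unfolding m_def by (intro sp_mult unipotent_sp)
  have m_eq: "m = mat4 [[1, -x, - y + x * w, - z + x * y], [0, 1, - w, -y], [0, 0, 1, x], [0, 0, 0, 1]]"
    using m by (subst mat_eq_4_iff)
      (simp_all add: sp_carrier_mat, simp add: m_def mult_index_4 c all_less_4 del: index_mult_mat(1),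
        simp add: levi_upper_def siegel_upper_def)
  have b: "b \<in> sp" unfolding b_def by (intro sp_mult g m)
  have ent: "b $$ (i, 0) = g $$ (i, 0)" "b $$ (i, 1) = g $$ (i, 1) - x * g $$ (i, 0)"
    "b $$ (i, 2) = g $$ (i, 2) - y * g $$ (i, 0) - w * b $$ (i, 1)"
    "b $$ (i, 3) = g $$ (i, 3) + x * g $$ (i, 2) - z * g $$ (i, 0) - y * b $$ (i, 1)"
    if "i < 4" for i
    using that by (simp_all add: b_def mult_index_4 cg m_eq algebra_simps del: index_mult_mat(1))
  have b01: "b $$ (0, 1) = 0" and b11: "b $$ (1, 1) = h11"
    using assms(2) by (simp_all add: ent x_def h11_def)
  have 1: "b $$ (0, 2) = 0" "b $$ (0, 3) = 0" "b $$ (1, 2) = 0"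
    using assms(2) h11 by (simp_all add: ent(3,4) b01 b11) (simp_all add: y_def z_def w_def)
  \<comment> \<open>The four parameters clear four entries; the last two vanish because row 0 of
    \<open>b\<close> is orthogonal to rows 1 and 2.\<close>
  have "row_form b b 0 1 = 0" "row_form b b 0 2 = 0" "b $$ (0, 0) \<noteq> 0"
    using b assms(2) by (simp_all add: sp_iff_rows ent(1))
  then have "b $$ (1, 3) = 0" "b $$ (2, 3) = 0"
    using 1 b01 by (auto simp: row_form_def)
  then have "b \<in> borel_lower"
    using b 1 b01 by (simp add: borel_lower_def)
  moreover have "m * (siegel_upper y z w * levi_upper x) = 1\<^sub>m 4"
    using c by (subst mat_eq_4_iff)
      (simp_all add: m_eq all_less_4 mult_index_4 del: index_mult_mat(1), simp add: levi_upper_def siegel_upper_def algebra_simps)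
  then have "b * (siegel_upper y z w * levi_upper x) = g"
    using c cg by (simp add: b_def m_eq assoc_mult_mat[of _ 4 4 _ 4 _ 4])
  ultimately show ?thesis using that by metis
qed

lemma max_unipotent_mult:
  assumes "n \<in> max_unipotent" "m \<in> max_unipotent"
  shows "n * m \<in> max_unipotent"
proof -
  have sp: "n \<in> sp" "m \<in> sp" using assms by (simp_all add: max_unipotent_def)
  then have c: "n \<in> carrier_mat 4 4" "m \<in> carrier_mat 4 4" by (simp_all add: sp_carrier_mat)
  show ?thesis
    using assms sp sp_mult[OF sp] c unfolding max_unipotent_def
    by (simp add: upper_triangular_4_iff mult_index_4 all_less_4 del: index_mult_mat(1))
qed

lemma borel_lower_factor:
  assumes "b \<in> borel_lower"
  obtains n where "transpose_mat n \<in> max_unipotent" "n \<in> sp" "b = n * torus_elt (b $$ (0, 0)) (b $$ (1, 1))"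
proof
  let ?s = "b $$ (0, 0)" and ?t = "b $$ (1, 1)"
  let ?n = "b * torus_elt (inverse ?s) (inverse ?t)"
  have nz: "?s \<noteq> 0" "?t \<noteq> 0" using borel_lower_diag(3,4)[OF assms] by simp_all
  have b: "b \<in> sp" "b \<in> carrier_mat 4 4" using assms by (simp_all add: borel_lower_def sp_carrier_mat)
  show n: "?n \<in> sp" using nz b by (intro sp_mult torus_elt_sp) auto
  have "transpose_mat ?n \<in> sp" by (rule sp_transpose[OF n])
  moreover have nc: "transpose_mat ?n \<in> carrier_mat 4 4" using sp_carrier_mat[OF n] by simp
  ultimately show "transpose_mat ?n \<in> max_unipotent"
    using assms nz borel_lower_diag(1,2)[OF assms] b
    by (simp add: max_unipotent_def all_less_4 upper_triangular_4_iff mult_index_4 borel_lower_def 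
        torus_elt_mat4 mult.commute del: index_mult_mat(1))
  have "torus_elt (inverse ?s) (inverse ?t) * torus_elt ?s ?t = 1\<^sub>m 4"
    using nz by (subst mat_eq_4_iff) (simp_all add: torus_elt_mat4 all_less_4 mult_index_4 del: index_mult_mat(1))
  then show "b = ?n * torus_elt ?s ?t"
    using b by (simp add: assoc_mult_mat[of _ 4 4 _ 4 _ 4])
qed

section \<open>Subspaces and covectors\<close>

definition pairing :: "nat \<Rightarrow> (nat \<Rightarrow> complex) \<Rightarrow> complex vec \<Rightarrow> complex" where
  "pairing n r w = (\<Sum>i<n. r i * w $ i)"

definition subspace_vec :: "nat \<Rightarrow> complex vec set \<Rightarrow> bool" where
  "subspace_vec n W \<longleftrightarrow> W \<subseteq> carrier_vec n \<and> 0\<^sub>v n \<in> W \<and> (\<forall>v\<in>W. \<forall>w\<in>W. v + w \<in> W) \<and>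
     (\<forall>c. \<forall>w\<in>W. c \<cdot>\<^sub>v w \<in> W)"

lemma subspace_vec_iff:
  "VectorSpace.subspace class_ring W (module_vec TYPE(complex) n) \<longleftrightarrow> subspace_vec n W"
  by (simp add: VectorSpace.subspace_def vec_vs submodule_def vec_module subspace_vec_def
      module_vec_simps) blast

lemma pairing_add:
  "v \<in> carrier_vec n \<Longrightarrow> w \<in> carrier_vec n \<Longrightarrow> pairing n r (v + w) = pairing n r v + pairing n r w"
  unfolding pairing_def sum.distrib[symmetric] by (intro sum.cong) (auto simp: distrib_left)

lemma pairing_smult: "w \<in> carrier_vec n \<Longrightarrow> pairing n r (c \<cdot>\<^sub>v w) = c * pairing n r w"
  unfolding pairing_def sum_distrib_left by (intro sum.cong) auto

lemma mult_mat_vec_index: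
  assumes "A \<in> carrier_mat n n" "w \<in> carrier_vec n" "i < n"
  shows "(A *\<^sub>v w) $ i = (\<Sum>j<n. A $$ (i, j) * w $ j)"
  using assms by (simp add: scalar_prod_def atLeast0LessThan)

text \<open>A basis of \<open>W\<close> together with \<open>v\<close> is independent, so the
  coordinate of \<open>v\<close> extends to a linear functional. Membership in subspaces is later
  proved through such covectors.\<close>

lemma separating_covector:
  assumes W: "subspace_vec n W" and v: "v \<in> carrier_vec n" "v \<notin> W"
  obtains r where "\<And>w. w \<in> W \<Longrightarrow> pairing n r w = 0" "pairing n r v \<noteq> 0"
proof -
  let ?scale = "\<lambda>(c::complex) (f :: nat \<Rightarrow> complex) i. c * f i"
  interpret vs: vector_space ?scale
    by unfold_locales (auto simp: algebra_simps fun_eq_iff)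
  interpret vp: vector_space_pair ?scale "(*) :: complex \<Rightarrow> complex \<Rightarrow> complex"
    by unfold_locales (auto simp: algebra_simps)
  \<comment> \<open>The preimage of \<open>W\<close> in the space of all sequences. It contains the
    sequences that vanish below \<open>n\<close>, so \<open>L\<close> depends only on the first
    \<open>n\<close> terms.\<close>
  define U where "U = {f. vec n f \<in> W}"
  have U: "vs.subspace U"
  proof (rule vs.subspaceI)
    have "vec n (0 :: nat \<Rightarrow> complex) = 0\<^sub>v n" by auto
    then show "0 \<in> U" using W by (simp add: U_def subspace_vec_def)
    show "f + h \<in> U" if "f \<in> U" "h \<in> U" for f h
    proof -
      have "vec n (f + h) = vec n f + vec n h" by auto
      then show ?thesis using that W by (simp add: U_def subspace_vec_def)
    qed
    show "?scale c f \<in> U" if "f \<in> U" for c f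
    proof -
      have "vec n (?scale c f) = c \<cdot>\<^sub>v vec n f" by auto
      then show ?thesis using that W by (simp add: U_def subspace_vec_def)
    qed
  qed
  define f where "f = (\<lambda>i. v $ i)"
  have "vec n f = v" using v by (auto simp: f_def)
  then have f: "f \<notin> U" using v by (simp add: U_def)
  obtain B where B: "B \<subseteq> U" "vs.independent B" "U \<subseteq> vs.span B"
    using vs.maximal_independent_subset by blast
  have "vs.span B \<subseteq> U" using B(1) U by (rule vs.span_minimal)
  then have "f \<notin> vs.span B" using f by blast
  then have indep: "vs.independent (insert f B)"
    using B(2) by (rule vs.independent_insertI)
  obtain L where L: "Vector_Spaces.linear ?scale (*) L" 
    "\<And>x. x \<in> insert f B \<Longrightarrow> L x = (if x = f then 1 else 0)"
    using vp.linear_independent_extend[OF indep, of "\<lambda>x. if x = f then 1 else 0"] by blast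
  interpret L: Vector_Spaces.linear ?scale "(*) :: complex \<Rightarrow> complex \<Rightarrow> complex" L by (rule L(1))
  have "L x = 0" if "x \<in> vs.span B" for x
    using that
  proof (induction rule: vs.span_induct_alt)
    case base then show ?case by (rule L.zero)
  next
    case (step c x y)
    then have "L x = 0" using L(2)[of x] f B(1) by auto
    have "L (?scale c x + y) = c * L x + L y" by (simp only: L.add L.scale)
    also have "\<dots> = 0" using \<open>L x = 0\<close> step by simp
    finally show ?case .
  qed
  then have LU: "L x = 0" if "x \<in> U" for x using B(3) that by blast
  define r where "r = (\<lambda>i. L (\<lambda>j. if j = i then 1 else 0))"
  have "L h = pairing n r (vec n h)" for h
  proof -
    define h' where "h' = (\<lambda>j. if j < n then h j else 0)"
    have "h - h' \<in> U"
    proof -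
      have "vec n (h - h') = 0\<^sub>v n" by (auto simp: h'_def)
      then show ?thesis using W by (simp add: U_def subspace_vec_def)
    qed
    then have "L h = L h'" using LU[of "h - h'"] by (simp add: L.diff)
    also have "h' = (\<Sum>i<n. ?scale (h i) (\<lambda>j. if j = i then 1 else 0))"
    proof
      fix j
      have "(\<Sum>i<n. ?scale (h i) (\<lambda>j. if j = i then 1 else 0)) j = (\<Sum>i<n. h i * (if j = i then 1 else 0))"
        by (induction n) auto
      then show "h' j = (\<Sum>i<n. ?scale (h i) (\<lambda>j. if j = i then 1 else 0)) j"
        by (simp add: h'_def if_distrib cong: if_cong)
    qed
    also have "L \<dots> = (\<Sum>i<n. h i * r i)"
      by (simp add: L.sum L.scale r_def)
    finally show ?thesis by (simp add: pairing_def mult.commute)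
  qed note L_eq = this
  show ?thesis
  proof
    show "pairing n r w = 0" if "w \<in> W" for w
    proof -
      have "w \<in> carrier_vec n" using that W by (auto simp: subspace_vec_def)
      then have "vec n (\<lambda>i. w $ i) = w" by auto
      then show ?thesis using L_eq[of "\<lambda>i. w $ i"] LU[of "\<lambda>i. w $ i"] that by (simp add: U_def)
    qed
    show "pairing n r v \<noteq> 0"
      using L_eq[of f] L(2)[of f] \<open>vec n f = v\<close> by simp
  qed
qed

section \<open>Contraction to the highest weight line\<close>

locale rational_representation =
  fixes n :: nat and \<rho> :: "complex mat \<Rightarrow> complex mat"
  assumes rational: "rational_rep n \<rho>"
begin

lemma carrier_rho [simp]: "g \<in> sp \<Longrightarrow> \<rho> g \<in> carrier_mat n n"
  and rho_mult: "g \<in> sp \<Longrightarrow> h \<in> sp \<Longrightarrow> \<rho> (g * h) = \<rho> g * \<rho> h"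
  using rational by (auto simp: rational_rep_def hom_def units_of_def Units_def ring_mat_simps)

text \<open>\<open>hom\<close> only asks for multiplicativity; the image of the unit is an
  invertible idempotent and therefore the identity.\<close>

lemma rho_one: "\<rho> (1\<^sub>m 4) = 1\<^sub>m n"
proof -
  have "\<rho> (1\<^sub>m 4) \<in> Units (ring_mat TYPE(complex) n ())"
    using rational sp_one by (auto simp: rational_rep_def hom_def units_of_def)
  then obtain B where B: "B \<in> carrier_mat n n" "B * \<rho> (1\<^sub>m 4) = 1\<^sub>m n"
    by (auto simp: Units_def ring_mat_simps)
  have "\<rho> (1\<^sub>m 4) = (B * \<rho> (1\<^sub>m 4)) * \<rho> (1\<^sub>m 4)"
    using carrier_rho[OF sp_one] by (simp only: B(2) left_mult_one_mat)
  also have "\<dots> = B * (\<rho> (1\<^sub>m 4) * \<rho> (1\<^sub>m 4))"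
    using B by (intro assoc_mult_mat[of _ n n _ n _ n]) auto
  also have "\<rho> (1\<^sub>m 4) * \<rho> (1\<^sub>m 4) = \<rho> (1\<^sub>m 4)"
    using rho_mult[of "1\<^sub>m 4" "1\<^sub>m 4"] by simp
  finally show ?thesis using B by simp
qed

lemma rho_mult_vec: "g \<in> sp \<Longrightarrow> h \<in> sp \<Longrightarrow> w \<in> carrier_vec n \<Longrightarrow> \<rho> (g * h) *\<^sub>v w = \<rho> g *\<^sub>v (\<rho> h *\<^sub>v w)"
  by (simp add: rho_mult assoc_mult_mat_vec[of _ n n _ n])

lemma rho_vec_carrier [simp]: "g \<in> sp \<Longrightarrow> w \<in> carrier_vec n \<Longrightarrow> \<rho> g *\<^sub>v w \<in> carrier_vec n"
  by (rule mult_mat_vec_carrier[of _ n n]) auto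

lemma regular_rho: "i < n \<Longrightarrow> j < n \<Longrightarrow> regular (\<lambda>g. \<rho> g $$ (i, j))"
  using rational by (auto simp: rational_rep_def regular_def)

lemma regular_rho_vec:
  assumes "w \<in> carrier_vec n" "i < n"
  shows "regular (\<lambda>g. (\<rho> g *\<^sub>v w) $ i)"
proof -
  have "regular (\<lambda>g. \<Sum>j<n. \<rho> g $$ (i, j) * w $ j)"
    using assms by (intro regular_sum regular_mult regular_rho regular_const) auto
  then show ?thesis
    by (rule iffD1[OF regular_cong, rotated]) (use assms in \<open>simp add: mult_mat_vec_index[of _ n]\<close>)
qed

lemma regular_pairing:
  assumes "w \<in> carrier_vec n"
  shows "regular (\<lambda>g. pairing n r (\<rho> g *\<^sub>v w))"
  unfolding pairing_def using assms by (intro regular_sum regular_mult regular_const regular_rho_vec) auto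

end

definition weight_char :: "weight \<Rightarrow> complex \<Rightarrow> complex \<Rightarrow> complex" where
  "weight_char l s t = s powi fst l * t powi snd l"

lemma weight_char_nonzero: "s \<noteq> 0 \<Longrightarrow> t \<noteq> 0 \<Longrightarrow> weight_char l s t \<noteq> 0"
  by (simp add: weight_char_def)

text \<open>Conjugation by these elements contracts the lower unipotent group to \<open>1\<close> as \<open>k\<close> tends to infinity.\<close>

definition dominant_torus :: "nat \<Rightarrow> complex mat" where
  "dominant_torus k = torus_elt (of_nat (Suc k) ^ 2) (of_nat (Suc k))"

definition dominant_char :: "weight \<Rightarrow> nat \<Rightarrow> complex" where
  "dominant_char l k = weight_char l (of_nat (Suc k) ^ 2) (of_nat (Suc k))"

lemma dominant_char_nonzero: "dominant_char l k \<noteq> 0"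
  by (simp add: dominant_char_def weight_char_nonzero del: of_nat_Suc)

lemma dominant_torus_sp: "dominant_torus k \<in> sp"
  by (simp add: dominant_torus_def torus_elt_sp del: of_nat_Suc)

lemma dominant_torus_conj:
  assumes n: "n \<in> sp" "transpose_mat n \<in> max_unipotent"
  obtains m where "\<And>k. m k \<in> sp" "\<And>k. dominant_torus k * n = m k * dominant_torus k"
    "\<And>i j. i < 4 \<Longrightarrow> j < 4 \<Longrightarrow> (\<lambda>k. m k $$ (i, j)) \<longlonglongrightarrow> 1\<^sub>m 4 $$ (i, j)"
proof -
  define K :: "nat \<Rightarrow> complex" where "K = (\<lambda>k. of_nat (Suc k))"
  have K: "K k \<noteq> 0" for k by (simp add: K_def del: of_nat_Suc)
  have T: "dominant_torus k = torus_elt (K k ^ 2) (K k)" for k by (simp add: dominant_torus_def K_def)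
  define m where "m = (\<lambda>k. torus_elt (K k ^ 2) (K k) * n * torus_elt (inverse (K k ^ 2)) (inverse (K k)))"
  have nc: "n \<in> carrier_mat 4 4" by (rule sp_carrier_mat[OF n(1)])
  have inv: "torus_elt (inverse (K k ^ 2)) (inverse (K k)) * torus_elt (K k ^ 2) (K k) = 1\<^sub>m 4" for k
    using K by (subst mat_eq_4_iff) (simp_all add: torus_elt_mat4 all_less_4 mult_index_4 del: index_mult_mat(1))
  have m_sp: "m k \<in> sp" for k
    unfolding m_def using K n by (intro sp_mult torus_elt_sp) auto
  have conj: "dominant_torus k * n = m k * dominant_torus k" for k
    using nc inv[of k] by (simp add: m_def T assoc_mult_mat[of _ 4 4 _ 4 _ 4])
  have nt: "n $$ (0, 1) = 0" "n $$ (0, 2) = 0" "n $$ (0, 3) = 0" "n $$ (1, 2) = 0" "n $$ (1, 3) = 0"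
    "n $$ (2, 3) = 0" "n $$ (0, 0) = 1" "n $$ (1, 1) = 1" "n $$ (2, 2) = 1" "n $$ (3, 3) = 1"
    using n nc by (simp_all add: max_unipotent_def upper_triangular_4_iff all_less_4)
  have K0: "(\<lambda>k. inverse (K k)) \<longlonglongrightarrow> 0"
    unfolding K_def by (rule LIMSEQ_Suc[OF lim_inverse_n])
  have Kp: "(\<lambda>k. c * inverse (K k) ^ p) \<longlonglongrightarrow> 0" if "p > 0" for p c
    using tendsto_mult[OF tendsto_const[of c] tendsto_power[OF K0, of p]] that by (simp add: power_0_left)
  \<comment> \<open>The exponents are the values of the positive roots on the cocharacter
    \<open>(2, 1)\<close>: 1, 2, 3, 4 for \<open>(1, -1)\<close>, \<open>(0, 2)\<close>,
    \<open>(1, 1)\<close>, \<open>(2, 0)\<close>.\<close>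
  have ent: "m k $$ (1, 0) = n $$ (1, 0) * inverse (K k) ^ 1" "m k $$ (2, 0) = n $$ (2, 0) * inverse (K k) ^ 3"
    "m k $$ (3, 0) = n $$ (3, 0) * inverse (K k) ^ 4" "m k $$ (2, 1) = n $$ (2, 1) * inverse (K k) ^ 2"
    "m k $$ (3, 1) = n $$ (3, 1) * inverse (K k) ^ 3" "m k $$ (3, 2) = n $$ (3, 2) * inverse (K k) ^ 1"
    "m k $$ (0, 0) = 1" "m k $$ (1, 1) = 1" "m k $$ (2, 2) = 1" "m k $$ (3, 3) = 1"
    "m k $$ (0, 1) = 0" "m k $$ (0, 2) = 0" "m k $$ (0, 3) = 0" "m k $$ (1, 2) = 0" "m k $$ (1, 3) = 0" "m k $$ (2, 3) = 0"
    for k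
    using K[of k] nc
    by (simp_all add: m_def torus_elt_mat4 mult_index_4 nt del: index_mult_mat(1))
      (simp_all add: field_simps power2_eq_square power3_eq_cube power4_eq_xxxx)
  have "(\<lambda>k. m k $$ (i, j)) \<longlonglongrightarrow> 1\<^sub>m 4 $$ (i, j)" if "i < 4" "j < 4" for i j
  proof -
    have "\<forall>i<4. \<forall>j<4. (\<lambda>k. m k $$ (i, j)) \<longlonglongrightarrow> 1\<^sub>m 4 $$ (i, j)"
      unfolding all_less_4 ent by (intro conjI) (simp_all add: Kp[of 1, simplified] Kp)
    then show ?thesis using that by blast
  qed
  then show ?thesis using that[of m] m_sp conj by blast
qed

text \<open>The contraction argument runs on cyclicity of \<open>v\<close>, stated in dual form.
  This is available for arbitrary irreducible representations and also for the models before they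
  are known to be irreducible.\<close>

locale highest_weight_cyclic = rational_representation +
  fixes l :: weight and v :: "complex vec"
  assumes hwv: "highest_weight_vector n \<rho> l v"
    and cyclic: "\<And>r. (\<And>g. g \<in> sp \<Longrightarrow> pairing n r (\<rho> g *\<^sub>v v) = 0) \<Longrightarrow> \<forall>i<n. r i = 0"
begin

lemma v_carrier [simp]: "v \<in> carrier_vec n"
  and v_nonzero: "v \<noteq> 0\<^sub>v n"
  and v_unipotent: "u \<in> max_unipotent \<Longrightarrow> \<rho> u *\<^sub>v v = v"
  and v_torus: "s \<noteq> 0 \<Longrightarrow> t \<noteq> 0 \<Longrightarrow> \<rho> (torus_elt s t) *\<^sub>v v = weight_char l s t \<cdot>\<^sub>v v"
  using hwv by (auto simp: highest_weight_vector_def weight_char_def)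

text \<open>On the big cell \<open>g\<close> is a product of a lower unipotent, a torus and an upper
  unipotent element; the last fixes \<open>v\<close> and the torus scales it. Density extends the
  vanishing to the whole group.\<close>

lemma lower_cyclic:
  assumes "\<And>m. m \<in> sp \<Longrightarrow> transpose_mat m \<in> max_unipotent \<Longrightarrow> pairing n r (\<rho> m *\<^sub>v v) = 0"
  shows "\<forall>i<n. r i = 0"
proof (rule cyclic)
  fix g assume "g \<in> sp"
  then show "pairing n r (\<rho> g *\<^sub>v v) = 0"
  proof (rule big_cell_dense[rotated 2])
    show "regular (\<lambda>g. pairing n r (\<rho> g *\<^sub>v v))" by (rule regular_pairing) simp
    fix g assume g: "g \<in> sp" "g $$ (0, 0) \<noteq> 0" "row_minor 0 1 g \<noteq> 0"
    obtain b y z w x where b: "b \<in> borel_lower" "g = b * (siegel_upper y z w * levi_upper x)"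
      using big_cell_factor[OF g] by metis
    define s t where "s = b $$ (0, 0)" and "t = b $$ (1, 1)"
    obtain m where m: "transpose_mat m \<in> max_unipotent" "m \<in> sp" "b = m * torus_elt s t"
      using borel_lower_factor[OF b(1)] unfolding s_def t_def by metis
    let ?t = "torus_elt s t" and ?u = "siegel_upper y z w * levi_upper x"
    have nz: "s \<noteq> 0" "t \<noteq> 0" using borel_lower_diag[OF b(1)] unfolding s_def t_def by blast+
    then have t: "?t \<in> sp" by (rule torus_elt_sp)
    have u: "?u \<in> max_unipotent" by (intro max_unipotent_mult unipotent_max_unipotent)
    then have u': "?u \<in> sp" by (simp add: max_unipotent_def)
    have "\<rho> g *\<^sub>v v = \<rho> b *\<^sub>v (\<rho> ?u *\<^sub>v v)"
      unfolding b(2) using borel_lower_sp[OF b(1)] u' by (intro rho_mult_vec) auto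
    also have "\<dots> = \<rho> (m * ?t) *\<^sub>v v" by (simp only: v_unipotent[OF u] m(3))
    also have "\<dots> = \<rho> m *\<^sub>v (weight_char l s t \<cdot>\<^sub>v v)"
      using nz m t by (simp add: rho_mult_vec v_torus)
    also have "\<dots> = weight_char l s t \<cdot>\<^sub>v (\<rho> m *\<^sub>v v)"
      using m by (intro mult_mat_vec[of _ n n]) auto
    finally show "pairing n r (\<rho> g *\<^sub>v v) = 0"
      using assms m by (simp add: pairing_smult)
  qed
qed

text \<open>The number \<open>c\<close> is the coordinate of \<open>w\<close> along the highest
  weight line, obtained as a limit.\<close>

definition contracts :: "complex vec \<Rightarrow> complex \<Rightarrow> bool" where
  "contracts w c \<longleftrightarrow>
     (\<forall>i<n. (\<lambda>k. inverse (dominant_char l k) * (\<rho> (dominant_torus k) *\<^sub>v w) $ i) \<longlonglongrightarrow> c * v $ i)"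

lemma contracts_unique: "contracts w c \<Longrightarrow> contracts w d \<Longrightarrow> c = d"
proof -
  assume *: "contracts w c" "contracts w d"
  obtain i where i: "i < n" "v $ i \<noteq> 0"
    using v_nonzero v_carrier by (metis eq_vecI carrier_vecD index_zero_vec(1,2))
  then have "c * v $ i = d * v $ i"
    using * LIMSEQ_unique unfolding contracts_def by blast
  then show ?thesis using i by simp
qed

lemma contracts_add:
  assumes "contracts w c" "contracts u d" "w \<in> carrier_vec n" "u \<in> carrier_vec n"
  shows "contracts (w + u) (c + d)"
  unfolding contracts_def
proof (intro allI impI)
  fix i assume i: "i < n"
  have "(\<rho> (dominant_torus k) *\<^sub>v (w + u)) $ i = (\<rho> (dominant_torus k) *\<^sub>v w) $ i + (\<rho> (dominant_torus k) *\<^sub>v u) $ i" for k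
    using assms i carrier_rho[OF dominant_torus_sp[of k]]
    by (subst mult_add_distrib_mat_vec[of _ n n]) auto
  moreover have "(\<lambda>k. inverse (dominant_char l k) * (\<rho> (dominant_torus k) *\<^sub>v w) $ i
      + inverse (dominant_char l k) * (\<rho> (dominant_torus k) *\<^sub>v u) $ i) \<longlonglongrightarrow> c * v $ i + d * v $ i"
    using assms(1,2) i unfolding contracts_def by (intro tendsto_add) auto
  ultimately show "(\<lambda>k. inverse (dominant_char l k) * (\<rho> (dominant_torus k) *\<^sub>v (w + u)) $ i) \<longlonglongrightarrow> (c + d) * v $ i"
    by (simp add: distrib_left distrib_right)
qed

lemma contracts_smult:
  assumes "contracts w c" "w \<in> carrier_vec n"
  shows "contracts (a \<cdot>\<^sub>v w) (a * c)"
  unfolding contracts_def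
proof (intro allI impI)
  fix i assume i: "i < n"
  have "(\<rho> (dominant_torus k) *\<^sub>v (a \<cdot>\<^sub>v w)) $ i = a * (\<rho> (dominant_torus k) *\<^sub>v w) $ i" for k
    using assms i carrier_rho[OF dominant_torus_sp[of k]]
    by (subst mult_mat_vec[of _ n n]) auto
  moreover have "(\<lambda>k. a * (inverse (dominant_char l k) * (\<rho> (dominant_torus k) *\<^sub>v w) $ i)) \<longlonglongrightarrow> a * (c * v $ i)"
    using assms(1) i unfolding contracts_def by (intro tendsto_mult_left) auto
  ultimately show "(\<lambda>k. inverse (dominant_char l k) * (\<rho> (dominant_torus k) *\<^sub>v (a \<cdot>\<^sub>v w)) $ i) \<longlonglongrightarrow> (a * c) * v $ i"
    by (simp add: mult_ac)
qed

lemma contracts_v: "contracts v 1"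
proof -
  have "\<rho> (dominant_torus k) *\<^sub>v v = dominant_char l k \<cdot>\<^sub>v v" for k
    by (simp add: dominant_torus_def dominant_char_def v_torus del: of_nat_Suc)
  then show ?thesis
    using dominant_char_nonzero by (simp add: contracts_def carrier_vecD[OF v_carrier] mult.assoc[symmetric])
qed

text \<open>Moving \<open>m\<close> past the torus element replaces it by \<open>q k\<close>, which
  tends to 1.\<close>

lemma contracts_lower:
  assumes w: "contracts w c" "w \<in> carrier_vec n" and m: "m \<in> sp" "transpose_mat m \<in> max_unipotent"
  shows "contracts (\<rho> m *\<^sub>v w) c"
  unfolding contracts_def
proof (intro allI impI)
  fix i assume i: "i < n"
  obtain q where q: "\<And>k. q k \<in> sp" "\<And>k. dominant_torus k * m = q k * dominant_torus k"
    "\<And>i j. i < 4 \<Longrightarrow> j < 4 \<Longrightarrow> (\<lambda>k. q k $$ (i, j)) \<longlonglongrightarrow> 1\<^sub>m 4 $$ (i, j)"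
    using dominant_torus_conj[OF m] by metis
  let ?T = dominant_torus and ?c = "\<lambda>k. inverse (dominant_char l k)"
  have "?c k * (\<rho> (?T k) *\<^sub>v (\<rho> m *\<^sub>v w)) $ i = (\<Sum>j<n. \<rho> (q k) $$ (i, j) * (?c k * (\<rho> (?T k) *\<^sub>v w) $ j))" for k
  proof -
    have "\<rho> (?T k) *\<^sub>v (\<rho> m *\<^sub>v w) = \<rho> (q k) *\<^sub>v (\<rho> (?T k) *\<^sub>v w)"
      using w m q by (simp flip: rho_mult_vec add: dominant_torus_sp)
    then show ?thesis
      using w q i by (simp add: mult_mat_vec_index[of "\<rho> (q k)" n] dominant_torus_sp sum_distrib_left mult_ac)
  qed
  moreover have "(\<lambda>k. \<Sum>j<n. \<rho> (q k) $$ (i, j) * (?c k * (\<rho> (?T k) *\<^sub>v w) $ j)) \<longlonglongrightarrow> (\<Sum>j<n. \<rho> (1\<^sub>m 4) $$ (i, j) * (c * v $ j))"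
    using w(1) i q unfolding contracts_def
    by (intro tendsto_sum tendsto_mult[OF regular_tendsto[OF regular_rho]]) auto
  moreover have "(\<Sum>j<n. \<rho> (1\<^sub>m 4) $$ (i, j) * (c * v $ j)) = c * v $ i"
  proof -
    have "(\<Sum>j<n. \<rho> (1\<^sub>m 4) $$ (i, j) * (c * v $ j)) = (\<Sum>j<n. if j = i then c * v $ i else 0)"
      unfolding rho_one using i by (intro sum.cong) auto
    then show ?thesis using i by simp
  qed
  ultimately show "(\<lambda>k. ?c k * (\<rho> (?T k) *\<^sub>v (\<rho> m *\<^sub>v w)) $ i) \<longlonglongrightarrow> c * v $ i"
    by simp
qed

lemma contracts_torus:
  assumes w: "contracts w c" "w \<in> carrier_vec n" and st: "s \<noteq> 0" "t \<noteq> 0"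
  shows "contracts (\<rho> (torus_elt s t) *\<^sub>v w) (weight_char l s t * c)"
  unfolding contracts_def
proof (intro allI impI)
  fix i assume i: "i < n"
  let ?T = dominant_torus and ?c = "\<lambda>k. inverse (dominant_char l k)" and ?t = "torus_elt s t"
  have t: "?t \<in> sp" by (rule torus_elt_sp[OF st])
  have "?c k * (\<rho> (?T k) *\<^sub>v (\<rho> ?t *\<^sub>v w)) $ i = (\<Sum>j<n. \<rho> ?t $$ (i, j) * (?c k * (\<rho> (?T k) *\<^sub>v w) $ j))" for k
  proof -
    have "?T k * ?t = ?t * ?T k"
      by (subst mat_eq_4_iff)
        (simp_all add: dominant_torus_def torus_elt_mat4 all_less_4 mult_index_4 mult.commute del: index_mult_mat(1) of_nat_Suc)
    then have "\<rho> (?T k) *\<^sub>v (\<rho> ?t *\<^sub>v w) = \<rho> ?t *\<^sub>v (\<rho> (?T k) *\<^sub>v w)"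
      using w t by (simp flip: rho_mult_vec add: dominant_torus_sp)
    then show ?thesis
      using w t i by (simp add: mult_mat_vec_index[of "\<rho> ?t" n] dominant_torus_sp sum_distrib_left mult_ac)
  qed
  moreover have "(\<lambda>k. \<Sum>j<n. \<rho> ?t $$ (i, j) * (?c k * (\<rho> (?T k) *\<^sub>v w) $ j)) \<longlonglongrightarrow> (\<Sum>j<n. \<rho> ?t $$ (i, j) * (c * v $ j))"
    using w(1) i unfolding contracts_def by (intro tendsto_sum tendsto_mult[OF tendsto_const]) auto
  moreover have "(\<Sum>j<n. \<rho> ?t $$ (i, j) * (c * v $ j)) = c * (\<rho> ?t *\<^sub>v v) $ i"
    using i t by (simp add: mult_mat_vec_index[of "\<rho> ?t" n] sum_distrib_left mult_ac)
  moreover have "(\<rho> ?t *\<^sub>v v) $ i = weight_char l s t * v $ i"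
    using st i by (simp add: v_torus carrier_vecD[OF v_carrier])
  ultimately show "(\<lambda>k. ?c k * (\<rho> (?T k) *\<^sub>v (\<rho> ?t *\<^sub>v w)) $ i) \<longlonglongrightarrow> (weight_char l s t * c) * v $ i"
    by (simp add: mult_ac)
qed

text \<open>The vectors with a limit form a subspace that contains the lower unipotent orbit of
  \<open>v\<close>; a covector separating \<open>w\<close> from it would be zero by
  \<open>lower_cyclic\<close>.\<close>

lemma contracts_ex:
  assumes "w \<in> carrier_vec n" shows "\<exists>c. contracts w c"
proof (rule ccontr)
  assume no: "\<nexists>c. contracts w c"
  let ?W = "{w \<in> carrier_vec n. \<exists>c. contracts w c}"
  have "0 \<cdot>\<^sub>v v = 0\<^sub>v n" by (auto simp: carrier_vecD[OF v_carrier])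
  then have "contracts (0\<^sub>v n) (0 * 1)"
    using contracts_smult[OF contracts_v v_carrier, of 0] by simp
  then have 0: "0\<^sub>v n \<in> ?W" by auto
  have "w + u \<in> ?W" if "w \<in> ?W" "u \<in> ?W" for w u
    using that contracts_add by (auto; blast)
  moreover have "c \<cdot>\<^sub>v w \<in> ?W" if "w \<in> ?W" for w c
    using that contracts_smult by (auto; blast)
  ultimately have "subspace_vec n ?W"
    unfolding subspace_vec_def using 0 by (intro conjI ballI allI Collect_restrict)
  then obtain r where r: "\<And>u. u \<in> ?W \<Longrightarrow> pairing n r u = 0" "pairing n r w \<noteq> 0"
    using separating_covector[of n ?W w] no assms by blast
  have "\<forall>i<n. r i = 0"
  proof (rule lower_cyclic)
    fix m assume "m \<in> sp" "transpose_mat m \<in> max_unipotent"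
    then show "pairing n r (\<rho> m *\<^sub>v v) = 0"
      using contracts_lower[OF contracts_v v_carrier] by (intro r(1)) auto
  qed
  then show False using r(2) by (simp add: pairing_def)
qed

text \<open>The limit coefficient as a linear functional. Lower unipotent elements leave it
  unchanged and the torus scales it, so \<open>borel_lower\<close> acts on it by the character of
  \<open>l\<close>.\<close>

lemma highest_weight_covector:
  obtains \<xi> where "\<And>w. w \<in> carrier_vec n \<Longrightarrow> contracts w (pairing n \<xi> w)"
    "\<And>b w. b \<in> borel_lower \<Longrightarrow> w \<in> carrier_vec n \<Longrightarrow>
       pairing n \<xi> (\<rho> b *\<^sub>v w) = weight_char l (b $$ (0, 0)) (b $$ (1, 1)) * pairing n \<xi> w"
    "pairing n \<xi> v = 1"
proof -
  have "\<forall>j. \<exists>c. contracts (unit_vec n j) c" using contracts_ex by simp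
  then obtain \<xi> where \<xi>: "\<And>j. contracts (unit_vec n j) (\<xi> j)" by metis
  have c: "contracts w (pairing n \<xi> w)" if w: "w \<in> carrier_vec n" for w
    unfolding contracts_def
  proof (intro allI impI)
    fix i assume i: "i < n"
    let ?T = dominant_torus and ?c = "\<lambda>k. inverse (dominant_char l k)"
    have u: "(\<rho> (?T k) *\<^sub>v unit_vec n j) $ i = \<rho> (?T k) $$ (i, j)" if "j < n" for k j
      using that i carrier_rho[OF dominant_torus_sp[of k]] by (simp add: mult_mat_vec_index[of _ n])
    have "(\<lambda>k. \<Sum>j<n. w $ j * (?c k * (\<rho> (?T k) *\<^sub>v unit_vec n j) $ i)) \<longlonglongrightarrow> (\<Sum>j<n. w $ j * (\<xi> j * v $ i))"
      using \<xi> i unfolding contracts_def by (intro tendsto_sum tendsto_mult[OF tendsto_const]) auto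
    moreover have "(\<Sum>j<n. w $ j * (\<xi> j * v $ i)) = pairing n \<xi> w * v $ i"
      by (simp add: pairing_def sum_distrib_left mult_ac)
    moreover have "(\<Sum>j<n. w $ j * (?c k * (\<rho> (?T k) *\<^sub>v unit_vec n j) $ i)) = ?c k * (\<rho> (?T k) *\<^sub>v w) $ i" for k
      using w i carrier_rho[OF dominant_torus_sp[of k]] u
      by (simp add: mult_mat_vec_index[of "\<rho> (?T k)" n w] sum_distrib_left mult_ac del: index_mult_mat_vec)
    ultimately show "(\<lambda>k. ?c k * (\<rho> (?T k) *\<^sub>v w) $ i) \<longlonglongrightarrow> pairing n \<xi> w * v $ i"
      by simp
  qed
  have b: "pairing n \<xi> (\<rho> b *\<^sub>v w) = weight_char l (b $$ (0, 0)) (b $$ (1, 1)) * pairing n \<xi> w"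
    if b: "b \<in> borel_lower" and w: "w \<in> carrier_vec n" for b w
  proof -
    let ?s = "b $$ (0, 0)" and ?t = "b $$ (1, 1)"
    obtain m where m: "transpose_mat m \<in> max_unipotent" "m \<in> sp" "b = m * torus_elt ?s ?t"
      using borel_lower_factor[OF b] by metis
    have nz: "?s \<noteq> 0" "?t \<noteq> 0" using borel_lower_diag[OF b] by blast+
    have t: "torus_elt ?s ?t \<in> sp" using nz by (rule torus_elt_sp)
    have "contracts (\<rho> m *\<^sub>v (\<rho> (torus_elt ?s ?t) *\<^sub>v w)) (weight_char l ?s ?t * pairing n \<xi> w)"
      by (rule contracts_lower[OF contracts_torus[OF c[OF w] w nz] rho_vec_carrier[OF t w] m(2,1)])
    also have "\<rho> m *\<^sub>v (\<rho> (torus_elt ?s ?t) *\<^sub>v w) = \<rho> (m * torus_elt ?s ?t) *\<^sub>v w"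
      by (rule rho_mult_vec[OF m(2) t w, symmetric])
    also have "m * torus_elt ?s ?t = b" by (rule m(3)[symmetric])
    finally have "contracts (\<rho> b *\<^sub>v w) (weight_char l ?s ?t * pairing n \<xi> w)" .
    moreover have "contracts (\<rho> b *\<^sub>v w) (pairing n \<xi> (\<rho> b *\<^sub>v w))"
      by (rule c[OF rho_vec_carrier[OF borel_lower_sp[OF b] w]])
    ultimately show ?thesis by (rule contracts_unique[rotated])
  qed
  show ?thesis
    by (rule that[OF c b contracts_unique[OF c[OF v_carrier] contracts_v]])
qed

end

section \<open>Models of the irreducible representations\<close>

text \<open>Forms of bidegree \<open>(a, b)\<close> in the coordinates of the flag spanned by the first two rows: the
  entries of the first row and the Pluecker coordinates of the first two rows.\<close>

inductive form :: "nat \<Rightarrow> nat \<Rightarrow> (complex mat \<Rightarrow> complex) \<Rightarrow> bool" where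
  form_const: "form 0 0 (\<lambda>_. c)"
| form_row: "i < 4 \<Longrightarrow> form a b F \<Longrightarrow> form (Suc a) b (\<lambda>g. g $$ (0, i) * F g)"
| form_minor: "i < 4 \<Longrightarrow> j < 4 \<Longrightarrow> form a b F \<Longrightarrow> form a (Suc b) (\<lambda>g. row_minor i j g * F g)"
| form_add: "form a b F \<Longrightarrow> form a b H \<Longrightarrow> form a b (\<lambda>g. F g + H g)"

lemma form_cmult: "form a b F \<Longrightarrow> form a b (\<lambda>g. c * F g)"
proof (induction rule: form.induct)
  case (form_row i a b F)
  then show ?case using form.form_row[of i a b "\<lambda>g. c * F g"] by (simp add: mult_ac)
next
  case (form_minor i j a b F)
  then show ?case using form.form_minor[of i j a b "\<lambda>g. c * F g"] by (simp add: mult_ac)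
next
  case (form_add a b F H)
  then show ?case using form.form_add[of a b "\<lambda>g. c * F g" "\<lambda>g. c * H g"] by (simp add: distrib_left)
qed (rule form.form_const)

lemma form_mult: "form a b F \<Longrightarrow> form a' b' H \<Longrightarrow> form (a + a') (b + b') (\<lambda>g. F g * H g)"
proof (induction rule: form.induct)
  case (form_const c)
  then show ?case by (simp add: form_cmult)
next
  case (form_row i a b F)
  then show ?case using form.form_row[of i "a + a'" "b + b'" "\<lambda>g. F g * H g"] by (simp add: mult_ac)
next
  case (form_minor i j a b F)
  then show ?case using form.form_minor[of i j "a + a'" "b + b'" "\<lambda>g. F g * H g"] by (simp add: mult_ac)
next
  case (form_add a b F G)
  then show ?case using form.form_add[of "a + a'" "b + b'" "\<lambda>g. F g * H g" "\<lambda>g. G g * H g"] by (simp add: distrib_right)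
qed

lemma form_power: "form a b F \<Longrightarrow> form (k * a) (k * b) (\<lambda>g. F g ^ k)"
  by (induction k) (use form_const[of 1] form_mult in \<open>auto simp: One_nat_def\<close>)

text \<open>The highest weight function of weight \<open>(a + b, b)\<close>; the functions
  \<open>lead a b (x * g)\<close> of \<open>g\<close> generate the model.\<close>

definition lead :: "nat \<Rightarrow> nat \<Rightarrow> complex mat \<Rightarrow> complex" where
  "lead a b g = g $$ (0, 0) ^ a * row_minor 0 1 g ^ b"

lemma lead_form: "form a b (lead a b)"
proof -
  have "form 1 0 (\<lambda>g. g $$ (0, 0))" using form_row[OF _ form_const[of 1], of 0] by (simp add: One_nat_def)
  moreover have "form 0 1 (row_minor 0 1)" using form_minor[OF _ _ form_const[of 1], of 0 1] by (simp add: One_nat_def)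
  ultimately show ?thesis
    using form_mult[OF form_power[of 1 0 _ a] form_power[of 0 1 _ b]] by (simp add: lead_def[abs_def])
qed

lemma form_regular: "form a b F \<Longrightarrow> regular F"
  by (induction rule: form.induct)
    (auto simp: row_minor_def intro!: regular_const regular_mult regular_add regular_diff regular_entry)

lemma lead_torus:
  assumes g: "g \<in> carrier_mat 4 4"
  shows "lead a b (torus_elt s t * g) = s ^ (a + b) * t ^ b * lead a b g"
    and "lead a b (g * torus_elt s t) = s ^ (a + b) * t ^ b * lead a b g"
proof -
  have "(torus_elt s t * g) $$ (0, 0) = s * g $$ (0, 0)" "(g * torus_elt s t) $$ (0, 0) = s * g $$ (0, 0)"
    "row_minor 0 1 (torus_elt s t * g) = s * t * row_minor 0 1 g"
    "row_minor 0 1 (g * torus_elt s t) = s * t * row_minor 0 1 g"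
    using g by (simp_all add: row_minor_def mult_index_4 torus_elt_mat4 algebra_simps del: index_mult_mat(1))
  then show "lead a b (torus_elt s t * g) = s ^ (a + b) * t ^ b * lead a b g"
    "lead a b (g * torus_elt s t) = s ^ (a + b) * t ^ b * lead a b g"
    by (simp_all add: lead_def power_mult_distrib power_add mult_ac)
qed

lemma mult_entry_00:
  assumes "h \<in> carrier_mat 4 4" "g \<in> carrier_mat 4 4"
  shows "(h * g) $$ (0, 0) = (\<Sum>k<4. h $$ (0, k) * g $$ (k, 0))"
  using assms by (simp add: mult_index_4 sum_less_4[unfolded atLeast0LessThan] del: index_mult_mat(1))

text \<open>Cauchy-Binet over ordered pairs of indices; the factor 1/2 compensates for counting each
  pair twice.\<close>

lemma row_minor_mult:
  assumes "h \<in> carrier_mat 4 4" "g \<in> carrier_mat 4 4"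
  shows "row_minor 0 1 (h * g) = (\<Sum>i<4. \<Sum>j<4. row_minor i j h * (row_minor i j (transpose_mat g) / 2))"
  using assms
  by (simp add: row_minor_def mult_index_4 sum_less_4[unfolded atLeast0LessThan] del: index_mult_mat(1))
    (simp add: field_simps)

section \<open>Positivity of the Gram form\<close>

definition adj :: "complex mat \<Rightarrow> complex mat" where
  "adj h = transpose_mat (map_mat cnj h)"

text \<open>The entries of \<open>symp_form\<close> are real, so complex conjugation preserves the
  group, as transposition does.\<close>

lemma adj_sp: "h \<in> sp \<Longrightarrow> adj h \<in> sp"
proof -
  assume h: "h \<in> sp"
  have c: "h \<in> carrier_mat 4 4" by (rule sp_carrier_mat[OF h])
  have "row_form (map_mat cnj h) (map_mat cnj h) i j = cnj (row_form h h i j)" if "i < 4" "j < 4" for i j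
    using c that by (simp add: row_form_def)
  then have "map_mat cnj h \<in> sp"
    using h c by (simp add: sp_iff_rows)
  then show ?thesis by (simp add: adj_def sp_transpose)
qed

lemma adj_index: "h \<in> carrier_mat 4 4 \<Longrightarrow> i < 4 \<Longrightarrow> j < 4 \<Longrightarrow> adj h $$ (i, j) = cnj (h $$ (j, i))"
  by (simp add: adj_def)

text \<open>The Hermitian form of the kernel \<open>lead a b (x * adj y)\<close> at the points
  \<open>h i\<close>.\<close>

definition gram :: "nat \<Rightarrow> nat \<Rightarrow> 'i set \<Rightarrow> ('i \<Rightarrow> complex mat) \<Rightarrow> ('i \<Rightarrow> complex) \<Rightarrow> complex" where
  "gram a b I h c = (\<Sum>i\<in>I. \<Sum>j\<in>I. c i * cnj (c j) * lead a b (h i * adj (h j)))"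

lemma gram_0: "gram 0 0 I h c = (\<Sum>i\<in>I. c i) * cnj (\<Sum>i\<in>I. c i)"
  by (simp add: gram_def lead_def sum_product)

text \<open>One factor of the kernel is the Hermitian product of two first rows; each of its terms
  is absorbed into the coefficients \<open>c i\<close> and \<open>cnj (c j)\<close>.\<close>

lemma gram_Suc_left:
  assumes "\<And>i. i \<in> I \<Longrightarrow> h i \<in> sp"
  shows "gram (Suc a) b I h c = (\<Sum>k<4. gram a b I h (\<lambda>i. c i * h i $$ (0, k)))"
proof -
  have "c i * cnj (c j) * lead (Suc a) b (h i * adj (h j)) =
      (\<Sum>k<4. (c i * h i $$ (0, k)) * cnj (c j * h j $$ (0, k)) * lead a b (h i * adj (h j)))"
    if "i \<in> I" "j \<in> I" for i j
  proof -
    have "(h i * adj (h j)) $$ (0, 0) = (\<Sum>k<4. h i $$ (0, k) * cnj (h j $$ (0, k)))"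
      using that assms adj_sp sp_carrier_mat by (subst mult_entry_00) (auto simp: adj_index)
    then show ?thesis
      by (simp add: lead_def sum_distrib_left sum_distrib_right mult_ac)
  qed
  then have "gram (Suc a) b I h c = (\<Sum>i\<in>I. \<Sum>j\<in>I. \<Sum>k<4. (c i * h i $$ (0, k)) * cnj (c j * h j $$ (0, k)) * lead a b (h i * adj (h j)))"
    unfolding gram_def by (intro sum.cong) auto
  also have "\<dots> = (\<Sum>i\<in>I. \<Sum>k<4. \<Sum>j\<in>I. (c i * h i $$ (0, k)) * cnj (c j * h j $$ (0, k)) * lead a b (h i * adj (h j)))"
    by (intro sum.cong refl sum.swap)
  also have "\<dots> = (\<Sum>k<4. gram a b I h (\<lambda>i. c i * h i $$ (0, k)))"
    unfolding gram_def by (rule sum.swap)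
  finally show ?thesis .
qed

lemma gram_Suc_right:
  assumes "\<And>i. i \<in> I \<Longrightarrow> h i \<in> sp"
  shows "gram a (Suc b) I h c = (\<Sum>(k, l)\<in>{..<4} \<times> {..<4}. gram a b I h (\<lambda>i. c i * row_minor k l (h i))) / 2"
proof -
  let ?P = "{..<4::nat} \<times> {..<4::nat}"
  let ?t = "\<lambda>i j p. (c i * row_minor (fst p) (snd p) (h i)) * cnj (c j * row_minor (fst p) (snd p) (h j)) * lead a b (h i * adj (h j))"
  have "c i * cnj (c j) * lead a (Suc b) (h i * adj (h j)) = (\<Sum>p\<in>?P. ?t i j p) / 2"
    if "i \<in> I" "j \<in> I" for i j
  proof -
    have hc: "h i \<in> carrier_mat 4 4" "h j \<in> carrier_mat 4 4" "adj (h j) \<in> carrier_mat 4 4"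
      using that assms adj_sp sp_carrier_mat by auto
    have m: "row_minor k l (transpose_mat (adj (h j))) = cnj (row_minor k l (h j))" if "k < 4" "l < 4" for k l
      using hc that by (simp add: row_minor_def adj_def)
    have "row_minor 0 1 (h i * adj (h j)) = (\<Sum>k<4. \<Sum>l<4. row_minor k l (h i) * (cnj (row_minor k l (h j)) / 2))"
      using hc by (subst row_minor_mult) (auto simp: m)
    also have "\<dots> = (\<Sum>p\<in>?P. row_minor (fst p) (snd p) (h i) * cnj (row_minor (fst p) (snd p) (h j))) / 2"
      by (simp add: sum.cartesian_product case_prod_beta sum_divide_distrib)
    finally show ?thesis
      by (simp add: lead_def sum_distrib_left sum_distrib_right sum_divide_distrib mult_ac)
  qed
  then have "gram a (Suc b) I h c = (\<Sum>i\<in>I. \<Sum>j\<in>I. (\<Sum>p\<in>?P. ?t i j p) / 2)"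
    unfolding gram_def by (intro sum.cong) auto
  also have "\<dots> = (\<Sum>i\<in>I. \<Sum>j\<in>I. \<Sum>p\<in>?P. ?t i j p) / 2"
    by (simp add: sum_divide_distrib)
  also have "(\<Sum>i\<in>I. \<Sum>j\<in>I. \<Sum>p\<in>?P. ?t i j p) = (\<Sum>i\<in>I. \<Sum>p\<in>?P. \<Sum>j\<in>I. ?t i j p)"
    by (intro sum.cong refl sum.swap)
  also have "\<dots> = (\<Sum>p\<in>?P. gram a b I h (\<lambda>i. c i * row_minor (fst p) (snd p) (h i)))"
    unfolding gram_def by (rule sum.swap)
  finally show ?thesis by (simp add: case_prod_beta)
qed

text \<open>Peeling off the factors one by one leaves sums of squared absolute values, divided by
  powers of 2.\<close>

lemma gram_nonneg:
  assumes "\<And>i. i \<in> I \<Longrightarrow> h i \<in> sp"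
  shows "Re (gram a b I h c) \<ge> 0 \<and> Im (gram a b I h c) = 0"
proof (induction a arbitrary: c)
  case 0
  show ?case
  proof (induction b arbitrary: c)
    case 0
    show ?case unfolding gram_0 complex_mult_cnj by (simp del: Re_sum Im_sum)
  next
    case (Suc b)
    show ?case
      by (simp add: gram_Suc_right assms case_prod_beta Suc sum_nonneg)
  qed
next
  case (Suc a)
  show ?case
    by (simp add: gram_Suc_left assms Suc sum_nonneg)
qed

lemma gram_sum_eq_0:
  assumes "\<And>i. i \<in> I \<Longrightarrow> h i \<in> sp" "finite K" "(\<Sum>k\<in>K. gram a b I h (c k)) = 0" "k \<in> K"
  shows "gram a b I h (c k) = 0"
proof -
  have "(\<Sum>k\<in>K. Re (gram a b I h (c k))) = 0"
    using assms(3) by (metis Re_sum zero_complex.sel(1))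
  then have "Re (gram a b I h (c k)) = 0"
    using assms gram_nonneg[of I h] by (subst (asm) sum_nonneg_eq_0_iff) auto
  then show ?thesis using gram_nonneg[of I h] assms(1) by (simp add: complex_eq_iff)
qed

text \<open>The recursion of \<open>form\<close> matches that of \<open>gram\<close>: a row entry or
  minor in front of a form can be moved into the coefficients, and a vanishing sum of nonnegative
  terms has all its terms zero.\<close>

lemma form_vanishes_of_gram:
  assumes h: "\<And>i. i \<in> I \<Longrightarrow> h i \<in> sp" and "form a b F"
  shows "gram a b I h c = 0 \<Longrightarrow> (\<Sum>i\<in>I. c i * F (h i)) = 0"
  using assms(2)
proof (induction arbitrary: c rule: form.induct)
  case (form_const d)
  then have "(\<Sum>i\<in>I. c i) = 0" unfolding gram_0 mult_eq_0_iff complex_cnj_zero_iff by simp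
  then show ?case by (simp flip: sum_distrib_right)
next
  case (form_row k a b F)
  then have "gram a b I h (\<lambda>i. c i * h i $$ (0, k)) = 0"
    using gram_sum_eq_0[where I = I and h = h and K = "{..<4}" and a = a and b = b and c = "\<lambda>k i. c i * h i $$ (0, k)" and k = k]
    by (simp add: gram_Suc_left h)
  from form_row.IH[OF this] show ?case by (simp add: mult.assoc)
next
  case (form_minor k l a b F)
  then have "gram a b I h (\<lambda>i. c i * row_minor k l (h i)) = 0"
    using gram_sum_eq_0[where I = I and h = h and K = "{..<4} \<times> {..<4}" and a = a and b = b
          and c = "\<lambda>p i. c i * row_minor (fst p) (snd p) (h i)" and k = "(k, l)"]
    by (simp add: gram_Suc_right h case_prod_beta)
  from form_minor.IH[OF this] show ?case by (simp add: mult.assoc)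
next
  case (form_add a b F H)
  then show ?case by (simp add: distrib_left sum.distrib)
qed

text \<open>By positivity of the Gram matrices, a linear relation between the functions
  \<open>g \<mapsto> lead a b (h i * g)\<close> holds for all forms of bidegree \<open>(a, b)\<close>, not only for translates
  of \<open>lead a b\<close>. This takes the place of complete reducibility.\<close>

lemma form_vanishes:
  assumes h: "\<And>i. i \<in> I \<Longrightarrow> h i \<in> sp"
    and z: "\<And>g. g \<in> sp \<Longrightarrow> (\<Sum>i\<in>I. c i * lead a b (h i * g)) = 0" and F: "form a b F"
  shows "(\<Sum>i\<in>I. c i * F (h i)) = 0"
proof (rule form_vanishes_of_gram[OF h F])
  have "gram a b I h c = (\<Sum>j\<in>I. cnj (c j) * (\<Sum>i\<in>I. c i * lead a b (h i * adj (h j))))"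
    unfolding gram_def by (subst sum.swap) (simp add: sum_distrib_left mult_ac)
  also have "\<dots> = 0" using h by (intro sum.neutral) (simp add: z adj_sp)
  finally show "gram a b I h c = 0" .
qed

section \<open>Finite dimensionality and interpolation points\<close>

definition finite_rank :: "(complex mat \<Rightarrow> complex mat \<Rightarrow> complex) \<Rightarrow> bool" where
  "finite_rank k \<longleftrightarrow> (\<exists>(S :: nat set) \<alpha> \<tau>. finite S \<and> (\<forall>h\<in>sp. \<forall>g\<in>sp. k h g = (\<Sum>s\<in>S. \<alpha> s h * \<tau> s g)))"

lemma finite_rank_sum_prod:
  assumes "finite K" "\<And>h g. h \<in> sp \<Longrightarrow> g \<in> sp \<Longrightarrow> k h g = (\<Sum>x\<in>K. \<alpha> x h * \<tau> x g)"
  shows "finite_rank k"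
proof -
  obtain e :: "nat \<Rightarrow> _" where e: "bij_betw e {0..<card K} K"
    using ex_bij_betw_nat_finite[OF assms(1)] by blast
  have "k h g = (\<Sum>s\<in>{0..<card K}. \<alpha> (e s) h * \<tau> (e s) g)" if "h \<in> sp" "g \<in> sp" for h g
    using assms(2)[OF that] sum.reindex_bij_betw[OF e, of "\<lambda>x. \<alpha> x h * \<tau> x g"] by simp
  then show ?thesis
    unfolding finite_rank_def by (intro exI[of _ "{0..<card K}"] exI[of _ "\<lambda>s. \<alpha> (e s)"] exI[of _ "\<lambda>s. \<tau> (e s)"]) simp
qed

lemma finite_rank_mult:
  assumes "finite_rank k" "finite_rank k'"
  shows "finite_rank (\<lambda>h g. k h g * k' h g)"
proof -
  obtain S \<alpha> \<tau> where 1: "finite (S :: nat set)" "\<forall>h\<in>sp. \<forall>g\<in>sp. k h g = (\<Sum>s\<in>S. \<alpha> s h * \<tau> s g)"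
    using assms(1) by (auto simp: finite_rank_def)
  obtain S' \<alpha>' \<tau>' where 2: "finite (S' :: nat set)" "\<forall>h\<in>sp. \<forall>g\<in>sp. k' h g = (\<Sum>s\<in>S'. \<alpha>' s h * \<tau>' s g)"
    using assms(2) by (auto simp: finite_rank_def)
  show ?thesis
  proof (rule finite_rank_sum_prod)
    show "finite (S \<times> S')" using 1 2 by simp
    show "k h g * k' h g = (\<Sum>x\<in>S \<times> S'. (\<alpha> (fst x) h * \<alpha>' (snd x) h) * (\<tau> (fst x) g * \<tau>' (snd x) g))"
      if "h \<in> sp" "g \<in> sp" for h g
    proof -
      have "k h g * k' h g = (\<Sum>s\<in>S. \<alpha> s h * \<tau> s g) * (\<Sum>s\<in>S'. \<alpha>' s h * \<tau>' s g)"
        using 1 2 that by simp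
      also have "\<dots> = (\<Sum>x\<in>S \<times> S'. (\<alpha> (fst x) h * \<tau> (fst x) g) * (\<alpha>' (snd x) h * \<tau>' (snd x) g))"
        by (simp add: sum_product sum.cartesian_product case_prod_beta)
      finally show ?thesis by (simp add: mult_ac)
    qed
  qed
qed

lemma finite_rank_power: "finite_rank k \<Longrightarrow> finite_rank (\<lambda>h g. k h g ^ m)"
proof (induction m)
  case 0
  show ?case by (rule finite_rank_sum_prod[of "{0::nat}" _ "\<lambda>_ _. 1" "\<lambda>_ _. 1"]) auto
next
  case (Suc m)
  then show ?case using finite_rank_mult by simp
qed

text \<open>Kernels of finite rank are closed under products, so the translates of
  \<open>lead a b\<close> span a finite-dimensional space.\<close>

lemma finite_rank_lead: "finite_rank (\<lambda>h g. lead a b (h * g))"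
  unfolding lead_def
proof (intro finite_rank_mult finite_rank_power)
  show "finite_rank (\<lambda>h g. (h * g) $$ (0, 0))"
    by (rule finite_rank_sum_prod[of "{..<4}" _ "\<lambda>k h. h $$ (0, k)" "\<lambda>k g. g $$ (k, 0)"])
      (simp_all add: mult_entry_00 sp_carrier_mat del: index_mult_mat(1))
  show "finite_rank (\<lambda>h g. row_minor 0 1 (h * g))"
    by (rule finite_rank_sum_prod[of "{..<4} \<times> {..<4}" _ "\<lambda>p h. row_minor (fst p) (snd p) h"
          "\<lambda>p g. row_minor (fst p) (snd p) (transpose_mat g) / 2"])
      (simp_all add: row_minor_mult sp_carrier_mat sum.cartesian_product case_prod_beta)
qed

text \<open>A basis of the span of the translates is picked among the translates themselves, so that
  its members are indexed by group elements \<open>h i\<close>.\<close>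

lemma kernel_frame_exists:
  obtains n h coef where "\<And>i. i < n \<Longrightarrow> h i \<in> sp"
    "\<And>x g. x \<in> sp \<Longrightarrow> g \<in> sp \<Longrightarrow> lead a b (x * g) = (\<Sum>i<n. coef x i * lead a b (h i * g))"
    "\<And>c i. (\<And>g. g \<in> sp \<Longrightarrow> (\<Sum>i<n. c i * lead a b (h i * g)) = 0) \<Longrightarrow> i < (n::nat) \<Longrightarrow> c i = 0"
proof -
  let ?scale = "\<lambda>(c::complex) (f :: complex mat \<Rightarrow> complex) x. c * f x"
  interpret vs: vector_space ?scale
    by unfold_locales (auto simp: algebra_simps fun_eq_iff)
  have sum_app: "(\<Sum>i\<in>I. f i) x = (\<Sum>i\<in>I. f i x)" for I :: "'i set" and f :: "'i \<Rightarrow> complex mat \<Rightarrow> complex" and x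
    by (induction I rule: infinite_finite_induct) auto
  \<comment> \<open>Zero outside the group, so that equality of functions means equality on
    \<open>sp\<close>.\<close>
  define K where "K = (\<lambda>h g. if g \<in> sp then lead a b (h * g) else 0)"
  obtain S \<alpha> \<tau> where S: "finite (S :: nat set)"
    "\<And>h g. h \<in> sp \<Longrightarrow> g \<in> sp \<Longrightarrow> lead a b (h * g) = (\<Sum>s\<in>S. \<alpha> s h * \<tau> s g)"
    using finite_rank_lead[of a b] unfolding finite_rank_def by blast
  define T where "T = (\<lambda>s g. if g \<in> sp then \<tau> s g else 0) ` S"
  have "finite T" using S by (simp add: T_def)
  have K_span: "K h \<in> vs.span T" if "h \<in> sp" for h
  proof -
    have "K h = (\<Sum>s\<in>S. ?scale (\<alpha> s h) (\<lambda>g. if g \<in> sp then \<tau> s g else 0))"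
      using S(2)[OF that] by (auto simp: K_def sum_app fun_eq_iff)
    also have "\<dots> \<in> vs.span T"
      by (intro vs.span_sum vs.span_scale vs.span_base) (auto simp: T_def)
    finally show ?thesis .
  qed
  obtain B where B: "B \<subseteq> K ` sp" "vs.independent B" "K ` sp \<subseteq> vs.span B"
    using vs.maximal_independent_subset by blast
  have fB: "finite B"
    using vs.independent_span_bound[OF \<open>finite T\<close> B(2)] B(1) K_span by blast
  obtain e where e: "bij_betw e {0..<card B} B"
    using ex_bij_betw_nat_finite[OF fB] by blast
  let ?n = "card B"
  have "e i \<in> K ` sp" if "i < ?n" for i
    using B(1) bij_betwE[OF e] that by auto
  then have "\<forall>i. \<exists>h. i < ?n \<longrightarrow> h \<in> sp \<and> e i = K h" by blast
  then obtain h where h: "\<And>i. i < ?n \<Longrightarrow> h i \<in> sp" "\<And>i. i < ?n \<Longrightarrow> e i = K (h i)"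
    by (metis (full_types))
  define u where "u = (\<lambda>x. SOME w. K x = (\<Sum>v\<in>B. ?scale (w v) v))"
  have u: "K x = (\<Sum>v\<in>B. ?scale (u x v) v)" if "x \<in> sp" for x
  proof -
    have "K x \<in> vs.span B" using B(3) that by auto
    then obtain w where "K x = (\<Sum>v\<in>B. ?scale (w v) v)"
      unfolding vs.span_finite[OF fB] by (rule imageE)
    then show ?thesis unfolding u_def by (rule someI[where P = "\<lambda>w. K x = (\<Sum>v\<in>B. ?scale (w v) v)"])
  qed
  have reindex: "(\<Sum>v\<in>B. w v * v g) = (\<Sum>i<?n. w (e i) * e i g)" for w g
    using sum.reindex_bij_betw[OF e, of "\<lambda>v. w v * v g"] by (simp add: atLeast0LessThan)
  show ?thesis
  proof (rule that[of ?n h "\<lambda>x i. u x (e i)"])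
    show "h i \<in> sp" if "i < ?n" for i using h that by blast
    show "lead a b (x * g) = (\<Sum>i<?n. u x (e i) * lead a b (h i * g))" if "x \<in> sp" "g \<in> sp" for x g
    proof -
      have "lead a b (x * g) = K x g" using that by (simp add: K_def)
      also have "\<dots> = (\<Sum>i<?n. u x (e i) * e i g)"
        using u[OF that(1)] by (simp add: sum_app reindex)
      also have "\<dots> = (\<Sum>i<?n. u x (e i) * lead a b (h i * g))"
        using h that by (intro sum.cong) (auto simp: K_def)
      finally show ?thesis .
    qed
    show "c i = 0" if z: "\<And>g. g \<in> sp \<Longrightarrow> (\<Sum>i<?n. c i * lead a b (h i * g)) = 0" and i: "i < ?n" for c i
    proof -
      define w where "w = (\<lambda>v. c (the_inv_into {0..<?n} e v))"
      have we: "w (e j) = c j" if "j < ?n" for j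
        using e that by (simp add: w_def the_inv_into_f_f bij_betw_def)
      have "(\<Sum>v\<in>B. ?scale (w v) v) = 0"
      proof
        fix g
        have "(\<Sum>v\<in>B. ?scale (w v) v) g = (\<Sum>i<?n. c i * K (h i) g)"
          unfolding sum_app reindex by (intro sum.cong) (simp_all add: we flip: h(2))
        then show "(\<Sum>v\<in>B. ?scale (w v) v) g = 0 g"
          using z by (cases "g \<in> sp") (auto simp: K_def)
      qed
      moreover have "e i \<in> B" using e i by (auto simp: bij_betw_def)
      ultimately have "w (e i) = 0"
        using vs.independentD[OF B(2) fB] by blast
      then show ?thesis using we i by simp
    qed
  qed
qed

text \<open>The model of highest weight \<open>(a + b, b)\<close>: \<open>n\<close> is its
  dimension, a vector is a list of values at the points \<open>h i\<close>, and
  \<open>coef x\<close> is the covector that evaluates at \<open>x\<close>.\<close>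

locale kernel_frame =
  fixes a b n :: nat and h :: "nat \<Rightarrow> complex mat" and coef :: "complex mat \<Rightarrow> nat \<Rightarrow> complex"
  assumes h_sp: "i < n \<Longrightarrow> h i \<in> sp"
    and coef: "x \<in> sp \<Longrightarrow> g \<in> sp \<Longrightarrow> lead a b (x * g) = (\<Sum>i<n. coef x i * lead a b (h i * g))"
    and indep: "(\<And>g. g \<in> sp \<Longrightarrow> (\<Sum>i<n. c i * lead a b (h i * g)) = 0) \<Longrightarrow> i < n \<Longrightarrow> c i = 0"
begin

lemma coef_unique:
  assumes "x \<in> sp" "\<And>g. g \<in> sp \<Longrightarrow> lead a b (x * g) = (\<Sum>i<n. c i * lead a b (h i * g))" "i < n"
  shows "coef x i = c i"
proof -
  have "(\<Sum>i<n. (coef x i - c i) * lead a b (h i * g)) = 0" if "g \<in> sp" for g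
    using assms(2)[OF that] coef[OF assms(1) that] by (simp add: left_diff_distrib sum_subtractf)
  from indep[OF this assms(3)] show ?thesis by simp
qed

text \<open>The expansion of the translate at \<open>x\<close> passes to all forms by
  \<open>form_vanishes\<close>; hence the values at the \<open>h i\<close> determine a form.\<close>

lemma form_coef:
  assumes "form a b F" "x \<in> sp"
  shows "F x = (\<Sum>i<n. coef x i * F (h i))"
proof -
  \<comment> \<open>The point \<open>x\<close> is appended at index \<open>n\<close> with
    coefficient -1, which turns the expansion into a linear relation.\<close>
  let ?h = "\<lambda>i. if i < n then h i else x" and ?c = "\<lambda>i. if i < n then coef x i else - 1"
  have *: "(\<Sum>i<Suc n. ?c i * H (?h i)) = (\<Sum>i<n. coef x i * H (h i)) - H x" for H :: "complex mat \<Rightarrow> complex"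
    by simp
  have "(\<Sum>i<Suc n. ?c i * F (?h i)) = 0"
  proof (rule form_vanishes[OF _ _ assms(1)])
    show "?h i \<in> sp" for i using h_sp assms by simp
    show "(\<Sum>i<Suc n. ?c i * lead a b (?h i * g)) = 0" if "g \<in> sp" for g
      using coef[OF assms(2) that] *[of "\<lambda>y. lead a b (y * g)"] by simp
  qed
  then show ?thesis unfolding * by simp
qed

text \<open>Two ways of expanding \<open>lead a b\<close> at \<open>x * (g * y)\<close>, compared by
  uniqueness; in matrix form this is multiplicativity of \<open>frame_rep\<close>.\<close>

lemma coef_mult:
  assumes "x \<in> sp" "g \<in> sp" "j < n"
  shows "coef (x * g) j = (\<Sum>k<n. coef x k * coef (h k * g) j)"
proof (rule coef_unique[OF sp_mult[OF assms(1,2)] _ assms(3)])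
  fix y assume y: "y \<in> sp"
  have "lead a b ((x * g) * y) = (\<Sum>k<n. coef x k * lead a b (h k * (g * y)))"
    using assms y by (simp add: sp_assoc coef[OF assms(1) sp_mult[OF assms(2) y]])
  also have "\<dots> = (\<Sum>k<n. coef x k * (\<Sum>i<n. coef (h k * g) i * lead a b (h i * y)))"
  proof (intro sum.cong refl arg_cong2[where f = "(*)"])
    fix k assume "k \<in> {..<n}"
    then have k: "h k \<in> sp" using h_sp by simp
    show "lead a b (h k * (g * y)) = (\<Sum>i<n. coef (h k * g) i * lead a b (h i * y))"
      using coef[OF sp_mult[OF k assms(2)] y] by (simp only: sp_assoc[OF k assms(2) y])
  qed
  also have "\<dots> = (\<Sum>i<n. (\<Sum>k<n. coef x k * coef (h k * g) i) * lead a b (h i * y))"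
    by (simp add: sum_distrib_left sum_distrib_right mult.assoc) (rule sum.swap)
  finally show "lead a b ((x * g) * y) = (\<Sum>i<n. (\<Sum>k<n. coef x k * coef (h k * g) i) * lead a b (h i * y))" .
qed

lemma coef_h: "i < n \<Longrightarrow> j < n \<Longrightarrow> coef (h i) j = (if j = i then 1 else 0)"
  by (rule coef_unique) (simp_all add: h_sp if_distrib[of "\<lambda>x. x * _"] cong: if_cong)

lemma sum_coef_h: "i < n \<Longrightarrow> (\<Sum>j<n. coef (h i) j * w j) = w i"
proof -
  assume i: "i < n"
  have "(\<Sum>j<n. coef (h i) j * w j) = (\<Sum>j<n. if j = i then w i else 0)"
    using i by (intro sum.cong) (auto simp: coef_h)
  then show ?thesis using i by simp
qed

lemma coef_torus:
  assumes "s \<noteq> 0" "t \<noteq> 0" "i < n"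
  shows "coef (torus_elt s t) i = s ^ (a + b) * t ^ b * coef (1\<^sub>m 4) i"
proof (rule coef_unique[OF torus_elt_sp[OF assms(1,2)] _ assms(3)])
  fix g assume g: "g \<in> sp"
  have c: "g \<in> carrier_mat 4 4" by (rule sp_carrier_mat[OF g])
  have "lead a b (torus_elt s t * g) = s ^ (a + b) * t ^ b * lead a b g"
    by (rule lead_torus[OF c])
  also have "lead a b g = lead a b (1\<^sub>m 4 * g)" using c by simp
  also have "\<dots> = (\<Sum>i<n. coef (1\<^sub>m 4) i * lead a b (h i * g))" using g by (rule coef[OF sp_one])
  finally show "lead a b (torus_elt s t * g) = (\<Sum>i<n. (s ^ (a + b) * t ^ b * coef (1\<^sub>m 4) i) * lead a b (h i * g))"
    by (simp add: sum_distrib_left mult_ac)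
qed

text \<open>The vectors \<open>w\<close> for which the sum of \<open>coef x i * w $ i\<close> is
  regular in \<open>x\<close> form a subspace containing the value vectors of all right translates
  of \<open>lead a b\<close>. By independence no nonzero covector kills these, so every unit vector
  belongs to it.\<close>

lemma regular_coef:
  assumes "j < n" shows "regular (\<lambda>x. coef x j)"
proof -
  let ?W = "{w \<in> carrier_vec n. regular (\<lambda>x. \<Sum>i<n. coef x i * w $ i)}"
  have 0: "0\<^sub>v n \<in> ?W" by (simp add: regular_const)
  have add: "w + u \<in> ?W" if "w \<in> ?W" "u \<in> ?W" for w u
  proof -
    have "(\<lambda>x. \<Sum>i<n. coef x i * (w + u) $ i) = (\<lambda>x. (\<Sum>i<n. coef x i * w $ i) + (\<Sum>i<n. coef x i * u $ i))"
      unfolding sum.distrib[symmetric] using that by (intro ext sum.cong refl) (auto simp: distrib_left)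
    then show ?thesis using that by (auto intro: regular_add)
  qed
  have smult: "c \<cdot>\<^sub>v w \<in> ?W" if "w \<in> ?W" for w c
  proof -
    have "(\<lambda>x. \<Sum>i<n. coef x i * (c \<cdot>\<^sub>v w) $ i) = (\<lambda>x. c * (\<Sum>i<n. coef x i * w $ i))"
      unfolding sum_distrib_left using that by (intro ext sum.cong refl) auto
    then show ?thesis using that by (auto intro: regular_cmult)
  qed
  have W: "subspace_vec n ?W"
    unfolding subspace_vec_def using 0 add smult by (intro conjI ballI allI Collect_restrict)
  have "unit_vec n j \<in> ?W"
  proof (rule ccontr)
    assume "unit_vec n j \<notin> ?W"
    then obtain r where r: "\<And>w. w \<in> ?W \<Longrightarrow> pairing n r w = 0" "pairing n r (unit_vec n j) \<noteq> 0"
      using separating_covector[OF W unit_vec_carrier] by blast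
    have "(\<Sum>i<n. r i * lead a b (h i * g)) = 0" if g: "g \<in> sp" for g
    proof -
      have "regular (\<lambda>x. lead a b (x * g))"
        by (rule regular_right_translate[OF form_regular[OF lead_form] g])
      then have "regular (\<lambda>x. \<Sum>i<n. coef x i * vec n (\<lambda>i. lead a b (h i * g)) $ i)"
        by (rule iffD1[OF regular_cong, rotated]) (use g in \<open>simp add: coef\<close>)
      then have "vec n (\<lambda>i. lead a b (h i * g)) \<in> ?W" by simp
      from r(1)[OF this] show ?thesis by (simp add: pairing_def)
    qed
    then have "r i = 0" if "i < n" for i using indep that by blast
    then show False using r(2) by (simp add: pairing_def)
  qed
  then have "regular (\<lambda>x. \<Sum>i<n. coef x i * unit_vec n j $ i)" by simp
  moreover have "(\<Sum>i<n. coef x i * unit_vec n j $ i) = coef x j" for x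
  proof -
    have "(\<Sum>i<n. coef x i * unit_vec n j $ i) = (\<Sum>i<n. if i = j then coef x j else 0)"
      using assms by (intro sum.cong) auto
    then show ?thesis using assms by simp
  qed
  ultimately show ?thesis by simp
qed

section \<open>Right translation in terms of values at the frame points\<close>

definition frame_rep :: "complex mat \<Rightarrow> complex mat" where
  "frame_rep g = mat n n (\<lambda>(i, j). coef (h i * g) j)"

lemma frame_rep_carrier [simp]: "frame_rep g \<in> carrier_mat n n"
  by (simp add: frame_rep_def)

lemma frame_rep_index [simp]: "i < n \<Longrightarrow> j < n \<Longrightarrow> frame_rep g $$ (i, j) = coef (h i * g) j"
  by (simp add: frame_rep_def)

lemma frame_rep_mult:
  assumes "x \<in> sp" "y \<in> sp"
  shows "frame_rep (x * y) = frame_rep x * frame_rep y"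
proof (rule eq_matI)
  fix i j assume "i < dim_row (frame_rep x * frame_rep y)" "j < dim_col (frame_rep x * frame_rep y)"
  then have ij: "i < n" "j < n" by (simp_all add: frame_rep_def)
  have "coef (h i * (x * y)) j = coef ((h i * x) * y) j"
    using assms ij h_sp by (simp add: sp_assoc)
  also have "\<dots> = (\<Sum>k<n. coef (h i * x) k * coef (h k * y) j)"
    using assms ij h_sp by (intro coef_mult sp_mult) auto
  also have "\<dots> = (frame_rep x * frame_rep y) $$ (i, j)"
    using ij by (simp add: frame_rep_def scalar_prod_def atLeast0LessThan)
  finally show "frame_rep (x * y) $$ (i, j) = (frame_rep x * frame_rep y) $$ (i, j)"
    using ij by simp
qed (simp_all add: frame_rep_def)

lemma frame_rep_one: "frame_rep (1\<^sub>m 4) = 1\<^sub>m n"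
proof -
  have "h i * 1\<^sub>m 4 = h i" if "i < n" for i
    using sp_carrier_mat[OF h_sp[OF that]] by (rule right_mult_one_mat)
  then show ?thesis by (intro eq_matI) (auto simp: coef_h frame_rep_def)
qed

lemma rational_frame_rep: "rational_rep n frame_rep"
  unfolding rational_rep_def
proof (intro conjI allI impI)
  have "frame_rep g \<in> Units (ring_mat TYPE(complex) n ())" if "g \<in> sp" for g
  proof -
    obtain g' where "g' \<in> sp" "g' * g = 1\<^sub>m 4" "g * g' = 1\<^sub>m 4" using sp_inverse[OF \<open>g \<in> sp\<close>] .
    then have "frame_rep g' * frame_rep g = 1\<^sub>m n" "frame_rep g * frame_rep g' = 1\<^sub>m n"
      using that by (simp_all add: frame_rep_mult[symmetric] frame_rep_one)
    then show ?thesis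
      unfolding Units_def ring_mat_simps using frame_rep_carrier by blast
  qed
  then show "frame_rep \<in> hom Sp4 (units_of (ring_mat TYPE(complex) n ()))"
    by (auto simp: hom_def units_of_def ring_mat_simps frame_rep_mult)
next
  fix i j assume ij: "i < n" "j < n"
  have "regular (\<lambda>g. coef (h i * g) j)"
    by (rule regular_left_translate[OF regular_coef[OF ij(2)] h_sp[OF ij(1)]])
  then show "\<exists>p\<in>entry_polys. \<forall>g\<in>sp. frame_rep g $$ (i, j) = p g"
    using ij by (simp add: regular_def)
qed

sublocale rational_representation n frame_rep
  by unfold_locales (rule rational_frame_rep)

definition form_vec :: "(complex mat \<Rightarrow> complex) \<Rightarrow> complex vec" where
  "form_vec F = vec n (\<lambda>i. F (h i))"

lemma form_vec_carrier [simp]: "form_vec F \<in> carrier_vec n"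
  by (simp add: form_vec_def)

lemma form_vec_dim [simp]: "dim_vec (form_vec F) = n"
  by (simp add: form_vec_def)

lemma form_vec_index [simp]: "i < n \<Longrightarrow> form_vec F $ i = F (h i)"
  by (simp add: form_vec_def)

lemma frame_rep_form:
  assumes "form a b F" "g \<in> sp" "i < n"
  shows "(\<Sum>j<n. frame_rep g $$ (i, j) * F (h j)) = F (h i * g)"
  using assms by (simp add: form_coef[OF assms(1) sp_mult[OF h_sp[OF assms(3)] assms(2)]])

lemma frame_rep_form_vec:
  assumes "form a b F" "g \<in> sp" "i < n"
  shows "(frame_rep g *\<^sub>v form_vec F) $ i = F (h i * g)"
  unfolding frame_rep_form[OF assms, symmetric]
  using assms(3) by (subst mult_mat_vec_index[of _ n]) (auto simp: form_vec_def)

abbreviation lead_vec :: "complex vec" where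
  "lead_vec \<equiv> form_vec (lead a b)"

lemma lead_vec_highest_weight: "highest_weight_vector n frame_rep (int (a + b), int b) lead_vec"
  unfolding highest_weight_vector_def
proof (intro conjI ballI allI impI)
  show "lead_vec \<in> carrier_vec n" by simp
  have "lead a b (1\<^sub>m 4) = 1" by (simp add: lead_def row_minor_def)
  then have "(\<Sum>i<n. coef (1\<^sub>m 4) i * lead a b (h i)) = 1"
    using form_coef[OF lead_form sp_one] by simp
  then obtain i where "i < n" "lead a b (h i) \<noteq> 0"
    by (metis (no_types, lifting) lessThan_iff mult_zero_right sum.neutral zero_neq_one)
  then have "lead_vec $ i \<noteq> 0\<^sub>v n $ i" by (simp add: form_vec_def)
  then show "lead_vec \<noteq> 0\<^sub>v n" by metis
next
  fix u assume u: "u \<in> max_unipotent"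
  then have sp: "u \<in> sp" by (simp add: max_unipotent_def)
  then have c: "u \<in> carrier_mat 4 4" by (rule sp_carrier_mat)
  have "lead a b (x * u) = lead a b x" if "x \<in> carrier_mat 4 4" for x
    using u c that
    by (simp add: max_unipotent_def upper_triangular_4_iff all_less_4 lead_def row_minor_def mult_index_4 del: index_mult_mat(1))
      (simp add: algebra_simps)
  then have "(frame_rep u *\<^sub>v lead_vec) $ i = lead_vec $ i" if "i < n" for i
    using that sp_carrier_mat[OF h_sp[OF that]] sp by (simp add: frame_rep_form_vec lead_form del: index_mult_mat_vec)
  then show "frame_rep u *\<^sub>v lead_vec = lead_vec"
    by (intro eq_vecI) (simp_all add: frame_rep_def del: index_mult_mat_vec)
next
  fix s t :: complex assume st: "s \<noteq> 0" "t \<noteq> 0"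
  have "lead a b (x * torus_elt s t) = s ^ (a + b) * t ^ b * lead a b x" if "x \<in> carrier_mat 4 4" for x
    using that by (rule lead_torus)
  then have "(frame_rep (torus_elt s t) *\<^sub>v lead_vec) $ i = s ^ (a + b) * t ^ b * lead_vec $ i" if "i < n" for i
    using that sp_carrier_mat[OF h_sp[OF that]] torus_elt_sp[OF st]
    by (simp add: frame_rep_form_vec lead_form del: index_mult_mat_vec)
  then show "frame_rep (torus_elt s t) *\<^sub>v lead_vec =
      (s powi fst (int (a + b), int b) * t powi snd (int (a + b), int b)) \<cdot>\<^sub>v lead_vec"
    by (intro eq_vecI) (simp_all add: frame_rep_def power_int_of_nat del: index_mult_mat_vec of_nat_add)
qed

text \<open>Cyclicity of \<open>lead_vec\<close> is the independence of the frame.\<close>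

sublocale highest_weight_cyclic n frame_rep "(int (a + b), int b)" lead_vec
proof
  show "highest_weight_vector n frame_rep (int (a + b), int b) lead_vec" by (rule lead_vec_highest_weight)
  fix r assume *: "\<And>g. g \<in> sp \<Longrightarrow> pairing n r (frame_rep g *\<^sub>v lead_vec) = 0"
  have "(\<Sum>i<n. r i * lead a b (h i * g)) = 0" if "g \<in> sp" for g
    using *[OF that] that by (simp add: pairing_def frame_rep_form_vec lead_form del: index_mult_mat_vec)
  then show "\<forall>i<n. r i = 0" using indep by blast
qed

section \<open>Irreducibility of the model\<close>

lemma pairing_coef:
  assumes "x \<in> sp" "g \<in> sp" "w \<in> carrier_vec n"
  shows "pairing n (coef x) (frame_rep g *\<^sub>v w) = pairing n (coef (x * g)) w"
proof -
  have "pairing n (coef x) (frame_rep g *\<^sub>v w) = (\<Sum>i<n. \<Sum>j<n. coef x i * coef (h i * g) j * w $ j)"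
    unfolding pairing_def
    using assms by (intro sum.cong refl) (simp add: mult_mat_vec_index[of _ n] sum_distrib_left mult.assoc del: index_mult_mat_vec)
  also have "\<dots> = (\<Sum>j<n. \<Sum>i<n. coef x i * coef (h i * g) j * w $ j)" by (rule sum.swap)
  also have "\<dots> = pairing n (coef (x * g)) w"
    unfolding pairing_def using assms by (intro sum.cong refl) (simp add: coef_mult sum_distrib_right)
  finally show ?thesis .
qed

text \<open>Evaluation at the identity transforms under the torus by the highest weight character,
  so it is constant along the rescaled sequence; on \<open>lead_vec\<close> it is 1.\<close>

lemma contracts_eq_coef:
  assumes "w \<in> carrier_vec n" "contracts w c"
  shows "c = pairing n (coef (1\<^sub>m 4)) w"
proof -
  let ?ev = "pairing n (coef (1\<^sub>m 4))" and ?l = "(int (a + b), int b)"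
  let ?x = "\<lambda>k i. inverse (dominant_char ?l k) * (frame_rep (dominant_torus k) *\<^sub>v w) $ i"
  have "(\<lambda>k. \<Sum>i<n. coef (1\<^sub>m 4) i * ?x k i) \<longlonglongrightarrow> (\<Sum>i<n. coef (1\<^sub>m 4) i * (c * lead_vec $ i))"
    using assms(2) unfolding contracts_def by (intro tendsto_sum tendsto_mult[OF tendsto_const]) auto
  moreover have "(\<Sum>i<n. coef (1\<^sub>m 4) i * ?x k i) = ?ev w" for k
  proof -
    have nz: "(of_nat (Suc k) :: complex) ^ 2 \<noteq> 0" "(of_nat (Suc k) :: complex) \<noteq> 0"
      by (simp_all del: of_nat_Suc)
    have "(\<Sum>i<n. coef (1\<^sub>m 4) i * ?x k i) = inverse (dominant_char ?l k) * ?ev (frame_rep (dominant_torus k) *\<^sub>v w)"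
      by (simp add: pairing_def sum_distrib_left mult_ac)
    also have "?ev (frame_rep (dominant_torus k) *\<^sub>v w) = pairing n (coef (dominant_torus k)) w"
      using assms left_mult_one_mat[OF sp_carrier_mat[OF dominant_torus_sp]]
      by (simp add: pairing_coef dominant_torus_sp)
    also have "\<dots> = dominant_char ?l k * ?ev w"
      using nz by (simp add: pairing_def dominant_torus_def coef_torus dominant_char_def weight_char_def power_int_of_nat
          sum_distrib_left mult_ac del: of_nat_Suc of_nat_add)
    finally show ?thesis using dominant_char_nonzero[of ?l k] by simp
  qed
  moreover have "(\<Sum>i<n. coef (1\<^sub>m 4) i * (c * lead_vec $ i)) = c"
  proof -
    have "lead a b (1\<^sub>m 4) = 1" by (simp add: lead_def row_minor_def)
    then have "(\<Sum>i<n. coef (1\<^sub>m 4) i * lead a b (h i)) = 1"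
      using form_coef[OF lead_form sp_one] by simp
    then show ?thesis
      by (simp add: form_vec_def mult.left_commute[of _ c] flip: sum_distrib_left)
  qed
  ultimately show ?thesis
    by (simp add: LIMSEQ_const_iff)
qed

text \<open>A nonzero vector of \<open>W\<close> is nonzero at some \<open>h k\<close>. Translated
  by \<open>h k\<close> it is nonzero at the identity, so it contracts to a nonzero multiple of
  \<open>lead_vec\<close>. Covectors that vanish on \<open>W\<close> also vanish on the limit; hence
  \<open>lead_vec\<close> lies in \<open>W\<close> and generates everything.\<close>

lemma irreducible_frame_rep: "irreducible_rep n frame_rep"
  unfolding irreducible_rep_def subspace_vec_iff
proof (intro conjI allI impI)
  show "rational_rep n frame_rep" by (rule rational_frame_rep)
  show "n > 0"
  proof (rule ccontr)
    assume "\<not> n > 0"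
    then have "i < n \<Longrightarrow> lead_vec $ i = 0\<^sub>v n $ i" for i by simp
    then have "lead_vec = 0\<^sub>v n" by (rule eq_vecI) simp_all
    then show False using v_nonzero by simp
  qed
  fix W assume *: "subspace_vec n W \<and> (\<forall>g\<in>sp. \<forall>w\<in>W. frame_rep g *\<^sub>v w \<in> W)"
  then have W: "subspace_vec n W" and inv: "\<And>g w. g \<in> sp \<Longrightarrow> w \<in> W \<Longrightarrow> frame_rep g *\<^sub>v w \<in> W" by blast+
  have WC: "W \<subseteq> carrier_vec n" and W0: "0\<^sub>v n \<in> W" using W unfolding subspace_vec_def by blast+
  show "W = {0\<^sub>v n} \<or> W = carrier_vec n"
  proof (cases "W = {0\<^sub>v n}")
    case False
    then obtain w where w: "w \<in> W" "w \<noteq> 0\<^sub>v n" using W0 by blast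
    have wc: "w \<in> carrier_vec n" using w WC by blast
    obtain k where k: "k < n" "w $ k \<noteq> 0"
      using w(2) wc by (metis eq_vecI carrier_vecD index_zero_vec(1,2))
    define u where "u = frame_rep (h k) *\<^sub>v w"
    have u: "u \<in> W" "u \<in> carrier_vec n" using w(1) inv h_sp k WC by (auto simp: u_def)
    have ev: "pairing n (coef (1\<^sub>m 4)) u = w $ k"
      using k wc left_mult_one_mat[OF sp_carrier_mat[OF h_sp[OF k(1)]]] by (simp add: u_def pairing_coef h_sp sum_coef_h[of k] pairing_def[of n "coef (h k)"])
    obtain c where c: "contracts u c" using contracts_ex u by blast
    have cw: "c = w $ k" using contracts_eq_coef[OF u(2) c] ev by simp
    have lead_W: "lead_vec \<in> W"
    proof (rule ccontr)
      assume "lead_vec \<notin> W"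
      then obtain r where r: "\<And>w. w \<in> W \<Longrightarrow> pairing n r w = 0" "pairing n r lead_vec \<noteq> 0"
        using separating_covector[OF W form_vec_carrier] by blast
      let ?l = "(int (a + b), int b)"
      have "(\<lambda>k. \<Sum>i<n. r i * (inverse (dominant_char ?l k) * (frame_rep (dominant_torus k) *\<^sub>v u) $ i))
          \<longlonglongrightarrow> (\<Sum>i<n. r i * (c * lead_vec $ i))"
        using c unfolding contracts_def by (intro tendsto_sum tendsto_mult[OF tendsto_const]) auto
      moreover have "(\<Sum>i<n. r i * (inverse (dominant_char ?l k) * (frame_rep (dominant_torus k) *\<^sub>v u) $ i)) = 0" for k
      proof -
        have "(\<Sum>i<n. r i * (inverse (dominant_char ?l k) * (frame_rep (dominant_torus k) *\<^sub>v u) $ i)) =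
            inverse (dominant_char ?l k) * pairing n r (frame_rep (dominant_torus k) *\<^sub>v u)"
          by (simp add: pairing_def sum_distrib_left mult_ac)
        also have "\<dots> = 0" using r(1) inv[OF dominant_torus_sp u(1)] by simp
        finally show ?thesis .
      qed
      moreover have "(\<Sum>i<n. r i * (c * lead_vec $ i)) = c * pairing n r lead_vec"
        by (simp add: pairing_def sum_distrib_left mult_ac)
      ultimately have "c * pairing n r lead_vec = 0" by (simp add: LIMSEQ_const_iff)
      then show False using cw k r(2) by simp
    qed
    have "carrier_vec n \<subseteq> W"
    proof
      fix x :: "complex vec" assume x: "x \<in> carrier_vec n"
      show "x \<in> W"
      proof (rule ccontr)
        assume "x \<notin> W"
        then obtain r where r: "\<And>w. w \<in> W \<Longrightarrow> pairing n r w = 0" "pairing n r x \<noteq> 0"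
          using separating_covector[OF W x] by blast
        have "\<forall>i<n. r i = 0" using r(1) inv lead_W by (intro cyclic) blast
        then show False using r(2) by (simp add: pairing_def)
      qed
    qed
    then show ?thesis using WC by blast
  qed simp
qed

lemma irrep_frame_rep: "irrep_of_highest_weight (int (a + b), int b) n frame_rep"
  unfolding irrep_of_highest_weight_def using irreducible_frame_rep hwv by blast

end

section \<open>Invariants of triple tensor products\<close>

lemma sum_mult_div_mod:
  fixes f :: "nat \<Rightarrow> 'a::comm_monoid_add"
  shows "(\<Sum>p<m * c. f p) = (\<Sum>q<m. \<Sum>k<c. f (q * c + k))"
proof -
  have "sum f {q * c..<q * c + c} = (\<Sum>k<c. f (q * c + k))" for q
    using sum.shift_bounds_nat_ivl[of f 0 "q * c" c] by (simp add: atLeast0LessThan add.commute)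
  then show ?thesis by (simp add: sum.nat_group[symmetric])
qed

text \<open>The position of an elementary tensor in the iterated Kronecker product.\<close>

definition triple_index :: "nat \<Rightarrow> nat \<Rightarrow> nat \<Rightarrow> nat \<Rightarrow> nat \<Rightarrow> nat" where
  "triple_index b c i j k = (i * b + j) * c + k"

lemma pair_index_less: "i < a \<Longrightarrow> j < b \<Longrightarrow> i * b + j < a * (b::nat)"
  using mult_le_mono1[of "Suc i" a b] by simp

lemma triple_index_less: "i < a \<Longrightarrow> j < b \<Longrightarrow> k < c \<Longrightarrow> triple_index b c i j k < a * b * c"
  by (simp add: triple_index_def pair_index_less)

lemma triple_index_surj:
  assumes "p < a * b * c"
  obtains i j k where "i < a" "j < b" "k < c" "p = triple_index b c i j k"
proof
  have "c > 0" "b > 0" using assms by (auto intro: gr0I)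
  then show "p div c mod b < b" "p mod c < c" by auto
  have "p div c < a * b" using assms by (simp add: less_mult_imp_div_less)
  then show "p div c div b < a" by (simp add: less_mult_imp_div_less)
  show "p = triple_index b c (p div c div b) (p div c mod b) (p mod c)" by (simp add: triple_index_def)
qed

lemma kronecker3_index:
  assumes "A \<in> carrier_mat a a" "B \<in> carrier_mat b b" "C \<in> carrier_mat c c"
    and "i < a" "j < b" "k < c" "i' < a" "j' < b" "k' < c"
  shows "kronecker (kronecker A B) C $$ (triple_index b c i j k, triple_index b c i' j' k') =
    A $$ (i, i') * B $$ (j, j') * C $$ (k, k')"
proof -
  have "i * b + j < a * b" "i' * b + j' < a * b" using assms by (auto intro: pair_index_less)
  then show ?thesis
    using assms triple_index_less[of i a j b k c] triple_index_less[of i' a j' b k' c]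
    by (simp add: kronecker_def triple_index_def)
qed

lemma kronecker3_mult_vec:
  assumes "A \<in> carrier_mat a a" "B \<in> carrier_mat b b" "C \<in> carrier_mat c c" "v \<in> carrier_vec (a * b * c)"
    and "i < a" "j < b" "k < c"
  shows "(kronecker (kronecker A B) C *\<^sub>v v) $ triple_index b c i j k =
    (\<Sum>i'<a. \<Sum>j'<b. \<Sum>k'<c. A $$ (i, i') * B $$ (j, j') * C $$ (k, k') * v $ triple_index b c i' j' k')"
proof -
  have c: "kronecker (kronecker A B) C \<in> carrier_mat (a * b * c) (a * b * c)"
    using assms by (auto simp: kronecker_def)
  have "(kronecker (kronecker A B) C *\<^sub>v v) $ triple_index b c i j k =
    (\<Sum>p<a * b * c. kronecker (kronecker A B) C $$ (triple_index b c i j k, p) * v $ p)"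
    using c assms by (intro mult_mat_vec_index triple_index_less) auto
  also have "\<dots> = (\<Sum>i'<a. \<Sum>j'<b. \<Sum>k'<c. kronecker (kronecker A B) C $$ (triple_index b c i j k, triple_index b c i' j' k')
      * v $ triple_index b c i' j' k')"
    unfolding sum_mult_div_mod triple_index_def ..
  also have "\<dots> = (\<Sum>i'<a. \<Sum>j'<b. \<Sum>k'<c. A $$ (i, i') * B $$ (j, j') * C $$ (k, k') * v $ triple_index b c i' j' k')"
    using assms by (intro sum.cong refl) (simp add: kronecker3_index[of A a B b C c])
  finally show ?thesis .
qed

lemma invariants3_iff:
  assumes "\<And>g. g \<in> sp \<Longrightarrow> \<rho> g \<in> carrier_mat a a" "\<And>g. g \<in> sp \<Longrightarrow> \<sigma> g \<in> carrier_mat b b"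
    "\<And>g. g \<in> sp \<Longrightarrow> \<tau> g \<in> carrier_mat c c" and v: "v \<in> carrier_vec (a * b * c)"
  shows "v \<in> invariants (a * b * c) (tensor_rep (tensor_rep \<rho> \<sigma>) \<tau>) \<longleftrightarrow>
    (\<forall>g\<in>sp. \<forall>i<a. \<forall>j<b. \<forall>k<c. (\<Sum>i'<a. \<Sum>j'<b. \<Sum>k'<c. \<rho> g $$ (i, i') * \<sigma> g $$ (j, j') * \<tau> g $$ (k, k')
       * v $ triple_index b c i' j' k') = v $ triple_index b c i j k)"
proof -
  have "tensor_rep (tensor_rep \<rho> \<sigma>) \<tau> g *\<^sub>v v = v \<longleftrightarrow>
    (\<forall>i<a. \<forall>j<b. \<forall>k<c. (\<Sum>i'<a. \<Sum>j'<b. \<Sum>k'<c. \<rho> g $$ (i, i') * \<sigma> g $$ (j, j') * \<tau> g $$ (k, k')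
       * v $ triple_index b c i' j' k') = v $ triple_index b c i j k)" (is "?K *\<^sub>v v = v \<longleftrightarrow> ?R") if g: "g \<in> sp" for g
  proof -
    have d: "dim_vec (?K *\<^sub>v v) = a * b * c"
      using assms(1-3)[OF g] by (simp add: tensor_rep_def kronecker_def)
    have "?K *\<^sub>v v = v \<longleftrightarrow> (\<forall>p<a * b * c. (?K *\<^sub>v v) $ p = v $ p)"
      using d v by (auto intro!: eq_vecI simp del: index_mult_mat_vec)
    also have "\<dots> \<longleftrightarrow> (\<forall>i<a. \<forall>j<b. \<forall>k<c. (?K *\<^sub>v v) $ triple_index b c i j k = v $ triple_index b c i j k)"
      by (metis triple_index_less triple_index_surj)
    also have "\<dots> \<longleftrightarrow> ?R"
      using assms(1-3)[OF g] v by (simp add: tensor_rep_def kronecker3_mult_vec[of "\<rho> g" a "\<sigma> g" b "\<tau> g" c] del: index_mult_mat_vec)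
    finally show ?thesis .
  qed
  then show ?thesis using v by (simp add: invariants_def)
qed

section \<open>Invariant forms on triples of flags\<close>

text \<open>Sequences of matrices stand for triples, so that a slot can be varied by a function
  update; the first clause says that only the slots 0, 1, 2 matter.\<close>

definition tri_form :: "(nat \<Rightarrow> nat) \<Rightarrow> (nat \<Rightarrow> nat) \<Rightarrow> ((nat \<Rightarrow> complex mat) \<Rightarrow> complex) \<Rightarrow> bool" where
  "tri_form A B F \<longleftrightarrow> (\<forall>h h'. (\<forall>i<3. h i = h' i) \<longrightarrow> F h = F h') \<and> (\<forall>h. (\<forall>i<3. h i \<in> sp) \<longrightarrow>
     (\<forall>i<3. form (A i) (B i) (\<lambda>g. F (h(i := g)))) \<and> (\<forall>x\<in>sp. F (\<lambda>i. h i * x) = F h))"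

lemma tri_form_cong:
  "tri_form A B F \<Longrightarrow> (\<And>i. i < 3 \<Longrightarrow> A i = A' i) \<Longrightarrow> (\<And>i. i < 3 \<Longrightarrow> B i = B' i) \<Longrightarrow> tri_form A' B' F"
  by (simp add: tri_form_def)

lemma tri_form_mult:
  "tri_form A B F \<Longrightarrow> tri_form A' B' H \<Longrightarrow> tri_form (\<lambda>i. A i + A' i) (\<lambda>i. B i + B' i) (\<lambda>h. F h * H h)"
  unfolding tri_form_def by (simp add: form_mult) metis

lemma tri_form_power: "tri_form A B F \<Longrightarrow> tri_form (\<lambda>i. k * A i) (\<lambda>i. k * B i) (\<lambda>h. F h ^ k)"
  unfolding tri_form_def by (simp add: form_power) metis

lemma form_row_form: "form 1 0 (\<lambda>g. row_form g x 0 j)"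
proof -
  have row: "form 1 0 (\<lambda>g. c * g $$ (0, k))" if "k < 4" for k c
    using form_row[OF that form_const[of c]] by (simp add: One_nat_def mult.commute)
  have "form 1 0 (\<lambda>g. x $$ (j, 3) * g $$ (0, 0) + x $$ (j, 2) * g $$ (0, 1) + - x $$ (j, 1) * g $$ (0, 2) + - x $$ (j, 0) * g $$ (0, 3))"
    by (intro form_add row) auto
  then show ?thesis by (simp add: row_form_def mult_ac)
qed

text \<open>A determinant of products of the two rows with fixed vectors is bilinear and alternating
  in the rows, hence linear in the Pluecker coordinates.\<close>

lemma form_row_form_minor:
  "form 0 1 (\<lambda>g. row_form g x 0 i * row_form g y 1 j - row_form g x 1 i * row_form g y 0 j)"
proof -
  define p where "p = nth [x $$ (i, 3), x $$ (i, 2), - x $$ (i, 1), - x $$ (i, 0)]"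
  define q where "q = nth [y $$ (j, 3), y $$ (j, 2), - y $$ (j, 1), - y $$ (j, 0)]"
  have m: "form 0 1 (\<lambda>g. c * row_minor k l g)" if "k < 4" "l < 4" for k l c
    using form_minor[OF that form_const[of c]] by (simp add: One_nat_def mult.commute)
  have "form 0 1 (\<lambda>g. (p 0 * q 1 - p 1 * q 0) * row_minor 0 1 g + (p 0 * q 2 - p 2 * q 0) * row_minor 0 2 g
     + (p 0 * q 3 - p 3 * q 0) * row_minor 0 3 g + (p 1 * q 2 - p 2 * q 1) * row_minor 1 2 g
     + (p 1 * q 3 - p 3 * q 1) * row_minor 1 3 g + (p 2 * q 3 - p 3 * q 2) * row_minor 2 3 g)"
    by (intro form_add m) auto
  moreover have "(\<lambda>g. row_form g x 0 i * row_form g y 1 j - row_form g x 1 i * row_form g y 0 j) =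
    (\<lambda>g. (p 0 * q 1 - p 1 * q 0) * row_minor 0 1 g + (p 0 * q 2 - p 2 * q 0) * row_minor 0 2 g
     + (p 0 * q 3 - p 3 * q 0) * row_minor 0 3 g + (p 1 * q 2 - p 2 * q 1) * row_minor 1 2 g
     + (p 1 * q 3 - p 3 * q 1) * row_minor 1 3 g + (p 2 * q 3 - p 3 * q 2) * row_minor 2 3 g)"
    unfolding row_form_def row_minor_def p_def q_def by (rule ext) (simp add: algebra_simps)
  ultimately show ?thesis by simp
qed

lemma row_form_swap: "row_form g x i j = - row_form x g j i"
  by (simp add: row_form_def)

section \<open>The basic invariants of three flags\<close>

definition line_line :: "nat \<Rightarrow> nat \<Rightarrow> (nat \<Rightarrow> complex mat) \<Rightarrow> complex" where
  "line_line i j h = row_form (h i) (h j) 0 0"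

definition plane_plane :: "nat \<Rightarrow> nat \<Rightarrow> (nat \<Rightarrow> complex mat) \<Rightarrow> complex" where
  "plane_plane i j h = row_form (h i) (h j) 0 0 * row_form (h i) (h j) 1 1
     - row_form (h i) (h j) 1 0 * row_form (h i) (h j) 0 1"

definition line_line_plane :: "nat \<Rightarrow> nat \<Rightarrow> nat \<Rightarrow> (nat \<Rightarrow> complex mat) \<Rightarrow> complex" where
  "line_line_plane i j k h = row_form (h k) (h i) 0 0 * row_form (h k) (h j) 1 0
     - row_form (h k) (h i) 1 0 * row_form (h k) (h j) 0 0"

text \<open>The contractions of the line \<open>u\<^sub>i\<close> against the planes \<open>p\<^sub>j\<close> and \<open>p\<^sub>k\<close> are vectors in these planes;
  this is their symplectic product.\<close>

definition line2_plane_plane :: "nat \<Rightarrow> nat \<Rightarrow> nat \<Rightarrow> (nat \<Rightarrow> complex mat) \<Rightarrow> complex" where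
  "line2_plane_plane i j k h =
     row_form (h i) (h k) 0 1 * (row_form (h j) (h i) 0 0 * row_form (h j) (h k) 1 0 - row_form (h j) (h i) 1 0 * row_form (h j) (h k) 0 0)
   - row_form (h i) (h k) 0 0 * (row_form (h j) (h i) 0 0 * row_form (h j) (h k) 1 1 - row_form (h j) (h i) 1 0 * row_form (h j) (h k) 0 1)"

lemma tri_formI:
  assumes "\<And>h i. (\<And>i. i < 3 \<Longrightarrow> h i \<in> sp) \<Longrightarrow> i < 3 \<Longrightarrow> form (A i) (B i) (\<lambda>g. F (h(i := g)))"
    and "\<And>h x. (\<And>i. i < 3 \<Longrightarrow> h i \<in> carrier_mat 4 4) \<Longrightarrow> x \<in> sp \<Longrightarrow> F (\<lambda>i. h i * x) = F h"
    and "\<And>h h'. (\<And>i. i < 3 \<Longrightarrow> h i = h' i) \<Longrightarrow> F h = F h'"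
  shows "tri_form A B F"
  using assms sp_carrier_mat unfolding tri_form_def by blast

lemma tri_form_line_line:
  assumes "i < 3" "j < 3" "i \<noteq> j"
  shows "tri_form (\<lambda>s. of_bool (s = i) + of_bool (s = j)) (\<lambda>_. 0) (line_line i j)"
proof (rule tri_formI)
  fix h :: "nat \<Rightarrow> complex mat" and s :: nat
  have 1: "form 1 0 (\<lambda>g. row_form g (h j) 0 0)" by (rule form_row_form)
  have 2: "form 1 0 (\<lambda>g. row_form (h i) g 0 0)"
    using form_cmult[OF form_row_form, of "- 1"] by (simp add: row_form_swap[of "h i"])
  have 3: "form 0 0 (\<lambda>g. row_form (h i) (h j) 0 0)" by (rule form_const)
  show "form (of_bool (s = i) + of_bool (s = j)) 0 (\<lambda>g. line_line i j (h(s := g)))"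
    using 1 2 3 assms by (auto simp: line_line_def)
next
  fix h :: "nat \<Rightarrow> complex mat" and x
  assume h: "\<And>i. i < 3 \<Longrightarrow> h i \<in> carrier_mat 4 4" and x: "x \<in> sp"
  then show "line_line i j (\<lambda>i. h i * x) = line_line i j h"
    using assms by (simp add: line_line_def row_form_mult)
qed (use assms in \<open>simp add: line_line_def\<close>)

lemma tri_form_plane_plane:
  assumes "i < 3" "j < 3" "i \<noteq> j"
  shows "tri_form (\<lambda>_. 0) (\<lambda>s. of_bool (s = i) + of_bool (s = j)) (plane_plane i j)"
proof (rule tri_formI)
  fix h :: "nat \<Rightarrow> complex mat" and s :: nat
  have 1: "form 0 1 (\<lambda>g. plane_plane i j (h(i := g)))"
    using form_row_form_minor[of "h j" 0 "h j" 1] assms by (simp add: plane_plane_def)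
  have 2: "form 0 1 (\<lambda>g. plane_plane i j (h(j := g)))"
    using form_row_form_minor[of "h i" 0 "h i" 1] assms
    by (simp add: plane_plane_def row_form_swap[of "h i"] mult.commute)
  have 3: "form 0 0 (\<lambda>g. plane_plane i j (h(s := g)))" if "s \<noteq> i" "s \<noteq> j"
    using that by (simp add: plane_plane_def form_const)
  show "form 0 (of_bool (s = i) + of_bool (s = j)) (\<lambda>g. plane_plane i j (h(s := g)))"
    using 1 2 3 assms by (cases "s = i"; cases "s = j") auto
next
  fix h :: "nat \<Rightarrow> complex mat" and x
  assume h: "\<And>i. i < 3 \<Longrightarrow> h i \<in> carrier_mat 4 4" and x: "x \<in> sp"
  then show "plane_plane i j (\<lambda>i. h i * x) = plane_plane i j h"
    using assms by (simp add: plane_plane_def row_form_mult)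
qed (use assms in \<open>simp add: plane_plane_def\<close>)

lemma tri_form_line_line_plane:
  assumes "i < 3" "j < 3" "k < 3" "i \<noteq> j" "i \<noteq> k" "j \<noteq> k"
  shows "tri_form (\<lambda>s. of_bool (s = i) + of_bool (s = j)) (\<lambda>s. of_bool (s = k)) (line_line_plane i j k)"
proof (rule tri_formI)
  fix h :: "nat \<Rightarrow> complex mat" and s :: nat
  assume s: "s < 3"
  have 1: "form 1 0 (\<lambda>g. line_line_plane i j k (h(i := g)))"
  proof -
    have "form 1 0 (\<lambda>g. - row_form (h k) (h j) 1 0 * row_form g (h k) 0 0 + row_form (h k) (h j) 0 0 * row_form g (h k) 0 1)"
      by (intro form_add form_cmult form_row_form)
    then show ?thesis using assms by (simp add: line_line_plane_def row_form_swap[of "h k" "_ :: complex mat" _ 0] algebra_simps)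
  qed
  have 2: "form 1 0 (\<lambda>g. line_line_plane i j k (h(j := g)))"
  proof -
    have "form 1 0 (\<lambda>g. - row_form (h k) (h i) 0 0 * row_form g (h k) 0 1 + row_form (h k) (h i) 1 0 * row_form g (h k) 0 0)"
      by (intro form_add form_cmult form_row_form)
    then show ?thesis using assms by (simp add: line_line_plane_def row_form_swap[of "h k" "_ :: complex mat" _ 0] algebra_simps)
  qed
  have 3: "form 0 1 (\<lambda>g. line_line_plane i j k (h(k := g)))"
    using form_row_form_minor[of "h i" 0 "h j" 0] assms by (simp add: line_line_plane_def)
  have "s = i \<or> s = j \<or> s = k" using s assms by linarith
  then show "form (of_bool (s = i) + of_bool (s = j)) (of_bool (s = k)) (\<lambda>g. line_line_plane i j k (h(s := g)))"
    using 1 2 3 assms by auto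
next
  fix h :: "nat \<Rightarrow> complex mat" and x
  assume h: "\<And>i. i < 3 \<Longrightarrow> h i \<in> carrier_mat 4 4" and x: "x \<in> sp"
  then show "line_line_plane i j k (\<lambda>i. h i * x) = line_line_plane i j k h"
    using assms by (simp add: line_line_plane_def row_form_mult)
qed (use assms in \<open>simp add: line_line_plane_def\<close>)

lemma tri_form_line2_plane_plane:
  assumes "i < 3" "j < 3" "k < 3" "i \<noteq> j" "i \<noteq> k" "j \<noteq> k"
  shows "tri_form (\<lambda>s. 2 * of_bool (s = i)) (\<lambda>s. of_bool (s = j) + of_bool (s = k)) (line2_plane_plane i j k)"
proof (rule tri_formI)
  fix h :: "nat \<Rightarrow> complex mat" and s :: nat
  assume s: "s < 3"
  have q: "form 2 0 (\<lambda>g. c * (row_form g x 0 p * row_form g y 0 q))" for c x y p q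
    using form_cmult[OF form_mult[OF form_row_form[of x p] form_row_form[of y q]], of c] by simp
  have 1: "form 2 0 (\<lambda>g. line2_plane_plane i j k (h(i := g)))"
  proof -
    have "form 2 0 (\<lambda>g. - row_form (h j) (h k) 1 0 * (row_form g (h k) 0 1 * row_form g (h j) 0 0)
        + row_form (h j) (h k) 0 0 * (row_form g (h k) 0 1 * row_form g (h j) 0 1)
        + row_form (h j) (h k) 1 1 * (row_form g (h k) 0 0 * row_form g (h j) 0 0)
        + - row_form (h j) (h k) 0 1 * (row_form g (h k) 0 0 * row_form g (h j) 0 1))"
      by (intro form_add q)
    moreover have "line2_plane_plane i j k (h(i := g)) = - row_form (h j) (h k) 1 0 * (row_form g (h k) 0 1 * row_form g (h j) 0 0)
        + row_form (h j) (h k) 0 0 * (row_form g (h k) 0 1 * row_form g (h j) 0 1)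
        + row_form (h j) (h k) 1 1 * (row_form g (h k) 0 0 * row_form g (h j) 0 0)
        + - row_form (h j) (h k) 0 1 * (row_form g (h k) 0 0 * row_form g (h j) 0 1)" for g
      using assms by (simp add: line2_plane_plane_def row_form_swap[of "h j" g] algebra_simps)
    ultimately show ?thesis by simp
  qed
  have 2: "form 0 1 (\<lambda>g. line2_plane_plane i j k (h(j := g)))"
  proof -
    have "form 0 1 (\<lambda>g. row_form (h i) (h k) 0 1 * (row_form g (h i) 0 0 * row_form g (h k) 1 0 - row_form g (h i) 1 0 * row_form g (h k) 0 0)
       + - row_form (h i) (h k) 0 0 * (row_form g (h i) 0 0 * row_form g (h k) 1 1 - row_form g (h i) 1 0 * row_form g (h k) 0 1))"
      by (intro form_add form_cmult form_row_form_minor)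
    then show ?thesis using assms by (simp add: line2_plane_plane_def)
  qed
  have 3: "form 0 1 (\<lambda>g. line2_plane_plane i j k (h(k := g)))"
  proof -
    have "form 0 1 (\<lambda>g. - row_form (h j) (h i) 0 0 * (row_form g (h i) 0 0 * row_form g (h j) 1 1 - row_form g (h i) 1 0 * row_form g (h j) 0 1)
       + row_form (h j) (h i) 1 0 * (row_form g (h i) 0 0 * row_form g (h j) 1 0 - row_form g (h i) 1 0 * row_form g (h j) 0 0))"
      by (intro form_add form_cmult form_row_form_minor)
    moreover have "line2_plane_plane i j k (h(k := g)) = - row_form (h j) (h i) 0 0 * (row_form g (h i) 0 0 * row_form g (h j) 1 1 - row_form g (h i) 1 0 * row_form g (h j) 0 1)
       + row_form (h j) (h i) 1 0 * (row_form g (h i) 0 0 * row_form g (h j) 1 0 - row_form g (h i) 1 0 * row_form g (h j) 0 0)" for g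
      using assms by (simp add: line2_plane_plane_def row_form_swap[of "h j" g] row_form_swap[of "h i" g] algebra_simps)
    ultimately show ?thesis by simp
  qed
  have "s = i \<or> s = j \<or> s = k" using s assms by linarith
  then show "form (2 * of_bool (s = i)) (of_bool (s = j) + of_bool (s = k)) (\<lambda>g. line2_plane_plane i j k (h(s := g)))"
    using 1 2 3 assms by auto
next
  fix h :: "nat \<Rightarrow> complex mat" and x
  assume h: "\<And>i. i < 3 \<Longrightarrow> h i \<in> carrier_mat 4 4" and x: "x \<in> sp"
  then show "line2_plane_plane i j k (\<lambda>i. h i * x) = line2_plane_plane i j k h"
    using assms by (simp add: line2_plane_plane_def row_form_mult)
qed (use assms in \<open>simp add: line2_plane_plane_def\<close>)

text \<open>Two opposite flags and the point \<open>siegel_upper 3 5 2 * levi_upper 1\<close> of the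
  big cell; none of the basic invariants vanishes there.\<close>

definition generic_triple :: "nat \<Rightarrow> complex mat" where
  "generic_triple = nth [mat4 [[1,0,0,0],[0,1,0,0],[0,0,1,0],[0,0,0,1]],
     mat4 [[0,0,0,1],[0,0,1,0],[0,-1,0,0],[-1,0,0,0]],
     mat4 [[1,1,3,2],[0,1,2,1],[0,0,1,-1],[0,0,0,1]]]"

lemma less_3_iff: "i < (3::nat) \<longleftrightarrow> i = 0 \<or> i = 1 \<or> i = 2"
  by auto

lemma generic_triple_sp: "i < 3 \<Longrightarrow> generic_triple i \<in> sp"
  by (auto simp: less_3_iff generic_triple_def sp_iff_rows row_form_def)

text \<open>The hypotheses state the bidegree of a monomial with exponents \<open>M\<close>,
  \<open>N\<close>, \<open>C\<close>, \<open>D\<close> in the four kinds of invariants.\<close>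

lemma tri_form_exists:
  fixes M N C D :: "nat \<Rightarrow> nat"
  assumes "A 0 = M 1 + M 2 + C 1 + C 2 + 2 * D 0" "A 1 = M 0 + M 2 + C 0 + C 2 + 2 * D 1"
    "A 2 = M 0 + M 1 + C 0 + C 1 + 2 * D 2"
    and "B 0 = N 1 + N 2 + C 0 + D 1 + D 2" "B 1 = N 0 + N 2 + C 1 + D 0 + D 2"
    "B 2 = N 0 + N 1 + C 2 + D 0 + D 1"
  obtains F where "tri_form A B F" "F generic_triple \<noteq> 0"
proof -
  note ll = tri_form_power[OF tri_form_line_line] and pp = tri_form_power[OF tri_form_plane_plane]
    and llp = tri_form_power[OF tri_form_line_line_plane] and lpp = tri_form_power[OF tri_form_line2_plane_plane]
  note prods = tri_form_mult[OF tri_form_mult[OF tri_form_mult[OF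
      tri_form_mult[OF tri_form_mult[OF ll[of 1 2 "M 0"] ll[of 0 2 "M 1"]] ll[of 0 1 "M 2"]]
      tri_form_mult[OF tri_form_mult[OF pp[of 1 2 "N 0"] pp[of 0 2 "N 1"]] pp[of 0 1 "N 2"]]]
      tri_form_mult[OF tri_form_mult[OF llp[of 1 2 0 "C 0"] llp[of 0 2 1 "C 1"]] llp[of 0 1 2 "C 2"]]]
      tri_form_mult[OF tri_form_mult[OF lpp[of 0 1 2 "D 0"] lpp[of 1 0 2 "D 1"]] lpp[of 2 0 1 "D 2"]]]
  define F where "F = (\<lambda>h. (line_line 1 2 h ^ M 0 * line_line 0 2 h ^ M 1 * line_line 0 1 h ^ M 2)
    * (plane_plane 1 2 h ^ N 0 * plane_plane 0 2 h ^ N 1 * plane_plane 0 1 h ^ N 2)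
    * (line_line_plane 1 2 0 h ^ C 0 * line_line_plane 0 2 1 h ^ C 1 * line_line_plane 0 1 2 h ^ C 2)
    * (line2_plane_plane 0 1 2 h ^ D 0 * line2_plane_plane 1 0 2 h ^ D 1 * line2_plane_plane 2 0 1 h ^ D 2))"
  have "tri_form A B F"
    unfolding F_def
    by (rule tri_form_cong[OF prods]) (auto simp: less_3_iff assms)
  moreover have "F generic_triple \<noteq> 0"
    unfolding F_def generic_triple_def row_form_def line_line_def plane_plane_def line_line_plane_def
      line2_plane_plane_def by simp
  ultimately show ?thesis using that by blast
qed

section \<open>From invariant forms to invariant tensors\<close>

lemma frame_exists: "\<exists>n h coef. kernel_frame a b n h coef"
proof (rule kernel_frame_exists[of a b])
  fix n h coef
  assume f: "\<And>i. i < n \<Longrightarrow> h i \<in> sp"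
    "\<And>x g. x \<in> sp \<Longrightarrow> g \<in> sp \<Longrightarrow> lead a b (x * g) = (\<Sum>i<n. coef x i * lead a b (h i * g))"
    "\<And>c i. (\<And>g. g \<in> sp \<Longrightarrow> (\<Sum>i<n. c i * lead a b (h i * g)) = 0) \<Longrightarrow> i < (n::nat) \<Longrightarrow> c i = 0"
  have "kernel_frame a b n h coef"
  proof (rule kernel_frame.intro)
    show "h i \<in> sp" if "i < n" for i using that by (rule f(1))
    show "lead a b (x * g) = (\<Sum>i<n. coef x i * lead a b (h i * g))" if "x \<in> sp" "g \<in> sp" for x g
      using that by (rule f(2))
    show "c i = 0" if "\<And>g. g \<in> sp \<Longrightarrow> (\<Sum>i<n. c i * lead a b (h i * g)) = 0" "i < n" for c i
      using that by (rule f(3))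
  qed
  then show ?thesis by blast
qed

text \<open>The tensor lists the values of \<open>F\<close> on the grid of frame points. Acting by
  \<open>g\<close> translates one slot after the other, so invariance of \<open>F\<close> becomes
  invariance of the tensor. If it were zero, \<open>form_coef\<close> in each slot would extend the
  vanishing from the grid to all triples.\<close>

lemma Tens_of_tri_form:
  assumes F: "tri_form A B F" "F generic_triple \<noteq> 0"
  shows "((int (A 0 + B 0), int (B 0)), (int (A 1 + B 1), int (B 1)), (int (A 2 + B 2), int (B 2))) \<in> Tens"
proof -
  obtain n0 h0 q0 where f0: "kernel_frame (A 0) (B 0) n0 h0 q0" using frame_exists by blast
  obtain n1 h1 q1 where f1: "kernel_frame (A 1) (B 1) n1 h1 q1" using frame_exists by blast
  obtain n2 h2 q2 where f2: "kernel_frame (A 2) (B 2) n2 h2 q2" using frame_exists by blast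
  define \<rho> \<sigma> \<tau> where "\<rho> = kernel_frame.frame_rep n0 h0 q0" and "\<sigma> = kernel_frame.frame_rep n1 h1 q1"
    and "\<tau> = kernel_frame.frame_rep n2 h2 q2"
  define P where "P = (\<lambda>x y z. F (nth [x, y, z]))"
  have sp3: "\<forall>i<3. [x, y, z] ! i \<in> sp" if "x \<in> sp" "y \<in> sp" "z \<in> sp" for x y z
    using that by (simp add: less_3_iff)
  have local: "F h = F h'" if "h 0 = h' 0" "h 1 = h' 1" "h 2 = h' 2" for h h'
    using F(1) that unfolding tri_form_def less_3_iff by blast
  have slots: "form (A 0) (B 0) (\<lambda>g. P g y z)" "form (A 1) (B 1) (\<lambda>g. P x g z)" "form (A 2) (B 2) (\<lambda>g. P x y g)"
    and inv: "g \<in> sp \<Longrightarrow> P (x * g) (y * g) (z * g) = P x y z" if xyz: "x \<in> sp" "y \<in> sp" "z \<in> sp" for x y z g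
  proof -
    have f: "\<forall>i<3. form (A i) (B i) (\<lambda>g. F ((nth [x, y, z])(i := g)))"
      and i: "\<forall>g\<in>sp. F (\<lambda>i. [x, y, z] ! i * g) = F (nth [x, y, z])"
      using F(1) sp3[OF xyz] unfolding tri_form_def by blast+
    have "F ((nth [x, y, z])(0 := g)) = P g y z" "F ((nth [x, y, z])(1 := g)) = P x g z"
      "F ((nth [x, y, z])(2 := g)) = P x y g" for g
      unfolding P_def by (rule local; simp)+
    then show "form (A 0) (B 0) (\<lambda>g. P g y z)" "form (A 1) (B 1) (\<lambda>g. P x g z)" "form (A 2) (B 2) (\<lambda>g. P x y g)"
      using f by (simp_all add: less_3_iff)
    have "F (\<lambda>i. [x, y, z] ! i * g) = P (x * g) (y * g) (z * g)" for g
      unfolding P_def by (rule local) simp_all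
    then show "g \<in> sp \<Longrightarrow> P (x * g) (y * g) (z * g) = P x y z" using i by (simp add: P_def)
  qed
  note sp0 = kernel_frame.h_sp[OF f0] and sp1 = kernel_frame.h_sp[OF f1] and sp2 = kernel_frame.h_sp[OF f2]
  define t where "t = vec (n0 * n1 * n2) (\<lambda>p. P (h0 (p div n2 div n1)) (h1 (p div n2 mod n1)) (h2 (p mod n2)))"
  have t: "t $ triple_index n1 n2 i j k = P (h0 i) (h1 j) (h2 k)" if "i < n0" "j < n1" "k < n2" for i j k
    using that triple_index_less[OF that] by (simp add: t_def) (simp add: triple_index_def)
  have "t \<in> invariants (n0 * n1 * n2) (tensor_rep (tensor_rep \<rho> \<sigma>) \<tau>)"
  proof (subst invariants3_iff)
    show "t \<in> carrier_vec (n0 * n1 * n2)" by (simp add: t_def)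
    show "\<rho> g \<in> carrier_mat n0 n0" "\<sigma> g \<in> carrier_mat n1 n1" "\<tau> g \<in> carrier_mat n2 n2" for g
      by (simp_all add: \<rho>_def \<sigma>_def \<tau>_def kernel_frame.frame_rep_carrier[OF f0]
          kernel_frame.frame_rep_carrier[OF f1] kernel_frame.frame_rep_carrier[OF f2])
    show "\<forall>g\<in>sp. \<forall>i<n0. \<forall>j<n1. \<forall>k<n2. (\<Sum>i'<n0. \<Sum>j'<n1. \<Sum>k'<n2. \<rho> g $$ (i, i') * \<sigma> g $$ (j, j') * \<tau> g $$ (k, k')
       * t $ triple_index n1 n2 i' j' k') = t $ triple_index n1 n2 i j k"
    proof (intro ballI allI impI)
      fix g i j k assume g: "g \<in> sp" and ijk: "i < n0" "j < n1" "k < n2"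
      have "(\<Sum>i'<n0. \<Sum>j'<n1. \<Sum>k'<n2. \<rho> g $$ (i, i') * \<sigma> g $$ (j, j') * \<tau> g $$ (k, k') * t $ triple_index n1 n2 i' j' k')
        = (\<Sum>i'<n0. \<rho> g $$ (i, i') * (\<Sum>j'<n1. \<sigma> g $$ (j, j') * (\<Sum>k'<n2. \<tau> g $$ (k, k') * P (h0 i') (h1 j') (h2 k'))))"
        by (simp add: t sum_distrib_left mult.assoc)
      also have "\<dots> = (\<Sum>i'<n0. \<rho> g $$ (i, i') * (\<Sum>j'<n1. \<sigma> g $$ (j, j') * P (h0 i') (h1 j') (h2 k * g)))"
        unfolding \<tau>_def using g ijk
        by (intro sum.cong refl arg_cong2[where f = "(*)"] kernel_frame.frame_rep_form[OF f2] slots sp0 sp1 sp2) auto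
      also have "\<dots> = (\<Sum>i'<n0. \<rho> g $$ (i, i') * P (h0 i') (h1 j * g) (h2 k * g))"
        unfolding \<sigma>_def using g ijk
        by (intro sum.cong refl arg_cong2[where f = "(*)"] kernel_frame.frame_rep_form[OF f1] slots sp_mult sp0 sp1 sp2) auto
      also have "\<dots> = P (h0 i * g) (h1 j * g) (h2 k * g)"
        unfolding \<rho>_def using g ijk
        by (intro kernel_frame.frame_rep_form[OF f0] slots sp_mult sp0 sp1 sp2) auto
      also have "\<dots> = t $ triple_index n1 n2 i j k"
        using g ijk by (simp add: t inv sp0 sp1 sp2)
      finally show "(\<Sum>i'<n0. \<Sum>j'<n1. \<Sum>k'<n2. \<rho> g $$ (i, i') * \<sigma> g $$ (j, j') * \<tau> g $$ (k, k')
        * t $ triple_index n1 n2 i' j' k') = t $ triple_index n1 n2 i j k" .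
    qed
  qed
  moreover have "t \<noteq> 0\<^sub>v (n0 * n1 * n2)"
  proof
    assume "t = 0\<^sub>v (n0 * n1 * n2)"
    then have z: "P (h0 i) (h1 j) (h2 k) = 0" if "i < n0" "j < n1" "k < n2" for i j k
      using t[OF that] triple_index_less[OF that] by simp
    have "P (h0 i) (h1 j) z = 0" if "i < n0" "j < n1" "z \<in> sp" for i j z
      using kernel_frame.form_coef[OF f2 slots(3)[OF sp0 sp1 that(3)] that(3)] that z by simp
    then have "P (h0 i) y z = 0" if "i < n0" "y \<in> sp" "z \<in> sp" for i y z
      using kernel_frame.form_coef[OF f1 slots(2)[OF sp0 that(2,3)] that(2)] that by simp
    then have "P x y z = 0" if "x \<in> sp" "y \<in> sp" "z \<in> sp" for x y z
      using kernel_frame.form_coef[OF f0 slots(1)[OF that] that(1)] that by simp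
    moreover have "F generic_triple = P (generic_triple 0) (generic_triple 1) (generic_triple 2)"
      unfolding P_def by (rule local) simp_all
    ultimately show False using F(2) generic_triple_sp by simp
  qed
  ultimately have "invariants (n0 * n1 * n2) (tensor_rep (tensor_rep \<rho> \<sigma>) \<tau>) \<noteq> {0\<^sub>v (n0 * n1 * n2)}" by blast
  moreover have "irrep_of_highest_weight (int (A 0 + B 0), int (B 0)) n0 \<rho>"
    "irrep_of_highest_weight (int (A 1 + B 1), int (B 1)) n1 \<sigma>"
    "irrep_of_highest_weight (int (A 2 + B 2), int (B 2)) n2 \<tau>"
    unfolding \<rho>_def \<sigma>_def \<tau>_def
    by (rule kernel_frame.irrep_frame_rep[OF f0] kernel_frame.irrep_frame_rep[OF f1] kernel_frame.irrep_frame_rep[OF f2])+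
  moreover have "real_pt (int (a + b), int b) \<in> chamber" for a b :: nat
    by (simp add: real_pt_def chamber_def)
  ultimately show ?thesis
    unfolding Tens_def by blast
qed

section \<open>Decomposition of lattice points of the cone\<close>

text \<open>In the next two lemmas \<open>m\<^sub>i\<close>, \<open>n\<^sub>i\<close>, \<open>c\<^sub>i\<close>, \<open>d\<^sub>i\<close> are the exponents of the invariants
  \<open>line_line\<close>, \<open>plane_plane\<close>, \<open>line_line_plane\<close> and \<open>line2_plane_plane\<close>, where \<open>i\<close> is the index that is
  missing or distinguished. At most one \<open>d\<^sub>i\<close> is needed: it absorbs the failure of the triangle
  inequality for the \<open>a\<^sub>i\<close>.\<close>

lemma triangle_decomposition:
  fixes b0 b1 b2 m0 m1 m2 :: nat
  assumes "b0 \<le> b1 + b2 + m0" "b1 \<le> b0 + b2 + m1" "b2 \<le> b0 + b1 + m2"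
    and "m0 + m1 + m2 > 0 \<or> even (b0 + b1 + b2)"
  shows "\<exists>c0 c1 c2 n0 n1 n2. c0 \<le> m0 \<and> c1 \<le> m1 \<and> c2 \<le> m2 \<and>
    b0 = n1 + n2 + c0 \<and> b1 = n0 + n2 + c1 \<and> b2 = n0 + n1 + c2"
proof -
  have tri: "\<exists>n0 n1 n2. x0 = n1 + n2 \<and> x1 = n0 + n2 \<and> x2 = n0 + n1"
    if t: "x0 \<le> x1 + x2" "x1 \<le> x0 + x2" "x2 \<le> x0 + x1" "even (x0 + x1 + x2)" for x0 x1 x2 :: nat
  proof -
    obtain s where s: "x0 + x1 + x2 = 2 * s" using t(4) by (elim evenE)
    then have "x0 \<le> s" "x1 \<le> s" "x2 \<le> s" using t by linarith+
    then show ?thesis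
      using s
      by - (rule exI[of _ "s - x0"], rule exI[of _ "s - x1"], rule exI[of _ "s - x2"],
          (intro conjI; linarith))
  qed
  \<comment> \<open>Trading a \<open>line_line\<close> for the \<open>line_line_plane\<close> with
    the same two lines keeps the \<open>a\<close>-degrees and raises one \<open>b\<close>-degree by
    1. Such trades, at most \<open>m0\<close>, \<open>m1\<close>, \<open>m2\<close> of them, repair
    a failing triangle inequality or a wrong parity.\<close>
  consider "b0 > b1 + b2" | "b1 > b0 + b2" | "b2 > b0 + b1" | "b0 \<le> b1 + b2" "b1 \<le> b0 + b2" "b2 \<le> b0 + b1"
    by linarith
  then show ?thesis
  proof cases
    case 1
    then show ?thesis using assms(1)
      by - (rule exI[of _ "b0 - b1 - b2"], rule exI[of _ 0], rule exI[of _ 0], rule exI[of _ 0],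
          rule exI[of _ b2], rule exI[of _ b1], (intro conjI; linarith))
  next
    case 2
    then show ?thesis using assms(2)
      by - (rule exI[of _ 0], rule exI[of _ "b1 - b0 - b2"], rule exI[of _ 0], rule exI[of _ b2],
          rule exI[of _ 0], rule exI[of _ b0], (intro conjI; linarith))
  next
    case 3
    then show ?thesis using assms(3)
      by - (rule exI[of _ 0], rule exI[of _ 0], rule exI[of _ "b2 - b0 - b1"], rule exI[of _ b1],
          rule exI[of _ b0], rule exI[of _ 0], (intro conjI; linarith))
  next
    case 4
    show ?thesis
    proof (cases "even (b0 + b1 + b2)")
      case True
      then obtain n0 n1 n2 where "b0 = n1 + n2" "b1 = n0 + n2" "b2 = n0 + n1"
        using tri[of b0 b1 b2] 4 by blast
      then show ?thesis
      by - (rule exI[of _ 0], rule exI[of _ 0], rule exI[of _ 0], rule exI[of _ n0], rule exI[of _ n1],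
          rule exI[of _ n2], (intro conjI; linarith))
    next
      case False
      \<comment> \<open>An odd perimeter excludes equality, so one side may be shortened by
        1.\<close>
      then have lt: "b0 < b1 + b2" "b1 < b0 + b2" "b2 < b0 + b1"
        using 4 by (auto simp: le_less)
      then have pos: "b0 > 0" "b1 > 0" "b2 > 0" by linarith+
      from False assms(4) consider "m0 > 0" | "m1 > 0" | "m2 > 0" by blast
      then show ?thesis
      proof cases
        case 1
        obtain c where c: "b0 = Suc c" using pos(1) gr0_implies_Suc by blast
        have "\<exists>n0 n1 n2. c = n1 + n2 \<and> b1 = n0 + n2 \<and> b2 = n0 + n1"
        proof (rule tri)
          show "even (c + b1 + b2)" using False c by simp
        qed (use lt c in linarith)+
        then obtain n0 n1 n2 where "c = n1 + n2" "b1 = n0 + n2" "b2 = n0 + n1" by blast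
        then show ?thesis using 1 c

      by - (rule exI[of _ 1], rule exI[of _ 0], rule exI[of _ 0], rule exI[of _ n0], rule exI[of _ n1],
          rule exI[of _ n2], (intro conjI; linarith))
      next
        case 2
        obtain c where c: "b1 = Suc c" using pos(2) gr0_implies_Suc by blast
        have "\<exists>n0 n1 n2. b0 = n1 + n2 \<and> c = n0 + n2 \<and> b2 = n0 + n1"
        proof (rule tri)
          show "even (b0 + c + b2)" using False c by simp
        qed (use lt c in linarith)+
        then obtain n0 n1 n2 where "b0 = n1 + n2" "c = n0 + n2" "b2 = n0 + n1" by blast
        then show ?thesis using 2 c

      by - (rule exI[of _ 0], rule exI[of _ 1], rule exI[of _ 0], rule exI[of _ n0], rule exI[of _ n1],
          rule exI[of _ n2], (intro conjI; linarith))
      next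
        case 3
        obtain c where c: "b2 = Suc c" using pos(3) gr0_implies_Suc by blast
        have "\<exists>n0 n1 n2. b0 = n1 + n2 \<and> b1 = n0 + n2 \<and> c = n0 + n1"
        proof (rule tri)
          show "even (b0 + b1 + c)" using False c by simp
        qed (use lt c in linarith)+
        then obtain n0 n1 n2 where "b0 = n1 + n2" "b1 = n0 + n2" "c = n0 + n1" by blast
        then show ?thesis using 3 c

      by - (rule exI[of _ 0], rule exI[of _ 0], rule exI[of _ 1], rule exI[of _ n0], rule exI[of _ n1],
          rule exI[of _ n2], (intro conjI; linarith))
      qed
    qed
  qed
qed

lemma cone_decomposition:
  fixes a0 a1 a2 b0 b1 b2 :: nat
  assumes even: "even (a0 + a1 + a2)"
    and x: "a0 + b0 \<le> a1 + b1 + (a2 + b2)" "a1 + b1 \<le> a0 + b0 + (a2 + b2)" "a2 + b2 \<le> a0 + b0 + (a1 + b1)"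
    and y: "b0 \<le> b1 + (a2 + b2)" "b0 \<le> b2 + (a1 + b1)" "b1 \<le> b0 + (a2 + b2)" "b1 \<le> b2 + (a0 + b0)"
      "b2 \<le> b0 + (a1 + b1)" "b2 \<le> b1 + (a0 + b0)"
    and xy: "a0 + 2 * b0 \<le> a1 + 2 * b1 + (a2 + 2 * b2)" "a1 + 2 * b1 \<le> a0 + 2 * b0 + (a2 + 2 * b2)"
      "a2 + 2 * b2 \<le> a0 + 2 * b0 + (a1 + 2 * b1)"
      "a0 \<le> a1 + a2 + 2 * b2" "a0 \<le> a1 + a2 + 2 * b1" "a1 \<le> a0 + a2 + 2 * b2" "a1 \<le> a0 + a2 + 2 * b0"
      "a2 \<le> a0 + a1 + 2 * b0" "a2 \<le> a0 + a1 + 2 * b1"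
    and par: "a0 > 0 \<and> a1 > 0 \<or> a0 > 0 \<and> a2 > 0 \<or> a1 > 0 \<and> a2 > 0 \<or> even (b0 + b1 + b2)"
  shows "\<exists>m0 m1 m2 n0 n1 n2 c0 c1 c2 d0 d1 d2.
    a0 = m1 + m2 + c1 + c2 + 2 * d0 \<and> a1 = m0 + m2 + c0 + c2 + 2 * d1 \<and> a2 = m0 + m1 + c0 + c1 + 2 * d2 \<and>
    b0 = n1 + n2 + c0 + d1 + d2 \<and> b1 = n0 + n2 + c1 + d0 + d2 \<and> b2 = n0 + n1 + c2 + d0 + (d1 :: nat)"
proof -
  \<comment> \<open>Here \<open>m0\<close>, \<open>m1\<close>, \<open>m2\<close> count both kinds of
    invariants that involve a pair of lines; \<open>c0\<close>, \<open>c1\<close>, \<open>c2\<close>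
    of them are split off afterwards.\<close>
  have combine: ?thesis
    if t: "a0 = m1 + m2 + 2 * d0" "a1 = m0 + m2 + 2 * d1" "a2 = m0 + m1 + 2 * d2"
      "b0 = b0' + d1 + d2" "b1 = b1' + d0 + d2" "b2 = b2' + d0 + d1"
      "b0' \<le> b1' + b2' + m0" "b1' \<le> b0' + b2' + m1" "b2' \<le> b0' + b1' + m2"
      "m0 + m1 + m2 > 0 \<or> even (b0' + b1' + b2')" for m0 m1 m2 d0 d1 d2 b0' b1' b2'
  proof -
    obtain c0 c1 c2 n0 n1 n2 where "c0 \<le> m0" "c1 \<le> m1" "c2 \<le> m2"
      "b0' = n1 + n2 + c0" "b1' = n0 + n2 + c1" "b2' = n0 + n1 + c2"
      using triangle_decomposition[OF t(7-10)] by blast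
    with t(1-6) show ?thesis

      by - (rule exI[of _ "m0 - c0"], rule exI[of _ "m1 - c1"], rule exI[of _ "m2 - c2"],
          rule exI[of _ n0], rule exI[of _ n1], rule exI[of _ n2], rule exI[of _ c0], rule exI[of _ c1],
          rule exI[of _ c2], rule exI[of _ d0], rule exI[of _ d1], rule exI[of _ d2],
          (intro conjI; linarith))
  qed
  obtain s where s: "a0 + a1 + a2 = 2 * s" using even by (elim evenE)
  consider "a0 > a1 + a2" | "a1 > a0 + a2" | "a2 > a0 + a1" | "a0 \<le> a1 + a2" "a1 \<le> a0 + a2" "a2 \<le> a0 + a1"
    by linarith
  then show ?thesis
  proof cases
    case 1
    define d where "d = s - a1 - a2"
    have d: "a0 = a1 + a2 + 2 * d" using 1 s by (simp add: d_def)
    have "d \<le> b1" "d \<le> b2" using d xy(5,4) by linarith+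
    then obtain e1 e2 where e: "b1 = e1 + d" "b2 = e2 + d"
      by (metis le_add_diff_inverse2)
    show ?thesis
    proof (rule combine[of a2 a1 d 0 0 0 b0 e1 e2])
      show "b0 \<le> e1 + e2 + 0" using x(1) d e by linarith
      show "e1 \<le> b0 + e2 + a2" using y(3) e by linarith
      show "e2 \<le> b0 + e1 + a1" using y(5) e by linarith
      show "0 + a2 + a1 > 0 \<or> even (b0 + e1 + e2)" using par d e by auto
    qed (use d e in simp_all)
  next
    case 2
    define d where "d = s - a0 - a2"
    have d: "a1 = a0 + a2 + 2 * d" using 2 s by (simp add: d_def)
    have "d \<le> b0" "d \<le> b2" using d xy(7,6) by linarith+
    then obtain e0 e2 where e: "b0 = e0 + d" "b2 = e2 + d"
      by (metis le_add_diff_inverse2)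
    show ?thesis
    proof (rule combine[of 0 a0 0 a2 d 0 e0 b1 e2])
      show "e0 \<le> b1 + e2 + a2" using y(1) e by linarith
      show "b1 \<le> e0 + e2 + 0" using x(2) d e by linarith
      show "e2 \<le> e0 + b1 + a0" using y(6) e by linarith
      show "a2 + 0 + a0 > 0 \<or> even (e0 + b1 + e2)" using par d e by auto
    qed (use d e in simp_all)
  next
    case 3
    define d where "d = s - a0 - a1"
    have d: "a2 = a0 + a1 + 2 * d" using 3 s by (simp add: d_def)
    have "d \<le> b0" "d \<le> b1" using d xy(8,9) by linarith+
    then obtain e0 e1 where e: "b0 = e0 + d" "b1 = e1 + d"
      by (metis le_add_diff_inverse2)
    show ?thesis
    proof (rule combine[of a0 0 0 a1 0 d e0 e1 b2])
      show "e0 \<le> e1 + b2 + a1" using y(2) e by linarith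
      show "e1 \<le> e0 + b2 + a0" using y(4) e by linarith
      show "b2 \<le> e0 + e1 + 0" using x(3) d e by linarith
      show "a1 + a0 + 0 > 0 \<or> even (e0 + e1 + b2)" using par d e by auto
    qed (use d e in simp_all)
  next
    case 4
    \<comment> \<open>Without excess the solution of \<open>a0 = m1 + m2\<close> and its
      permutations is \<open>m0 = s - a0\<close>, and likewise for \<open>m1\<close> and
      \<open>m2\<close>.\<close>
    then have "a0 \<le> s" "a1 \<le> s" "a2 \<le> s" using s by linarith+
    then obtain m0 m1 m2 where m: "s = a0 + m0" "s = a1 + m1" "s = a2 + m2"
      by (metis le_add_diff_inverse)
    show ?thesis
    proof (rule combine[of m1 m2 0 m0 0 0 b0 b1 b2])
      show "a0 = m1 + m2 + 2 * 0" "a1 = m0 + m2 + 2 * 0" "a2 = m0 + m1 + 2 * 0" using s m by linarith+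
      show "b0 \<le> b1 + b2 + m0" using xy(1) s m by linarith
      show "b1 \<le> b0 + b2 + m1" using xy(2) s m by linarith
      show "b2 \<le> b0 + b1 + m2" using xy(3) s m by linarith
      show "m0 + m1 + m2 > 0 \<or> even (b0 + b1 + b2)" using par s m by auto
    qed simp_all
  qed
qed

section \<open>Vanishing of invariants by parity\<close>

definition equivariant :: "weight \<Rightarrow> (complex mat \<Rightarrow> complex) \<Rightarrow> bool" where
  "equivariant l f \<longleftrightarrow> regular f \<and>
     (\<forall>b\<in>borel_lower. \<forall>g\<in>sp. f (b * g) = weight_char l (b $$ (0, 0)) (b $$ (1, 1)) * f g)"

lemma equivariant_regular: "equivariant l f \<Longrightarrow> regular f"
  by (simp add: equivariant_def)

lemma equivariant_borel:
  "equivariant l f \<Longrightarrow> b \<in> borel_lower \<Longrightarrow> g \<in> sp \<Longrightarrow>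
     f (b * g) = weight_char l (b $$ (0, 0)) (b $$ (1, 1)) * f g"
  by (simp add: equivariant_def)

lemma equivariant_unipotent:
  "equivariant l f \<Longrightarrow> b \<in> borel_lower \<Longrightarrow> b $$ (0, 0) = 1 \<Longrightarrow> b $$ (1, 1) = 1 \<Longrightarrow> g \<in> sp \<Longrightarrow> f (b * g) = f g"
  by (simp add: equivariant_borel weight_char_def)

lemma poly_eq_of_nonzero:
  fixes P Q :: "complex poly"
  assumes "\<And>e. e \<noteq> 0 \<Longrightarrow> poly P e = poly Q e"
  shows "P = Q"
proof -
  have "poly ([:0, 1:] * (P - Q)) e = 0" for e
    using assms[of e] by (cases "e = 0") auto
  then have "[:0, 1:] * (P - Q) = 0"
    using poly_all_0_iff_0 by blast
  then show ?thesis by simp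
qed

text \<open>Multiplied by the power \<open>degree Q\<close> of the variable, the right side becomes
  \<open>reflect_poly Q\<close>, of degree at most \<open>degree Q\<close>; this leaves degree 0 for
  \<open>P\<close>.\<close>

lemma poly_inverse_constant:
  fixes P Q :: "complex poly"
  assumes "\<And>e. e \<noteq> 0 \<Longrightarrow> poly P e = poly Q (inverse e)"
  shows "poly P x = poly P 0"
proof (cases "P = 0")
  case False
  have "monom 1 (degree Q) * P = reflect_poly Q"
    by (rule poly_eq_of_nonzero) (simp add: poly_monom poly_reflect_poly_nz assms)
  moreover have "degree (monom 1 (degree Q) * P) = degree Q + degree P"
    using False by (simp add: degree_mult_eq degree_monom_eq)
  ultimately have "degree P = 0"
    using degree_reflect_poly_le[of Q] by simp
  then obtain c where "P = [:c:]" by (rule degree_eq_zeroE)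
  then show ?thesis by simp
qed simp

lemma mult_curve_poly:
  assumes g: "g \<in> sp" and f: "regular f" and c: "\<And>e. c e \<in> sp"
    and L: "\<And>i j e. i < 4 \<Longrightarrow> j < 4 \<Longrightarrow> c e $$ (i, j) = poly (L ! i ! j) e"
  obtains P where "\<And>e. f (c e * g) = poly P e"
proof (rule regular_curve_poly[OF f])
  show "c e * g \<in> sp" for e by (intro sp_mult c g)
  fix i j :: nat assume ij: "i < 4" "j < 4"
  have "(c e * g) $$ (i, j) = poly ([:g $$ (0, j):] * L ! i ! 0 + [:g $$ (1, j):] * L ! i ! 1
      + [:g $$ (2, j):] * L ! i ! 2 + [:g $$ (3, j):] * L ! i ! 3) e" for e
    using ij by (simp add: mult_index_4 sp_carrier_mat[OF g] sp_carrier_mat[OF c] L mult.commute del: index_mult_mat(1))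
  then show "\<exists>P. \<forall>e. (c e * g) $$ (i, j) = poly P e" by blast
qed (rule that)

text \<open>A function on the projective line \<open>SL(2)/B\<close> that is regular in both affine charts is constant.\<close>

lemma levi_invariant:
  assumes f: "equivariant l f" and l: "fst l = snd l" and g: "g \<in> sp"
  shows "f (levi_upper x * g) = f g"
proof -
  \<comment> \<open>The chart at infinity: the block \<open>[[y, 1], [-1, 0]]\<close>, embedded in
    the Levi subgroup.\<close>
  define s where "s = (\<lambda>y. mat4 [[y,1,0,0],[-1,0,0,0],[0,0,y,-1],[0,0,1,0::complex]])"
  have s: "s y \<in> sp" for y by (simp add: s_def sp_iff_rows row_form_def)
  note reg = equivariant_regular[OF f]
  obtain P where P: "\<And>e. f (levi_upper e * g) = poly P e"
    by (rule mult_curve_poly[OF g reg unipotent_sp(1),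
          where L = "[[1,[:0,1:],0,0],[0,1,0,0],[0,0,1,[:0,-1:]],[0,0,0,1]]"])
      (auto simp: less_4_iff levi_upper_def)
  obtain Q where Q: "\<And>e. f (s e * g) = poly Q e"
    by (rule mult_curve_poly[OF g reg s, where L = "[[[:0,1:],1,0,0],[-1,0,0,0],[0,0,[:0,1:],-1],[0,0,1,0]]"])
      (auto simp: less_4_iff s_def)
  have "poly P e = poly Q (inverse e)" if e: "e \<noteq> 0" for e
  proof -
    \<comment> \<open>On the overlap the charts differ by a lower triangular element whose leading
      diagonal entries are \<open>e\<close> and \<open>inverse e\<close>; the character of
      \<open>l\<close> is trivial on it.\<close>
    define b where "b = mat4 [[e,0,0,0],[1,inverse e,0,0],[0,0,e,0],[0,0,-1,inverse e]]"
    have b: "b \<in> borel_lower" using e by (simp add: b_def borel_lower_def sp_iff_rows row_form_def)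
    have "levi_upper e = b * s (inverse e)"
      using e by (subst mat_eq_4_iff)
        (simp_all add: b_def s_def levi_upper_def all_less_4 mult_index_4 del: index_mult_mat(1))
    then have "levi_upper e * g = b * (s (inverse e) * g)"
      using sp_carrier_mat[OF g] sp_carrier_mat[OF s] sp_carrier_mat[OF borel_lower_sp[OF b]]
      by (simp add: assoc_mult_mat[of _ 4 4 _ 4 _ 4])
    then have "f (levi_upper e * g) = weight_char l e (inverse e) * f (s (inverse e) * g)"
      using equivariant_borel[OF f b sp_mult[OF s g]] by (simp add: b_def)
    moreover have "weight_char l e (inverse e) = 1"
      using e l by (simp add: weight_char_def power_int_inverse)
    ultimately show ?thesis using P Q by simp
  qed
  then have "poly P x = poly P 0" by (rule poly_inverse_constant)
  moreover have "levi_upper 0 = 1\<^sub>m 4" by (subst mat_eq_4_iff) (simp_all add: levi_upper_def all_less_4)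
  then have "levi_upper 0 * g = g" using sp_carrier_mat[OF g] by simp
  ultimately show ?thesis using P[of x] P[of 0] by simp
qed

text \<open>By equivariance and density it suffices to look at three Lagrangian planes in the normal form
  \<open>\<langle>e\<^sub>1, e\<^sub>2\<rangle>\<close>, \<open>\<langle>e\<^sub>3, e\<^sub>4\<rangle>\<close> and the graph of a symmetric form, together with a line in the last one.
  The reflection of the form that fixes this line preserves the configuration and has
  determinant \<open>-1\<close> on each of the planes.\<close>

lemma tri_equivariant_vanishes:
  fixes F :: "complex mat \<Rightarrow> complex mat \<Rightarrow> complex mat \<Rightarrow> complex"
  assumes inv: "\<And>g h k x. g \<in> sp \<Longrightarrow> h \<in> sp \<Longrightarrow> k \<in> sp \<Longrightarrow> x \<in> sp \<Longrightarrow> F (g * x) (h * x) (k * x) = F g h k"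
    and eq1: "\<And>h k. h \<in> sp \<Longrightarrow> k \<in> sp \<Longrightarrow> equivariant l1 (\<lambda>g. F g h k)"
    and eq2: "\<And>g k. g \<in> sp \<Longrightarrow> k \<in> sp \<Longrightarrow> equivariant l2 (\<lambda>h. F g h k)"
    and eq3: "\<And>g h. g \<in> sp \<Longrightarrow> h \<in> sp \<Longrightarrow> equivariant l3 (\<lambda>k. F g h k)"
    and l: "fst l1 = snd l1" "fst l2 = snd l2" "odd (snd l1 + snd l2 + snd l3)"
    and sp: "g \<in> sp" "h \<in> sp" "k \<in> sp"
  shows "F g h k = 0"
proof -
  let ?I = "1\<^sub>m 4 :: complex mat" and ?J = symp_form
  have J: "?J \<in> sp" by (rule unipotent_sp)
  have step1: "F ?I ?J (siegel_upper y z w) = 0" if z: "z \<noteq> 0" for y z w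
  proof -
    \<comment> \<open>Forced by the condition that right multiplication by \<open>m\<close> fixes
      the first row of \<open>siegel_upper y z w\<close>. The symmetric form has value
      \<open>z\<close> on this line, so the reflection exists when \<open>z\<close> is
      nonzero.\<close>
    define c where "c = 2 * y / z"
    define m where "m = mat4 [[1,0,0,0],[c,-1,0,0],[0,0,-1,0],[0,0,c,1]]"
    let ?S = "siegel_upper y z w" and ?t = "torus_elt 1 (- 1)"
    have m: "m \<in> borel_lower" by (simp add: m_def borel_lower_def sp_iff_rows row_form_def)
    have md: "m $$ (0, 0) = 1" "m $$ (1, 1) = - 1" by (simp_all add: m_def)
    have t: "?t \<in> borel_lower" by (simp add: torus_elt_mat4 borel_lower_def sp_iff_rows row_form_def)
    note ms = borel_lower_sp[OF m] and ts = borel_lower_sp[OF t] and S = unipotent_sp(3)[of y z w]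
    have comm: "?S * m = m * ?S"
      using z by (subst mat_eq_4_iff)
        (simp_all add: m_def siegel_upper_def all_less_4 mult_index_4 c_def field_simps del: index_mult_mat(1))
    \<comment> \<open>The line of the second flag moves inside its plane; as \<open>l2\<close> is a
      multiple of the second fundamental weight, \<open>levi_invariant\<close> absorbs this.\<close>
    have Jm: "?J * m = ?t * (levi_upper c * ?J)"
      by (subst mat_eq_4_iff)
        (simp_all add: m_def torus_elt_mat4 symp_form_mat4 levi_upper_def all_less_4 mult_index_4 del: index_mult_mat(1))
    have "F ?I ?J ?S = F (?I * m) (?J * m) (?S * m)"
      using inv[OF sp_one J S ms] by simp
    also have "\<dots> = F (m * ?I) (?t * (levi_upper c * ?J)) (m * ?S)"
      using ms by (simp add: sp_one_mult comm Jm)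
    also have "\<dots> = weight_char l1 1 (- 1) * F ?I (?t * (levi_upper c * ?J)) (m * ?S)"
      using equivariant_borel[OF eq1 m sp_one] ms ts J S by (simp add: md sp_mult unipotent_sp)
    also have "\<dots> = weight_char l1 1 (- 1) * (weight_char l2 1 (- 1) * F ?I (levi_upper c * ?J) (m * ?S))"
      using equivariant_borel[OF eq2 t, of ?I "m * ?S" "levi_upper c * ?J"] ms J S
      by (simp add: torus_elt_mat4 sp_mult unipotent_sp)
    also have "F ?I (levi_upper c * ?J) (m * ?S) = F ?I ?J (m * ?S)"
      using levi_invariant[OF eq2 l(2) J] ms S by (simp add: sp_mult)
    also have "F ?I ?J (m * ?S) = weight_char l3 1 (- 1) * F ?I ?J ?S"
      using equivariant_borel[OF eq3 m S, of ?I ?J] J by (simp add: m_def)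
    also have "weight_char l1 1 (- 1) * (weight_char l2 1 (- 1) * (weight_char l3 1 (- 1) * F ?I ?J ?S)) = - F ?I ?J ?S"
    proof -
      \<comment> \<open>Each flag contributes a power of -1 with exponent the second coordinate of
        its weight; their product is -1 by the parity assumption.\<close>
      have "weight_char l1 1 (- 1) * weight_char l2 1 (- 1) * weight_char l3 1 (- 1) = (- 1) powi (snd l1 + snd l2 + snd l3)"
        by (simp add: weight_char_def power_int_add)
      also have "\<dots> = - 1" using l(3) by (simp add: power_int_minus_left)
      finally have e: "weight_char l1 1 (- 1) * weight_char l2 1 (- 1) * weight_char l3 1 (- 1) = - 1" .
      have "weight_char l1 1 (- 1) * (weight_char l2 1 (- 1) * (weight_char l3 1 (- 1) * F ?I ?J ?S)) =
        weight_char l1 1 (- 1) * weight_char l2 1 (- 1) * weight_char l3 1 (- 1) * F ?I ?J ?S"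
        by (simp only: mult.assoc)
      then show ?thesis unfolding e by simp
    qed
    finally show ?thesis by simp
  qed
  \<comment> \<open>The value is polynomial in \<open>z\<close>, so vanishing for nonzero
    \<open>z\<close> extends to \<open>z = 0\<close>.\<close>
  have step2: "F ?I ?J (siegel_upper y z w) = 0" for y z w
  proof -
    obtain P where P: "\<And>e. F ?I ?J (siegel_upper y e w * ?I) = poly P e"
      by (rule mult_curve_poly[OF sp_one equivariant_regular[OF eq3[OF sp_one J]] unipotent_sp(3)[of y _ w],
            where L = "[[1,0,[:y:],[:0,1:]],[0,1,[:w:],[:y:]],[0,0,1,0],[0,0,0,1]]"])
        (auto simp: less_4_iff siegel_upper_def)
    have "P = 0"
      using P step1 by (intro poly_eq_of_nonzero) (metis poly_0 sp_one_mult(2) unipotent_sp(3))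
    then show ?thesis using P[of z] by (simp add: sp_one_mult unipotent_sp)
  qed
  \<comment> \<open>The Levi factor is transferred to the other flags: in the first it only moves
    the line inside its plane, which \<open>l1\<close> does not see, and in the second it becomes
    lower unipotent.\<close>
  have step3: "F ?I ?J (siegel_upper y z w * levi_upper x) = 0" for x y z w
  proof -
    let ?S = "siegel_upper y z w" and ?L = "levi_upper x" and ?L' = "levi_upper (- x)"
    note S = unipotent_sp(3)[of y z w] and L = unipotent_sp(1)[of x] and L' = unipotent_sp(1)[of "- x"]
    have LL: "?L * ?L' = ?I"
      by (subst mat_eq_4_iff) (simp_all add: levi_upper_def all_less_4 mult_index_4 del: index_mult_mat(1))
    have JL: "?J * ?L' = levi_lower x * ?J"
      by (subst mat_eq_4_iff)
        (simp_all add: symp_form_mat4 levi_upper_def levi_lower_def all_less_4 mult_index_4 del: index_mult_mat(1))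
    have low: "levi_lower x \<in> borel_lower" "levi_lower x $$ (0, 0) = 1" "levi_lower x $$ (1, 1) = 1"
      by (simp_all add: borel_lower_def unipotent_sp) (simp_all add: levi_lower_def)
    have "F ?I ?J (?S * ?L) = F (?I * ?L') (?J * ?L') ((?S * ?L) * ?L')"
      by (rule inv[symmetric]) (intro sp_one J sp_mult S L L')+
    also have "(?S * ?L) * ?L' = ?S" using S L L' by (simp add: sp_assoc LL sp_one_mult)
    also have "F (?I * ?L') (?J * ?L') ?S = F (?L' * ?I) (levi_lower x * ?J) ?S"
      using L' by (simp add: sp_one_mult JL)
    also have "\<dots> = F ?I (levi_lower x * ?J) ?S"
      using levi_invariant[OF eq1 l(1) sp_one] S J by (simp add: sp_mult unipotent_sp)
    also have "\<dots> = F ?I ?J ?S"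
      using equivariant_unipotent[OF eq2 low J] S by simp
    finally show ?thesis using step2 by simp
  qed
  have step4: "F ?I ?J k = 0" if "k \<in> sp" for k
  proof (rule big_cell_dense[OF equivariant_regular[OF eq3[OF sp_one J]] _ that])
    fix k assume k: "k \<in> sp" "k $$ (0, 0) \<noteq> 0" "row_minor 0 1 k \<noteq> 0"
    obtain b y z w x where b: "b \<in> borel_lower" "k = b * (siegel_upper y z w * levi_upper x)"
      using big_cell_factor[OF k] by metis
    show "F ?I ?J k = 0"
      unfolding b(2) using equivariant_borel[OF eq3[OF sp_one J] b(1)] step3 by (simp add: sp_mult unipotent_sp)
  qed
  \<comment> \<open>Density in the second slot, centred at \<open>symp_form\<close>. The unipotent
    part \<open>u\<close> is removed by translating with its transpose, which is lower unipotent and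
    so preserves the first flag.\<close>
  have step5: "F ?I (h * ?J) k = 0" if "h \<in> sp" "k \<in> sp" for h k
  proof (rule big_cell_dense[OF _ _ that(1)])
    show "regular (\<lambda>h. F ?I (h * ?J) k)"
      by (rule regular_right_translate[OF equivariant_regular[OF eq2[OF sp_one that(2)]] J])
    fix h assume h: "h \<in> sp" "h $$ (0, 0) \<noteq> 0" "row_minor 0 1 h \<noteq> 0"
    obtain b y z w x where b: "b \<in> borel_lower" "h = b * (siegel_upper y z w * levi_upper x)"
      using big_cell_factor[OF h] by metis
    define u where "u = siegel_upper y z w * levi_upper x"
    have u: "u \<in> max_unipotent" unfolding u_def by (intro max_unipotent_mult unipotent_max_unipotent)
    then have us: "u \<in> sp" by (simp add: max_unipotent_def)
    have uc: "u \<in> carrier_mat 4 4" by (rule sp_carrier_mat[OF us])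
    have ut: "transpose_mat u \<in> borel_lower" "transpose_mat u $$ (0, 0) = 1" "transpose_mat u $$ (1, 1) = 1"
      using u uc sp_transpose[OF us] by (simp_all add: borel_lower_def max_unipotent_def upper_triangular_4_iff all_less_4)
    note uts = borel_lower_sp[OF ut(1)]
    have uJ: "(u * ?J) * transpose_mat u = ?J" using us by (simp add: sp_iff_transpose)
    have "F ?I (h * ?J) k = F ?I (b * (u * ?J)) k"
      using b us J borel_lower_sp[OF b(1)] by (simp add: u_def[symmetric] sp_assoc)
    also have "\<dots> = weight_char l2 (b $$ (0, 0)) (b $$ (1, 1)) * F ?I (u * ?J) k"
      by (rule equivariant_borel[OF eq2[OF sp_one that(2)] b(1) sp_mult[OF us J]])
    also have "F ?I (u * ?J) k = F (?I * transpose_mat u) ((u * ?J) * transpose_mat u) (k * transpose_mat u)"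
      by (rule inv[symmetric]) (intro sp_one J sp_mult us uts that)+
    also have "\<dots> = F (transpose_mat u * ?I) ?J (k * transpose_mat u)"
      using uts unfolding uJ by (simp add: sp_one_mult)
    also have "\<dots> = F ?I ?J (k * transpose_mat u)"
      by (rule equivariant_unipotent[OF eq1[OF J sp_mult[OF that(2) uts]] ut sp_one])
    also have "\<dots> = 0" by (rule step4[OF sp_mult[OF that(2) uts]])
    finally show "F ?I (h * ?J) k = 0" by simp
  qed
  have step6: "F ?I h k = 0" if "h \<in> sp" "k \<in> sp" for h k
  proof -
    obtain J' where J': "J' \<in> sp" "J' * ?J = ?I" using sp_inverse[OF J] by metis
    have "(h * J') * ?J = h" using that J J' by (simp add: sp_assoc sp_one_mult)
    then show ?thesis using step5[OF sp_mult[OF that(1) J'(1)] that(2)] by simp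
  qed
  obtain g' where g': "g' \<in> sp" "g * g' = ?I" using sp_inverse[OF sp(1)] by metis
  have "F g h k = F (g * g') (h * g') (k * g')" using inv[OF sp g'(1)] by simp
  also have "\<dots> = 0" unfolding g'(2) by (intro step6 sp_mult sp g'(1))
  finally show ?thesis .
qed

section \<open>From invariant tensors to equivariant functions\<close>

text \<open>The vectors killed by all translates of the covector \<open>r\<close> form an invariant
  subspace.\<close>

lemma irrep_kernel_trivial:
  assumes "irreducible_rep n \<rho>"
  shows "(\<forall>w\<in>carrier_vec n. \<forall>g\<in>sp. pairing n r (\<rho> g *\<^sub>v w) = 0) \<or>
    (\<forall>w\<in>carrier_vec n. (\<forall>g\<in>sp. pairing n r (\<rho> g *\<^sub>v w) = 0) \<longrightarrow> w = 0\<^sub>v n)"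
proof -
  interpret rational_representation n \<rho>
    using assms by unfold_locales (simp add: irreducible_rep_def)
  let ?W = "{w \<in> carrier_vec n. \<forall>g\<in>sp. pairing n r (\<rho> g *\<^sub>v w) = 0}"
  have 0: "0\<^sub>v n \<in> ?W"
  proof -
    have "\<rho> g *\<^sub>v 0\<^sub>v n = 0\<^sub>v n" if "g \<in> sp" for g
      using carrier_rho[OF that] by (intro eq_vecI) auto
    then show ?thesis by (simp add: pairing_def)
  qed
  have add: "v + w \<in> ?W" if "v \<in> ?W" "w \<in> ?W" for v w
    using that by (simp add: mult_add_distrib_mat_vec[of _ n n] pairing_add)
  have smult: "c \<cdot>\<^sub>v w \<in> ?W" if "w \<in> ?W" for c w
    using that by (simp add: mult_mat_vec[of _ n n] pairing_smult)
  have W: "subspace_vec n ?W"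
    unfolding subspace_vec_def using 0 add smult by (intro conjI ballI allI Collect_restrict)
  have "\<forall>g\<in>sp. \<forall>w\<in>?W. \<rho> g *\<^sub>v w \<in> ?W"
    by (auto simp flip: rho_mult_vec simp: sp_mult)
  then have "?W = {0\<^sub>v n} \<or> ?W = carrier_vec n"
    using assms W unfolding irreducible_rep_def subspace_vec_iff by blast
  then show ?thesis by blast
qed

text \<open>The row \<open>p g\<close> is the limit covector \<xi> composed with the action of
  \<open>g\<close>. These rows turn vectors into equivariant functions, faithfully, and turn the
  action into right translation.\<close>

lemma irrep_covector_row:
  assumes "irrep_of_highest_weight l n \<rho>"
  shows "\<exists>p. (\<forall>w. equivariant l (\<lambda>g. \<Sum>i<n. p g i * w i)) \<and>
    (\<forall>w. (\<forall>g\<in>sp. (\<Sum>i<n. p g i * w i) = 0) \<longrightarrow> (\<forall>i<n. w i = 0)) \<and>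
    (\<forall>h\<in>sp. \<forall>x\<in>sp. \<forall>i<n. p (h * x) i = (\<Sum>j<n. p h j * \<rho> x $$ (j, i)))"
proof -
  obtain v where irr: "irreducible_rep n \<rho>" and v: "highest_weight_vector n \<rho> l v"
    using assms by (auto simp: irrep_of_highest_weight_def)
  interpret rational_representation n \<rho>
    using irr by unfold_locales (simp add: irreducible_rep_def)
  have vc: "v \<in> carrier_vec n" "v \<noteq> 0\<^sub>v n" using v by (auto simp: highest_weight_vector_def)
  have one: "\<rho> (1\<^sub>m 4) *\<^sub>v w = w" if "w \<in> carrier_vec n" for w using that by (simp add: rho_one)
  interpret highest_weight_cyclic n \<rho> l v
  proof
    fix r assume "\<And>g. g \<in> sp \<Longrightarrow> pairing n r (\<rho> g *\<^sub>v v) = 0"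
    then have "\<forall>w\<in>carrier_vec n. \<forall>g\<in>sp. pairing n r (\<rho> g *\<^sub>v w) = 0"
      using irrep_kernel_trivial[OF irr, of r] vc by blast
    then have z: "pairing n r w = 0" if "w \<in> carrier_vec n" for w
      using one that sp_one by metis
    show "\<forall>i<n. r i = 0"
    proof (intro allI impI)
      fix i assume i: "i < n"
      have "pairing n r (unit_vec n i) = (\<Sum>j<n. if j = i then r i else 0)"
        unfolding pairing_def using i by (intro sum.cong) auto
      then show "r i = 0" using z[of "unit_vec n i"] i by simp
    qed
  qed (rule v)
  obtain \<xi> where \<xi>: "\<And>b w. b \<in> borel_lower \<Longrightarrow> w \<in> carrier_vec n \<Longrightarrow>
       pairing n \<xi> (\<rho> b *\<^sub>v w) = weight_char l (b $$ (0, 0)) (b $$ (1, 1)) * pairing n \<xi> w"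
    "pairing n \<xi> v = 1"
    using highest_weight_covector by metis
  have nondeg: "w = 0\<^sub>v n" if "w \<in> carrier_vec n" "\<And>g. g \<in> sp \<Longrightarrow> pairing n \<xi> (\<rho> g *\<^sub>v w) = 0" for w
    using irrep_kernel_trivial[OF irr, of \<xi>] that \<xi>(2) vc one[OF vc(1)] sp_one by (metis zero_neq_one)
  define p where "p = (\<lambda>g i. \<Sum>k<n. \<xi> k * \<rho> g $$ (k, i))"
  have p: "(\<Sum>i<n. p g i * w i) = pairing n \<xi> (\<rho> g *\<^sub>v vec n w)" if "g \<in> sp" for g w
  proof -
    have "pairing n \<xi> (\<rho> g *\<^sub>v vec n w) = (\<Sum>k<n. \<Sum>i<n. \<xi> k * \<rho> g $$ (k, i) * w i)"
      unfolding pairing_def using that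
      by (intro sum.cong refl) (simp add: mult_mat_vec_index[of _ n] sum_distrib_left mult.assoc del: index_mult_mat_vec)
    also have "\<dots> = (\<Sum>i<n. p g i * w i)"
      unfolding p_def sum_distrib_right by (rule sum.swap)
    finally show ?thesis by simp
  qed
  show ?thesis
  proof (intro exI[of _ p] conjI allI ballI impI)
    show "equivariant l (\<lambda>g. \<Sum>i<n. p g i * w i)" for w
      unfolding equivariant_def
    proof (intro conjI ballI)
      have "regular (\<lambda>g. pairing n \<xi> (\<rho> g *\<^sub>v vec n w))" by (rule regular_pairing) simp
      then show "regular (\<lambda>g. \<Sum>i<n. p g i * w i)"
        by (rule iffD1[OF regular_cong, rotated]) (simp add: p)
      fix b g assume b: "b \<in> borel_lower" and g: "g \<in> sp"
      note bs = borel_lower_sp[OF b]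
      show "(\<Sum>i<n. p (b * g) i * w i) = weight_char l (b $$ (0, 0)) (b $$ (1, 1)) * (\<Sum>i<n. p g i * w i)"
        using bs g by (simp add: p sp_mult rho_mult_vec \<xi>(1)[OF b])
    qed
    show "w i = 0" if z: "\<forall>g\<in>sp. (\<Sum>i<n. p g i * w i) = 0" and i: "i < n" for w i
    proof -
      have "vec n w = 0\<^sub>v n" using z p by (intro nondeg) auto
      then have "vec n w $ i = 0\<^sub>v n $ i" by simp
      then show ?thesis using i by simp
    qed
    show "p (h * x) i = (\<Sum>j<n. p h j * \<rho> x $$ (j, i))" if "h \<in> sp" "x \<in> sp" "i < n" for h x i
    proof -
      have "\<rho> (h * x) $$ (k, i) = (\<Sum>j<n. \<rho> h $$ (k, j) * \<rho> x $$ (j, i))" if "k < n" for k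
        using carrier_rho[OF \<open>h \<in> sp\<close>] carrier_rho[OF \<open>x \<in> sp\<close>] \<open>i < n\<close> that
        by (simp add: rho_mult[OF \<open>h \<in> sp\<close> \<open>x \<in> sp\<close>] scalar_prod_def atLeast0LessThan)
      then have "p (h * x) i = (\<Sum>k<n. \<Sum>j<n. \<xi> k * \<rho> h $$ (k, j) * \<rho> x $$ (j, i))"
        by (simp add: p_def sum_distrib_left mult.assoc)
      also have "\<dots> = (\<Sum>j<n. p h j * \<rho> x $$ (j, i))"
        unfolding p_def sum_distrib_right by (rule sum.swap)
      finally show ?thesis .
    qed
  qed
qed

lemma sum_move_inside3:
  "(\<Sum>i\<in>I. \<Sum>j\<in>J. \<Sum>k\<in>K. \<Sum>a\<in>A. f i j k a) = (\<Sum>a\<in>A. \<Sum>i\<in>I. \<Sum>j\<in>J. \<Sum>k\<in>K. f i j k a)"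
proof -
  have "(\<Sum>i\<in>I. \<Sum>j\<in>J. \<Sum>k\<in>K. \<Sum>a\<in>A. f i j k a) = (\<Sum>i\<in>I. \<Sum>j\<in>J. \<Sum>a\<in>A. \<Sum>k\<in>K. f i j k a)"
    by (intro sum.cong refl sum.swap)
  also have "\<dots> = (\<Sum>i\<in>I. \<Sum>a\<in>A. \<Sum>j\<in>J. \<Sum>k\<in>K. f i j k a)"
    by (intro sum.cong refl sum.swap)
  also have "\<dots> = (\<Sum>a\<in>A. \<Sum>i\<in>I. \<Sum>j\<in>J. \<Sum>k\<in>K. f i j k a)"
    by (rule sum.swap)
  finally show ?thesis .
qed

lemma sum_swap3:
  "(\<Sum>i\<in>I. \<Sum>j\<in>J. \<Sum>k\<in>K. \<Sum>a\<in>A. \<Sum>b\<in>B. \<Sum>c\<in>C. f i j k a b c) =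
   (\<Sum>a\<in>A. \<Sum>b\<in>B. \<Sum>c\<in>C. \<Sum>i\<in>I. \<Sum>j\<in>J. \<Sum>k\<in>K. f i j k a b c)"
proof -
  have "(\<Sum>i\<in>I. \<Sum>j\<in>J. \<Sum>k\<in>K. \<Sum>a\<in>A. \<Sum>b\<in>B. \<Sum>c\<in>C. f i j k a b c) =
    (\<Sum>a\<in>A. \<Sum>i\<in>I. \<Sum>j\<in>J. \<Sum>k\<in>K. \<Sum>b\<in>B. \<Sum>c\<in>C. f i j k a b c)"
    by (rule sum_move_inside3)
  also have "\<dots> = (\<Sum>a\<in>A. \<Sum>b\<in>B. \<Sum>i\<in>I. \<Sum>j\<in>J. \<Sum>k\<in>K. \<Sum>c\<in>C. f i j k a b c)"
    by (intro sum.cong refl sum_move_inside3)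
  also have "\<dots> = (\<Sum>a\<in>A. \<Sum>b\<in>B. \<Sum>c\<in>C. \<Sum>i\<in>I. \<Sum>j\<in>J. \<Sum>k\<in>K. f i j k a b c)"
    by (intro sum.cong refl sum_move_inside3)
  finally show ?thesis .
qed

text \<open>\<open>F\<close> contracts an invariant tensor with three covector rows; it is nonzero
  because the rows are faithful, applied in one slot after another.\<close>

lemma Tens_tri_equivariant:
  assumes "(l1, l2, l3) \<in> Tens"
  obtains F g h k where
    "\<And>g h k x. g \<in> sp \<Longrightarrow> h \<in> sp \<Longrightarrow> k \<in> sp \<Longrightarrow> x \<in> sp \<Longrightarrow> F (g * x) (h * x) (k * x) = F g h k"
    "\<And>h k. equivariant l1 (\<lambda>g. F g h k)" "\<And>g k. equivariant l2 (\<lambda>h. F g h k)"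
    "\<And>g h. equivariant l3 (\<lambda>k. F g h k)"
    "g \<in> sp" "h \<in> sp" "k \<in> sp" "F g h k \<noteq> 0"
proof -
  obtain a b c \<rho> \<sigma> \<tau> where irr: "irrep_of_highest_weight l1 a \<rho>" "irrep_of_highest_weight l2 b \<sigma>"
    "irrep_of_highest_weight l3 c \<tau>"
    and ne: "invariants (a * b * c) (tensor_rep (tensor_rep \<rho> \<sigma>) \<tau>) \<noteq> {0\<^sub>v (a * b * c)}"
    using assms unfolding Tens_def by blast
  have reps: "rational_representation a \<rho>" "rational_representation b \<sigma>" "rational_representation c \<tau>"
    using irr by (auto simp: irrep_of_highest_weight_def irreducible_rep_def intro!: rational_representation.intro)
  note car = rational_representation.carrier_rho[OF reps(1)] rational_representation.carrier_rho[OF reps(2)]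
    rational_representation.carrier_rho[OF reps(3)]
  have "0\<^sub>v (a * b * c) \<in> invariants (a * b * c) (tensor_rep (tensor_rep \<rho> \<sigma>) \<tau>)"
    using invariants3_iff[of \<rho> a \<sigma> b \<tau> c "0\<^sub>v (a * b * c)"] car triple_index_less by simp
  then obtain t where t: "t \<in> invariants (a * b * c) (tensor_rep (tensor_rep \<rho> \<sigma>) \<tau>)" "t \<noteq> 0\<^sub>v (a * b * c)"
    using ne by blast
  have tc: "t \<in> carrier_vec (a * b * c)" using t(1) by (simp add: invariants_def)
  define T where "T = (\<lambda>i j k. t $ triple_index b c i j k)"
  have T: "(\<Sum>i'<a. \<Sum>j'<b. \<Sum>k'<c. \<rho> x $$ (i, i') * \<sigma> x $$ (j, j') * \<tau> x $$ (k, k') * T i' j' k') = T i j k"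
    if "x \<in> sp" "i < a" "j < b" "k < c" for x i j k
    using invariants3_iff[of \<rho> a \<sigma> b \<tau> c t] car tc t(1) that unfolding T_def by blast
  obtain p where p0: "(\<forall>w. equivariant l1 (\<lambda>g. \<Sum>i<a. p g i * w i)) \<and>
    (\<forall>w. (\<forall>g\<in>sp. (\<Sum>i<a. p g i * w i) = 0) \<longrightarrow> (\<forall>i<a. w i = 0)) \<and>
    (\<forall>h\<in>sp. \<forall>x\<in>sp. \<forall>i<a. p (h * x) i = (\<Sum>j<a. p h j * \<rho> x $$ (j, i)))"
    using irrep_covector_row[OF irr(1)] by (rule exE)
  note p = conjunct1[OF p0, rule_format] conjunct1[OF conjunct2[OF p0], rule_format]
    conjunct2[OF conjunct2[OF p0], rule_format]
  obtain q where q0: "(\<forall>w. equivariant l2 (\<lambda>g. \<Sum>i<b. q g i * w i)) \<and>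
    (\<forall>w. (\<forall>g\<in>sp. (\<Sum>i<b. q g i * w i) = 0) \<longrightarrow> (\<forall>i<b. w i = 0)) \<and>
    (\<forall>h\<in>sp. \<forall>x\<in>sp. \<forall>i<b. q (h * x) i = (\<Sum>j<b. q h j * \<sigma> x $$ (j, i)))"
    using irrep_covector_row[OF irr(2)] by (rule exE)
  note q = conjunct1[OF q0, rule_format] conjunct1[OF conjunct2[OF q0], rule_format]
    conjunct2[OF conjunct2[OF q0], rule_format]
  obtain r where r0: "(\<forall>w. equivariant l3 (\<lambda>g. \<Sum>i<c. r g i * w i)) \<and>
    (\<forall>w. (\<forall>g\<in>sp. (\<Sum>i<c. r g i * w i) = 0) \<longrightarrow> (\<forall>i<c. w i = 0)) \<and>
    (\<forall>h\<in>sp. \<forall>x\<in>sp. \<forall>i<c. r (h * x) i = (\<Sum>j<c. r h j * \<tau> x $$ (j, i)))"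
    using irrep_covector_row[OF irr(3)] by (rule exE)
  note r = conjunct1[OF r0, rule_format] conjunct1[OF conjunct2[OF r0], rule_format]
    conjunct2[OF conjunct2[OF r0], rule_format]
  define F where "F = (\<lambda>g h k. \<Sum>i<a. p g i * (\<Sum>j<b. q h j * (\<Sum>m<c. r k m * T i j m)))"
  \<comment> \<open>Equivariance in a slot is read off when the sum over that slot is
    outermost.\<close>
  have F2: "F g h k = (\<Sum>j<b. q h j * (\<Sum>i<a. p g i * (\<Sum>m<c. r k m * T i j m)))" for g h k
    unfolding F_def sum_distrib_left by (subst sum.swap) (simp add: mult_ac)
  have F3: "F g h k = (\<Sum>m<c. r k m * (\<Sum>j<b. q h j * (\<Sum>i<a. p g i * T i j m)))" for g h k
  proof -
    have "F g h k = (\<Sum>j<b. q h j * (\<Sum>m<c. r k m * (\<Sum>i<a. p g i * T i j m)))"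
      unfolding F2 sum_distrib_left by (rule sum.cong[OF refl], subst sum.swap) (simp add: mult_ac)
    also have "\<dots> = (\<Sum>m<c. r k m * (\<Sum>j<b. q h j * (\<Sum>i<a. p g i * T i j m)))"
      unfolding sum_distrib_left by (subst sum.swap) (simp add: mult_ac)
    finally show ?thesis .
  qed
  have F4: "F g h k = (\<Sum>i<a. \<Sum>j<b. \<Sum>m<c. p g i * q h j * r k m * T i j m)" for g h k
    unfolding F_def by (simp add: sum_distrib_left mult.assoc)
  have inv: "F (g * x) (h * x) (k * x) = F g h k" if "g \<in> sp" "h \<in> sp" "k \<in> sp" "x \<in> sp" for g h k x
  proof -
    let ?t = "\<lambda>i j m i' j' m'. (p g i' * q h j' * r k m') * (\<rho> x $$ (i', i) * \<sigma> x $$ (j', j) * \<tau> x $$ (m', m) * T i j m)"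
    have "p (g * x) i * q (h * x) j * r (k * x) m * T i j m = (\<Sum>i'<a. \<Sum>j'<b. \<Sum>m'<c. ?t i j m i' j' m')"
      if "i < a" "j < b" "m < c" for i j m
    proof -
      have "p (g * x) i * q (h * x) j * r (k * x) m * T i j m =
        (\<Sum>i'<a. p g i' * \<rho> x $$ (i', i)) * (\<Sum>j'<b. q h j' * \<sigma> x $$ (j', j)) * (\<Sum>m'<c. r k m' * \<tau> x $$ (m', m)) * T i j m"
        using that \<open>g \<in> sp\<close> \<open>h \<in> sp\<close> \<open>k \<in> sp\<close> \<open>x \<in> sp\<close> by (simp add: p(3) q(3) r(3))
      also have "\<dots> = (\<Sum>i'<a. \<Sum>j'<b. \<Sum>m'<c. ((p g i' * \<rho> x $$ (i', i)) * (q h j' * \<sigma> x $$ (j', j)) * (r k m' * \<tau> x $$ (m', m))) * T i j m)"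
        by (simp only: sum_distrib_right mult.assoc) (simp only: sum_distrib_left mult.assoc)
      finally show ?thesis by (simp add: mult_ac)
    qed
    then have "F (g * x) (h * x) (k * x) = (\<Sum>i<a. \<Sum>j<b. \<Sum>m<c. \<Sum>i'<a. \<Sum>j'<b. \<Sum>m'<c. ?t i j m i' j' m')"
      unfolding F4 by (intro sum.cong refl) auto
    also have "\<dots> = (\<Sum>i'<a. \<Sum>j'<b. \<Sum>m'<c. \<Sum>i<a. \<Sum>j<b. \<Sum>m<c. ?t i j m i' j' m')"
      by (rule sum_swap3)
    also have "\<dots> = F g h k"
      unfolding F4 sum_distrib_left[symmetric] using \<open>x \<in> sp\<close> by (intro sum.cong refl) (simp add: T)
    finally show ?thesis .
  qed
  have "\<exists>g\<in>sp. \<exists>h\<in>sp. \<exists>k\<in>sp. F g h k \<noteq> 0"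
  proof (rule ccontr)
    assume "\<not> ?thesis"
    then have "F g h k = 0" if "g \<in> sp" "h \<in> sp" "k \<in> sp" for g h k using that by blast
    then have "(\<Sum>j<b. q h j * (\<Sum>m<c. r k m * T i j m)) = 0" if "h \<in> sp" "k \<in> sp" "i < a" for h k i
      using that unfolding F_def by (intro p(2)[where w = "\<lambda>i. \<Sum>j<b. q h j * (\<Sum>m<c. r k m * T i j m)"]) auto
    then have "(\<Sum>m<c. r k m * T i j m) = 0" if "k \<in> sp" "i < a" "j < b" for k i j
      using that by (intro q(2)[where w = "\<lambda>j. \<Sum>m<c. r k m * T i j m"]) auto
    then have T0: "T i j m = 0" if "i < a" "j < b" "m < c" for i j m
      using that by (intro r(2)[where w = "\<lambda>m. T i j m"]) auto
    have "t $ s = 0" if "s < a * b * c" for s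
      using triple_index_surj[OF that] T0 unfolding T_def by metis
    then have "t = 0\<^sub>v (a * b * c)" using tc by (intro eq_vecI) auto
    then show False using t(2) by simp
  qed
  then obtain g h k where ghk: "g \<in> sp" "h \<in> sp" "k \<in> sp" "F g h k \<noteq> 0" by blast
  have e1: "equivariant l1 (\<lambda>g. F g h k)" for h k unfolding F_def by (rule p(1))
  have e2: "equivariant l2 (\<lambda>h. F g h k)" for g k unfolding F2 by (rule q(1))
  have e3: "equivariant l3 (\<lambda>k. F g h k)" for g h unfolding F3 by (rule r(1))
  show ?thesis by (rule that[OF inv e1 e2 e3 ghk])
qed

lemma Tens_parity:
  assumes T: "(l1, l2, l3) \<in> Tens"
    and m: "fst l1 = snd l1 \<and> fst l2 = snd l2 \<or> fst l1 = snd l1 \<and> fst l3 = snd l3 \<or> fst l2 = snd l2 \<and> fst l3 = snd l3"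
  shows "even (snd l1 + snd l2 + snd l3)"
proof (rule ccontr)
  assume odd: "odd (snd l1 + snd l2 + snd l3)"
  obtain F g h k where inv: "\<And>g h k x. g \<in> sp \<Longrightarrow> h \<in> sp \<Longrightarrow> k \<in> sp \<Longrightarrow> x \<in> sp \<Longrightarrow> F (g * x) (h * x) (k * x) = F g h k"
    and e: "\<And>h k. equivariant l1 (\<lambda>g. F g h k)" "\<And>g k. equivariant l2 (\<lambda>h. F g h k)"
      "\<And>g h. equivariant l3 (\<lambda>k. F g h k)"
    and ghk: "g \<in> sp" "h \<in> sp" "k \<in> sp" and ne: "F g h k \<noteq> 0"
    using Tens_tri_equivariant[OF T] by blast
  from m have "F g h k = 0"
  proof (elim disjE conjE)
    assume "fst l1 = snd l1" "fst l2 = snd l2"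
    then show ?thesis
      using odd by (intro tri_equivariant_vanishes[of F l1 l2 l3] inv e ghk) auto
  next
    assume "fst l1 = snd l1" "fst l3 = snd l3"
    then show ?thesis
      using odd by (intro tri_equivariant_vanishes[of "\<lambda>g k h. F g h k" l1 l3 l2] inv e ghk) (auto simp: add_ac)
  next
    assume "fst l2 = snd l2" "fst l3 = snd l3"
    then show ?thesis
      using odd by (intro tri_equivariant_vanishes[of "\<lambda>h k g. F g h k" l2 l3 l1] inv e ghk) (auto simp: add_ac)
  qed
  then show False using ne by simp
qed

section \<open>Integer coordinates and the case distinction\<close>

lemma multiple_of_fund_weight2_iff: "multiple_of_fund_weight2 l \<longleftrightarrow> fst l = snd l"
  by (auto simp: multiple_of_fund_weight2_def real_pt_def fund_weight2_def)

text \<open>The coordinates are those with respect to the fundamental weights: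
  \<open>a = x - y\<close> and \<open>b = y\<close>.\<close>

lemma triangle_cone_nat:
  assumes "((real (a0 + b0), real b0), (real (a1 + b1), real b1), (real (a2 + b2), real b2)) \<in> triangle_cone"
  shows "a0 + b0 \<le> a1 + b1 + (a2 + b2)" "a1 + b1 \<le> a0 + b0 + (a2 + b2)" "a2 + b2 \<le> a0 + b0 + (a1 + b1)"
    "b0 \<le> b1 + (a2 + b2)" "b0 \<le> b2 + (a1 + b1)" "b1 \<le> b0 + (a2 + b2)" "b1 \<le> b2 + (a0 + b0)"
      "b2 \<le> b0 + (a1 + b1)" "b2 \<le> b1 + (a0 + b0)"
    "a0 + 2 * b0 \<le> a1 + 2 * b1 + (a2 + 2 * b2)" "a1 + 2 * b1 \<le> a0 + 2 * b0 + (a2 + 2 * b2)"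
      "a2 + 2 * b2 \<le> a0 + 2 * b0 + (a1 + 2 * b1)"
      "a0 \<le> a1 + a2 + 2 * b2" "a0 \<le> a1 + a2 + 2 * b1" "a1 \<le> a0 + a2 + 2 * b2" "a1 \<le> a0 + a2 + 2 * b0"
      "a2 \<le> a0 + a1 + 2 * b0" "a2 \<le> a0 + a1 + 2 * b1"
proof -
  define L where "L = [(real (a0 + b0), real b0), (real (a1 + b1), real b1), (real (a2 + b2), real b2)]"
  define x where "x = (\<lambda>i. fst (L ! i))"
  define y where "y = (\<lambda>i. snd (L ! i))"
  have cone: "(\<forall>i j k. {i, j, k} = {0, 1, 2::nat} \<longrightarrow> x i \<le> x j + x k \<and> y i \<le> y j + x k) \<and>
      (\<forall>i<3. \<forall>j<3. x i + y j \<le> (\<Sum>i<3. x i + y i) / 2)"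
    using assms unfolding triangle_cone_def Let_def mem_Collect_eq prod.case x_def y_def L_def
    by (elim conjE) (intro conjI; assumption)
  have tri: "x i \<le> x j + x k \<and> y i \<le> y j + x k" if "{i, j, k} = {0, 1, 2::nat}" for i j k
    using conjunct1[OF cone] that by blast
  have S: "(\<Sum>i<3. x i + y i) = real (a0 + 2 * b0 + (a1 + 2 * b1) + (a2 + 2 * b2))"
    by (simp add: x_def y_def L_def numeral_3_eq_3 One_nat_def)
  have dia: "2 * (x i + y j) \<le> real (a0 + 2 * b0 + (a1 + 2 * b1) + (a2 + 2 * b2))" if "i < 3" "j < 3" for i j
  proof -
    have "x i + y j \<le> real (a0 + 2 * b0 + (a1 + 2 * b1) + (a2 + 2 * b2)) / 2"
      using conjunct2[OF cone] that unfolding S by blast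
    then show ?thesis by simp
  qed
  have perm: "{0, 2, 1} = {0, 1, 2::nat}" "{1, 0, 2} = {0, 1, 2::nat}" "{1, 2, 0} = {0, 1, 2::nat}"
    "{2, 0, 1} = {0, 1, 2::nat}" "{2, 1, 0} = {0, 1, 2::nat}" by auto
  note t = tri[OF refl] tri[OF perm(1)] tri[OF perm(2)] tri[OF perm(3)] tri[OF perm(4)] tri[OF perm(5)]
  have t': "real (a0 + b0) \<le> real (a1 + b1 + (a2 + b2))" "real (a1 + b1) \<le> real (a0 + b0 + (a2 + b2))"
    "real (a2 + b2) \<le> real (a0 + b0 + (a1 + b1))"
    "real b0 \<le> real (b1 + (a2 + b2))" "real b0 \<le> real (b2 + (a1 + b1))" "real b1 \<le> real (b0 + (a2 + b2))"
    "real b1 \<le> real (b2 + (a0 + b0))" "real b2 \<le> real (b0 + (a1 + b1))" "real b2 \<le> real (b1 + (a0 + b0))"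
    using t by (simp_all add: x_def y_def L_def)
  then show "a0 + b0 \<le> a1 + b1 + (a2 + b2)" "a1 + b1 \<le> a0 + b0 + (a2 + b2)" "a2 + b2 \<le> a0 + b0 + (a1 + b1)"
    "b0 \<le> b1 + (a2 + b2)" "b0 \<le> b2 + (a1 + b1)" "b1 \<le> b0 + (a2 + b2)" "b1 \<le> b2 + (a0 + b0)"
      "b2 \<le> b0 + (a1 + b1)" "b2 \<le> b1 + (a0 + b0)"
    unfolding of_nat_le_iff by blast+
  have d: "real (2 * (a0 + 2 * b0)) \<le> real (a0 + 2 * b0 + (a1 + 2 * b1) + (a2 + 2 * b2))"
    "real (2 * (a1 + 2 * b1)) \<le> real (a0 + 2 * b0 + (a1 + 2 * b1) + (a2 + 2 * b2))"
    "real (2 * (a2 + 2 * b2)) \<le> real (a0 + 2 * b0 + (a1 + 2 * b1) + (a2 + 2 * b2))"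
    "real (2 * (a0 + b0 + b1)) \<le> real (a0 + 2 * b0 + (a1 + 2 * b1) + (a2 + 2 * b2))"
    "real (2 * (a0 + b0 + b2)) \<le> real (a0 + 2 * b0 + (a1 + 2 * b1) + (a2 + 2 * b2))"
    "real (2 * (a1 + b1 + b0)) \<le> real (a0 + 2 * b0 + (a1 + 2 * b1) + (a2 + 2 * b2))"
    "real (2 * (a1 + b1 + b2)) \<le> real (a0 + 2 * b0 + (a1 + 2 * b1) + (a2 + 2 * b2))"
    "real (2 * (a2 + b2 + b0)) \<le> real (a0 + 2 * b0 + (a1 + 2 * b1) + (a2 + 2 * b2))"
    "real (2 * (a2 + b2 + b1)) \<le> real (a0 + 2 * b0 + (a1 + 2 * b1) + (a2 + 2 * b2))"
    using dia[of 0 0] dia[of 1 1] dia[of 2 2] dia[of 0 1] dia[of 0 2] dia[of 1 0] dia[of 1 2] dia[of 2 0] dia[of 2 1]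
    by (simp_all add: x_def y_def L_def)
  show "a0 + 2 * b0 \<le> a1 + 2 * b1 + (a2 + 2 * b2)" "a1 + 2 * b1 \<le> a0 + 2 * b0 + (a2 + 2 * b2)"
      "a2 + 2 * b2 \<le> a0 + 2 * b0 + (a1 + 2 * b1)"
      "a0 \<le> a1 + a2 + 2 * b2" "a0 \<le> a1 + a2 + 2 * b1" "a1 \<le> a0 + a2 + 2 * b2" "a1 \<le> a0 + a2 + 2 * b0"
      "a2 \<le> a0 + a1 + 2 * b0" "a2 \<le> a0 + a1 + 2 * b1"
    using d unfolding of_nat_le_iff by simp_all
qed

lemma chamber_nat:
  assumes "real_pt l \<in> chamber"
  obtains a b :: nat where "l = (int (a + b), int b)"
proof
  show "l = (int (nat (fst l - snd l) + nat (snd l)), int (nat (snd l)))"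
    using assms by (cases l) (simp add: real_pt_def chamber_def)
qed

lemma Tens_of_cone:
  fixes a0 a1 a2 b0 b1 b2 :: nat
  assumes cone: "((real (a0 + b0), real b0), (real (a1 + b1), real b1), (real (a2 + b2), real b2)) \<in> triangle_cone"
    and even: "even (a0 + a1 + a2)"
    and par: "a0 > 0 \<and> a1 > 0 \<or> a0 > 0 \<and> a2 > 0 \<or> a1 > 0 \<and> a2 > 0 \<or> even (b0 + b1 + b2)"
  shows "((int (a0 + b0), int b0), (int (a1 + b1), int b1), (int (a2 + b2), int b2)) \<in> Tens"
proof -
  obtain m0 m1 m2 n0 n1 n2 c0 c1 c2 d0 d1 d2 where dec:
    "a0 = m1 + m2 + c1 + c2 + 2 * d0" "a1 = m0 + m2 + c0 + c2 + 2 * d1" "a2 = m0 + m1 + c0 + c1 + 2 * d2"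
    "b0 = n1 + n2 + c0 + d1 + d2" "b1 = n0 + n2 + c1 + d0 + d2" "b2 = n0 + n1 + c2 + d0 + d1"
    using cone_decomposition[OF even triangle_cone_nat[OF cone] par] by blast
  obtain F where F: "tri_form (nth [a0, a1, a2]) (nth [b0, b1, b2]) F" "F generic_triple \<noteq> 0"
    by (rule tri_form_exists[of "nth [a0, a1, a2]" "nth [m0, m1, m2]" "nth [c0, c1, c2]" "nth [d0, d1, d2]"
          "nth [b0, b1, b2]" "nth [n0, n1, n2]"]) (simp_all add: dec)
  show ?thesis using Tens_of_tri_form[OF F] by simp
qed

lemma twice_weight_lattice_iff: "l \<in> twice_weight_lattice \<longleftrightarrow> even (fst l) \<and> even (snd l)"
proof
  assume "even (fst l) \<and> even (snd l)"
  then obtain x y where "fst l = 2 * x" "snd l = 2 * y" by (auto elim!: evenE)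
  then have "l = (x, y) + (x, y)" by (cases l) simp
  then show "l \<in> twice_weight_lattice" unfolding twice_weight_lattice_def by blast
qed (auto simp: twice_weight_lattice_def)

theorem theorem1p3:
  fixes lam \<mu> \<nu> :: weight
  assumes "(real_pt lam, real_pt \<mu>, real_pt \<nu>) \<in> triangle_cone"
    and "lam + \<mu> + \<nu> \<in> root_lattice"
  shows "(lam, \<mu>, \<nu>) \<in> Tens \<longleftrightarrow>
     length (filter (\<lambda>w. \<not> multiple_of_fund_weight2 w) [lam, \<mu>, \<nu>]) \<ge> 2 \<or>
     (length (filter multiple_of_fund_weight2 [lam, \<mu>, \<nu>]) \<ge> 2 \<and>
      lam + \<mu> + \<nu> \<in> twice_weight_lattice)"
proof -
  have chamber: "real_pt lam \<in> chamber" "real_pt \<mu> \<in> chamber" "real_pt \<nu> \<in> chamber"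
    using assms(1) by (simp_all add: triangle_cone_def)
  obtain a0 b0 where eq0: "lam = (int (a0 + b0), int b0)" using chamber_nat[OF chamber(1)] .
  obtain a1 b1 where eq1: "\<mu> = (int (a1 + b1), int b1)" using chamber_nat[OF chamber(2)] .
  obtain a2 b2 where eq2: "\<nu> = (int (a2 + b2), int b2)" using chamber_nat[OF chamber(3)] .
  note eq = eq0 eq1 eq2
  have cone: "((real (a0 + b0), real b0), (real (a1 + b1), real b1), (real (a2 + b2), real b2)) \<in> triangle_cone"
    using assms(1) by (simp add: eq real_pt_def)
  have sum: "lam + \<mu> + \<nu> = (int (a0 + a1 + a2) + int (b0 + b1 + b2), int (b0 + b1 + b2))"
    by (simp add: eq)
  \<comment> \<open>Since \<open>x + y = a + 2 * b\<close>, the root lattice condition is the parity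
    of the \<open>a\<close>-sum.\<close>
  have "even (int (a0 + a1 + a2) + 2 * int (b0 + b1 + b2))"
    using assms(2) unfolding sum root_lattice_def mem_Collect_eq prod.case by (simp only: mult_2 add.assoc)
  then have even: "even (a0 + a1 + a2)" by simp
  \<comment> \<open>As the \<open>a\<close>-sum is even, both coordinates of the sum have the parity
    of the \<open>b\<close>-sum.\<close>
  have twice: "lam + \<mu> + \<nu> \<in> twice_weight_lattice \<longleftrightarrow> even (b0 + b1 + b2)"
    using even unfolding sum twice_weight_lattice_iff by (simp only: fst_conv snd_conv even_add even_of_nat) simp
  have mult: "multiple_of_fund_weight2 lam \<longleftrightarrow> a0 = 0" "multiple_of_fund_weight2 \<mu> \<longleftrightarrow> a1 = 0"
    "multiple_of_fund_weight2 \<nu> \<longleftrightarrow> a2 = 0"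
    by (simp_all add: eq multiple_of_fund_weight2_iff)
  have parity: "even (b0 + b1 + b2)"
    if "(lam, \<mu>, \<nu>) \<in> Tens" "a0 = 0 \<and> a1 = 0 \<or> a0 = 0 \<and> a2 = 0 \<or> a1 = 0 \<and> a2 = 0"
  proof -
    have "even (snd lam + snd \<mu> + snd \<nu>)" using that by (intro Tens_parity) (auto simp: eq)
    then show ?thesis by (simp add: eq)
  qed
  have exists: "(lam, \<mu>, \<nu>) \<in> Tens"
    if "a0 > 0 \<and> a1 > 0 \<or> a0 > 0 \<and> a2 > 0 \<or> a1 > 0 \<and> a2 > 0 \<or> even (b0 + b1 + b2)"
    unfolding eq using cone even that by (rule Tens_of_cone)
  \<comment> \<open>With two of the \<open>a\<close> nonzero there is no obstruction; otherwise two
    of them vanish and the parity of the \<open>b\<close>-sum decides.\<close>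
  show ?thesis
    unfolding twice using parity exists
    by (cases "a0 = 0"; cases "a1 = 0"; cases "a2 = 0") (auto simp: mult)
qed

end
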